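(* Let $k$ be a field of arbitrary characteristic, let $B=k^{[3]}$ be the polynomial ring in three variables over $k$ and let $\delta\in\mathrm{EXP}(B)$. If the plinth ideal $\mathrm{pl}(\delta)$ contains a quasi-basic element of $B$, then $B^{\delta}=k^{[2]}$, i.e. $B^\delta$ is a polynomial ring in two variables over $k$.
   Context: An exponential map $\delta\in \mathrm{EXP}(B)$ on an integral domain $B$ containing $k$ is a family $\{D_n\}_{n\ge 0}$ of $k$-linear endomorphisms of $B$ such that: (1) $D_0=\mathrm{id}$; (2) for every $b\in B$ there is $n>0$ with $D_i(b)=0$ for all $i\ge n$; (3) $D_n(xy)=\sum_{i=0}^n D_i(x)D_{n-i}(y)$ for all $x,y\in B$, $n\ge 0$; (4) $D_j\circ D_i=\binom{i+j}{j}D_{i+j}$ for all $i,j\ge 0$. One also views $\delta$ as the $k$-algebra homomorphism $\delta:B\to B[t]$, $\delta(b)=\sum_n D_n(b)t^n$. The ring of invariants is $B^\delta=\{b\in B:\delta(b)=b\}$; $\delta$ is non-trivial if $B^\delta\ne B$. $lc_\delta(x)$ denotes the leading coefficient of $\delta(x)\in B[t]$ in $t$, i.e. $D_m(x)$ with $m=\deg_t\delta(x)$. A local slice of $\delta$ is an element $x\in B$ such that $\deg_t\delta(x)$ is positive and minimal among the positive $t$-degrees of elements $\delta(b)$, $b\in B$. The plinth ideal is $\mathrm{pl}(\delta)=\{lc_\delta(x): x \text{ a local slice of }\delta\}\cup\{0\}$, an ideal of $B^\delta$. A non-zero element $x\in B$ is quasi-basic if there are two non-trivial exponential maps $\alpha,\beta$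 of $B$ with $B^{\alpha}\neq B^{\beta}$ and $x\in B^{\alpha}\cap B^{\beta}$. *)

theory Defs
  imports Complex_Main "HOL-Computational_Algebra.Polynomial"
begin

text \<open>
  An integral domain \<open>'b\<close> containing a field \<open>'k\<close> is given by an embedding
  \<open>\<iota> :: 'k \<Rightarrow> 'b\<close>, and \<open>'b\<close> carries the scalar multiplication \<open>\<iota> c * x\<close>.
\<close>

definition scale_via :: "('k \<Rightarrow> 'b) \<Rightarrow> 'k \<Rightarrow> 'b \<Rightarrow> 'b::times" where
  "scale_via \<iota> c x = \<iota> c * x"

text \<open>
  Linearity over \<open>scale_via \<iota>\<close> includes that \<open>scale_via \<iota>\<close> is a vector space structure, which
  says exactly that \<open>\<iota>\<close> is a unital ring homomorphism (see \<open>vector_space_scale_via_iff\<close>).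
\<close>

definition exponential_map ::
  "('k::field \<Rightarrow> 'b::idom) \<Rightarrow> (nat \<Rightarrow> 'b \<Rightarrow> 'b) \<Rightarrow> bool" where
  "exponential_map \<iota> D \<longleftrightarrow>
     (\<forall>n. Vector_Spaces.linear (scale_via \<iota>) (scale_via \<iota>) (D n)) \<and>
     D 0 = id \<and>
     (\<forall>b. \<exists>n>0. \<forall>i\<ge>n. D i b = 0) \<and>
     (\<forall>n x y. D n (x * y) = (\<Sum>i=0..n. D i x * D (n - i) y)) \<and>
     (\<forall>i j x. D j (D i x) = of_nat ((i + j) choose j) * D (i + j) x)"

text \<open>
  The polynomial \<open>\<delta>(b) = \<Sum>n. D n b * t^n\<close>. The coefficient function has finite support when
  \<open>D\<close> is an exponential map, so that \<open>Abs_poly\<close> is then meaningful (see \<open>coeff_exp_poly\<close>).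
\<close>

definition exp_poly :: "(nat \<Rightarrow> 'b \<Rightarrow> 'b) \<Rightarrow> 'b \<Rightarrow> 'b::idom poly" where
  "exp_poly D b = Abs_poly (\<lambda>n. D n b)"

definition invariants :: "(nat \<Rightarrow> 'b \<Rightarrow> 'b) \<Rightarrow> 'b::idom set" where
  "invariants D = {b. exp_poly D b = [:b:]}"

definition nontrivial :: "(nat \<Rightarrow> 'b \<Rightarrow> 'b::idom) \<Rightarrow> bool" where
  "nontrivial D \<longleftrightarrow> invariants D \<noteq> UNIV"

definition local_slice :: "(nat \<Rightarrow> 'b \<Rightarrow> 'b) \<Rightarrow> 'b::idom \<Rightarrow> bool" where
  "local_slice D x \<longleftrightarrow>
     degree (exp_poly D x) > 0 \<and>
     (\<forall>b. degree (exp_poly D b) > 0 \<longrightarrow> degree (exp_poly D x) \<le> degree (exp_poly D b))"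

definition plinth :: "(nat \<Rightarrow> 'b \<Rightarrow> 'b) \<Rightarrow> 'b::idom set" where
  "plinth D = {lead_coeff (exp_poly D x) | x. local_slice D x} \<union> {0}"

definition quasi_basic :: "('k::field \<Rightarrow> 'b) \<Rightarrow> 'b::idom \<Rightarrow> bool" where
  "quasi_basic \<iota> x \<longleftrightarrow>
     x \<noteq> 0 \<and>
     (\<exists>\<alpha> \<beta>. exponential_map \<iota> \<alpha> \<and> exponential_map \<iota> \<beta> \<and>
            nontrivial \<alpha> \<and> nontrivial \<beta> \<and>
            invariants \<alpha> \<noteq> invariants \<beta> \<and>
            x \<in> invariants \<alpha> \<inter> invariants \<beta>)"

text \<open>
  The polynomial rings in two and three variables over \<open>'k\<close> are the types \<open>'k poly poly\<close> and
  \<open>'k poly poly poly\<close>, into which \<open>'k\<close> is embedded by the constant polynomials.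
\<close>

definition const2 :: "'k::field \<Rightarrow> 'k poly poly" where
  "const2 c = [:[:c:]:]"

definition const3 :: "'k::field \<Rightarrow> 'k poly poly poly" where
  "const3 c = [:[:[:c:]:]:]"

text \<open>\<open>A\<close> is the image of \<open>'k poly poly\<close> under an injective homomorphism of \<open>'k\<close>-algebras.\<close>

definition polynomial_ring2 :: "('k::field \<Rightarrow> 'b) \<Rightarrow> 'b::idom set \<Rightarrow> bool" where
  "polynomial_ring2 \<iota> A \<longleftrightarrow>
     (\<exists>\<phi> :: 'k poly poly \<Rightarrow> 'b.
        Vector_Spaces.linear (scale_via const2) (scale_via \<iota>) \<phi> \<and>
        \<phi> 1 = 1 \<and> (\<forall>p q. \<phi> (p * q) = \<phi> p * \<phi> q) \<and>
        bij_betw \<phi> UNIV A)"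

lemma vector_space_scale_via_iff:
  fixes \<iota> :: "'k::field \<Rightarrow> 'b::idom"
  shows "vector_space (scale_via \<iota>) \<longleftrightarrow>
    \<iota> 1 = 1 \<and> (\<forall>a b. \<iota> (a + b) = \<iota> a + \<iota> b) \<and> (\<forall>a b. \<iota> (a * b) = \<iota> a * \<iota> b)"
proof
  assume "vector_space (scale_via \<iota>)"
  then interpret vector_space "scale_via \<iota>" .
  show "\<iota> 1 = 1 \<and> (\<forall>a b. \<iota> (a + b) = \<iota> a + \<iota> b) \<and> (\<forall>a b. \<iota> (a * b) = \<iota> a * \<iota> b)"
    using scale_one[of 1] scale_left_distrib[of _ _ 1] scale_scale[of _ _ 1]
    by (simp add: scale_via_def)
qed (unfold_locales, simp_all add: scale_via_def algebra_simps)

lemma vector_space_const2: "vector_space (scale_via (const2 :: 'k::field \<Rightarrow> _))"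
  by (simp add: vector_space_scale_via_iff const2_def flip: one_pCons)

lemma vector_space_const3: "vector_space (scale_via (const3 :: 'k::field \<Rightarrow> _))"
  by (simp add: vector_space_scale_via_iff const3_def flip: one_pCons)

lemma coeff_exp_poly:
  assumes "exponential_map \<iota> D"
  shows "coeff (exp_poly D b) n = D n b"
proof -
  obtain m where "\<forall>i\<ge>m. D i b = 0"
    using assms unfolding exponential_map_def by blast
  then have "\<forall>\<^sub>\<infinity>i. D i b = 0"
    by (auto simp: MOST_nat_le)
  then show ?thesis
    by (simp add: exp_poly_def Abs_poly_inverse)
qed

end

(*
  Write A for the ring of invariants of D, let s be a local slice and c its leading coefficient,
  which is invariant under the two maps alpha, beta witnessing that c is quasi-basic.  A cannot lie
  in both of their rings of invariants, say A is moved by alpha.  After inverting c the polynomial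
  ring is A[s], and the top homogeneous part of alpha with respect to the s-degree is a non-trivial
  exponential map phi on A.  Its ring of invariants R has transcendence degree one, and over the
  field of fractions of R the ring A becomes a polynomial ring in one variable.

  R = k[f] with f of minimal positive total degree.  By base change to the algebraic closure, all
  elements f - lambda are prime there.  Choose y in A of minimal total degree generating A over
  Frac R.  If A were larger than R[y], then y would be congruent to a constant modulo some f - lambda;
  descending this to k gives y = t(f) + p(f) y' with p the minimal polynomial of lambda, and y' has
  smaller degree.  Hence A = k[f, y].
*)
theory Submission
  imports "HOL-Algebra.Algebraic_Closure_Type" Defs
begin

section \<open>Exponential maps on a subring\<close>

text \<open>If \<open>A\<close> lies in the invariants of a non-trivial map, the two rings coincide:
  any further invariant would make \<open>s\<close>, and then everything, algebraic over them. Two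
  different rings cannot both equal \<open>A\<close>, so one of the maps moves \<open>A\<close>.
  Invariance of \<open>c\<close> keeps that map compatible with inverting \<open>c\<close>. A top
  part needs a bounded growth rate, yet \<open>A\<close> is not known to be finitely generated; the
  rate is read off from the finitely many coefficients in the expansions of the three variables. It
  may be fractional, and then some steps contribute nothing at the top. In positive characteristic a
  local slice may have degree above one; vanishing binomial coefficients take the place of the
  derivation argument. Primality is wanted over the closure because a polynomial relation modulo a
  prime splits there into linear factors, which forces a residue to be constant; a linear functional
  on the closure carries the congruence back to \<open>k\<close>. Transcendence degree is replaced
  by counting monomials.\<close>

locale closed_subring =
  fixes A :: "'b::comm_ring_1 set"
  assumes one_closed [simp, intro]: "1 \<in> A"
    and add_closed [simp, intro]: "a \<in> A \<Longrightarrow> b \<in> A \<Longrightarrow> a + b \<in> A"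
    and mult_closed [simp, intro]: "a \<in> A \<Longrightarrow> b \<in> A \<Longrightarrow> a * b \<in> A"
    and uminus_closed [simp, intro]: "a \<in> A \<Longrightarrow> - a \<in> A"
begin

lemma diff_closed [simp, intro]: "a \<in> A \<Longrightarrow> b \<in> A \<Longrightarrow> a - b \<in> A"
  using add_closed[of a "- b"] by simp

lemma zero_closed [simp, intro]: "0 \<in> A"
  using diff_closed[of 1 1] by simp

lemma power_closed [simp, intro]: "a \<in> A \<Longrightarrow> a ^ n \<in> A"
  by (induction n) auto

lemma sum_closed [intro]: "(\<And>i. i \<in> I \<Longrightarrow> f i \<in> A) \<Longrightarrow> sum f I \<in> A"
  by (induction I rule: infinite_finite_induct) auto

end

definition polys_over :: "'b::zero set \<Rightarrow> 'b poly set" where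
  "polys_over U = {P. \<forall>i. coeff P i \<in> U}"

lemma polys_overI: "(\<And>i. coeff P i \<in> U) \<Longrightarrow> P \<in> polys_over U"
  by (simp add: polys_over_def)

lemma polys_overD: "P \<in> polys_over U \<Longrightarrow> coeff P i \<in> U"
  by (simp add: polys_over_def)

lemma polys_over_mono: "P \<in> polys_over U \<Longrightarrow> U \<subseteq> V \<Longrightarrow> P \<in> polys_over V"
  by (auto simp: polys_over_def)

lemma (in closed_subring) closed_subring_polys_over: "closed_subring (polys_over A)"
  by unfold_locales (auto simp: polys_over_def coeff_mult)

lemma (in closed_subring) polys_over_smult:
  "a \<in> A \<Longrightarrow> P \<in> polys_over A \<Longrightarrow> smult a P \<in> polys_over A"
  by (auto simp: polys_over_def)

lemma (in closed_subring) polys_over_monom: "a \<in> A \<Longrightarrow> monom a n \<in> polys_over A"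
  by (auto simp: polys_over_def)

lemma (in closed_subring) polys_over_const: "a \<in> A \<Longrightarrow> [:a:] \<in> polys_over A"
  by (auto simp: polys_over_def coeff_pCons split: nat.splits)

lemma (in closed_subring) poly_closed: "P \<in> polys_over A \<Longrightarrow> s \<in> A \<Longrightarrow> poly P s \<in> A"
  by (auto simp: poly_altdef polys_over_def)

text \<open>The axioms are relative to a subset because the theory is used twice: for the given map
  on the whole ring, and for the homogenized map, which acts only on a ring of invariants. Linearity
  over the field is carried separately by \<open>k_linear\<close>.\<close>

locale exp_map_on = closed_subring A for A :: "'b::idom set" +
  fixes D :: "nat \<Rightarrow> 'b \<Rightarrow> 'b"
  assumes D_closed [simp, intro]: "a \<in> A \<Longrightarrow> D n a \<in> A"
    and D_0 [simp]: "a \<in> A \<Longrightarrow> D 0 a = a"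
    and D_add: "a \<in> A \<Longrightarrow> b \<in> A \<Longrightarrow> D n (a + b) = D n a + D n b"
    and D_finite: "a \<in> A \<Longrightarrow> \<exists>n. \<forall>i\<ge>n. D i a = 0"
    and D_mult: "a \<in> A \<Longrightarrow> b \<in> A \<Longrightarrow> D n (a * b) = (\<Sum>i\<le>n. D i a * D (n - i) b)"
    and D_comp: "a \<in> A \<Longrightarrow> D j (D i a) = of_nat ((i + j) choose j) * D (i + j) a"
begin

abbreviation E :: "'b \<Rightarrow> 'b poly" where "E \<equiv> exp_poly D"
abbreviation dg :: "'b \<Rightarrow> nat" where "dg b \<equiv> degree (E b)"

lemma coeff_E: assumes "a \<in> A" shows "coeff (E a) n = D n a"
proof -
  from D_finite[OF assms] have "\<forall>\<^sub>\<infinity>i. D i a = 0"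
    by (auto simp: MOST_nat_le)
  then show ?thesis
    by (simp add: exp_poly_def Abs_poly_inverse)
qed

lemma E_add: "a \<in> A \<Longrightarrow> b \<in> A \<Longrightarrow> E (a + b) = E a + E b"
  by (intro poly_eqI) (simp add: coeff_E D_add)

lemma E_mult: "a \<in> A \<Longrightarrow> b \<in> A \<Longrightarrow> E (a * b) = E a * E b"
  by (intro poly_eqI) (simp add: coeff_E D_mult coeff_mult)

lemma E_eq_0_iff [simp]: assumes "a \<in> A" shows "E a = 0 \<longleftrightarrow> a = 0"
proof
  assume "E a = 0" then show "a = 0" using coeff_E[OF assms, of 0] assms by simp
next
  assume "a = 0"
  moreover have "E 0 + E 0 = E 0 + 0" using E_add[of 0 0] by simp
  then have "E 0 = 0" using add_left_imp_eq by blast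
  ultimately show "E a = 0" by simp
qed

lemma E_0 [simp]: "E 0 = 0" by simp

lemma D_zero [simp]: "D n 0 = 0"
  using coeff_E[of 0 n] by simp

lemma E_1 [simp]: "E 1 = 1"
proof -
  have "E 1 * E 1 = E 1 * 1" using E_mult[of 1 1] by simp
  moreover have "E 1 \<noteq> 0" by simp
  ultimately show ?thesis using mult_left_cancel by blast
qed

lemma E_power: "a \<in> A \<Longrightarrow> E (a ^ n) = E a ^ n"
  by (induction n) (simp_all add: E_mult)

lemma E_uminus: assumes "a \<in> A" shows "E (- a) = - E a"
proof -
  have "E (- a) + E a = 0" using E_add[of "- a" a] assms by simp
  then show ?thesis by (simp add: add_eq_0_iff2)
qed

lemma E_diff: "a \<in> A \<Longrightarrow> b \<in> A \<Longrightarrow> E (a - b) = E a - E b"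
  using E_add[of a "- b"] by (simp add: E_uminus)

lemma D_diff: "a \<in> A \<Longrightarrow> b \<in> A \<Longrightarrow> D n (a - b) = D n a - D n b"
  by (metis E_diff coeff_E coeff_diff diff_closed)

lemma dg_mult: "a \<in> A \<Longrightarrow> b \<in> A \<Longrightarrow> a \<noteq> 0 \<Longrightarrow> b \<noteq> 0 \<Longrightarrow> dg (a * b) = dg a + dg b"
  by (simp add: E_mult degree_mult_eq)

lemma dg_power: "a \<in> A \<Longrightarrow> dg (a ^ n) = n * dg a"
  by (cases "a = 0") (simp_all add: E_power degree_power_eq power_0_left)

lemma D_above_dg: "a \<in> A \<Longrightarrow> n > dg a \<Longrightarrow> D n a = 0"
  by (metis coeff_E coeff_eq_0)

lemma D_dg_nonzero: "a \<in> A \<Longrightarrow> a \<noteq> 0 \<Longrightarrow> D (dg a) a \<noteq> 0"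
  by (metis E_eq_0_iff coeff_E leading_coeff_0_iff)

lemma le_dg: "a \<in> A \<Longrightarrow> D n a \<noteq> 0 \<Longrightarrow> n \<le> dg a"
  using D_above_dg linorder_not_le by blast

lemma dg_leI: "a \<in> A \<Longrightarrow> (\<And>i. i > n \<Longrightarrow> D i a = 0) \<Longrightarrow> dg a \<le> n"
  by (intro degree_le) (simp add: coeff_E)

lemma dg_D_le: assumes "a \<in> A" shows "dg (D i a) \<le> dg a - i"
proof (rule dg_leI)
  fix j assume "j > dg a - i"
  then have "D (i + j) a = 0" using assms by (intro D_above_dg) auto
  then show "D j (D i a) = 0" using assms by (simp add: D_comp)
qed (use assms in auto)

text \<open>The constant coefficient of \<open>E a\<close> is \<open>a\<close>, so degree zero means
  invariance; see \<open>fixed_eq_invariants\<close>.\<close>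

definition fixed where "fixed = {a \<in> A. dg a = 0}"

lemma fixed_subset: "fixed \<subseteq> A" by (auto simp: fixed_def)

lemma fixedD: "a \<in> fixed \<Longrightarrow> n > 0 \<Longrightarrow> D n a = 0"
  using D_above_dg by (auto simp: fixed_def)

lemma fixedI: "a \<in> A \<Longrightarrow> (\<And>n. n > 0 \<Longrightarrow> D n a = 0) \<Longrightarrow> a \<in> fixed"
  using dg_leI[of a 0] by (auto simp: fixed_def)

lemma E_fixed: "a \<in> fixed \<Longrightarrow> E a = [:a:]"
  using fixed_subset by (intro poly_eqI) (auto simp: coeff_E coeff_pCons fixedD split: nat.splits)

lemma D_fixed_mult: assumes "a \<in> fixed" "b \<in> A" shows "D n (a * b) = a * D n b"
proof -
  have "a \<in> A" using assms fixed_subset by auto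
  have "E (a * b) = smult a (E b)" using assms \<open>a \<in> A\<close> by (simp add: E_mult E_fixed)
  then have "coeff (E (a * b)) n = a * coeff (E b) n" by simp
  then show ?thesis using assms \<open>a \<in> A\<close> by (simp add: coeff_E)
qed

sublocale fixed: closed_subring fixed
proof
  show "1 \<in> fixed" by (simp add: fixed_def)
  show "a + b \<in> fixed" if "a \<in> fixed" "b \<in> fixed" for a b
    using that degree_add_le[of "E a" 0 "E b"] by (auto simp: fixed_def E_add)
  show "a * b \<in> fixed" if "a \<in> fixed" "b \<in> fixed" for a b
    using that degree_mult_le[of "E a" "E b"] by (auto simp: fixed_def E_mult)
  show "- a \<in> fixed" if "a \<in> fixed" for a
    using that by (auto simp: fixed_def E_uminus)
qed

text \<open>Degrees add under multiplication in a domain, so a non-zero product of degree zero has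
  factors of degree zero.\<close>

lemma fixed_factorially_closed:
  assumes "a * b \<in> fixed" "a * b \<noteq> 0" "a \<in> A" "b \<in> A"
  shows "a \<in> fixed"
  using assms dg_mult[of a b] by (auto simp: fixed_def)

lemma D_dg_fixed: assumes "a \<in> A" "dg a \<le> n" shows "D n a \<in> fixed"
  using dg_D_le[OF assms(1), of n] assms by (auto simp: fixed_def)

text \<open>Different powers of \<open>s\<close> have different degrees and invariant coefficients
  do not change them, so nothing can cancel the leading term.\<close>

lemma dg_poly:
  assumes "P \<in> polys_over fixed" "s \<in> A" "dg s > 0"
  shows "dg (poly P s) = dg s * degree P"
    and "D (dg s * degree P) (poly P s) = lead_coeff P * D (dg s) s ^ degree P"
proof -
  have "dg (poly P s) = dg s * degree P \<and>
    D (dg s * degree P) (poly P s) = lead_coeff P * D (dg s) s ^ degree P"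
    using assms(1)
  proof (induction P)
    case 0 then show ?case by simp
  next
    case (pCons a P)
    have P: "P \<in> polys_over fixed"
      using polys_overD[OF pCons.prems, of "Suc _"] by (auto intro!: polys_overI)
    have a: "a \<in> fixed" using polys_overD[OF pCons.prems, of 0] by simp
    note IH = pCons.IH[OF P]
    have aA: "a \<in> A" using a fixed_subset by auto
    have pA: "poly P s \<in> A"
      using P assms(2) fixed_subset polys_over_mono poly_closed by blast
    show ?case
    proof (cases "P = 0")
      case True then show ?thesis using a aA by (simp add: fixed_def)
    next
      case False
      have nz: "s \<noteq> 0" using assms(3) by auto
      have nz': "poly P s \<noteq> 0"
      proof
        assume "poly P s = 0"
        then have "lead_coeff P * D (dg s) s ^ degree P = 0" using IH by simp
        then show False using False D_dg_nonzero[OF assms(2) nz] by simp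
      qed
      have d: "dg (s * poly P s) = dg s * Suc (degree P)"
        using dg_mult[OF assms(2) pA nz nz'] IH by simp
      have "E (poly (pCons a P) s) = E a + E (s * poly P s)"
        using aA pA assms by (simp add: E_add)
      also have "degree \<dots> = dg (s * poly P s)"
        using d a assms(3) by (intro degree_add_eq_right) (auto simp: fixed_def)
      finally have 1: "dg (poly (pCons a P) s) = dg s * degree (pCons a P)" using d False by simp
      have "D (dg s * Suc (degree P)) (poly (pCons a P) s) = D (dg s * Suc (degree P)) (s * poly P s)"
        using aA pA assms a by (simp add: D_add fixedD)
      also have "\<dots> = coeff (E s * E (poly P s)) (dg s + dg (poly P s))"
        using pA assms IH by (simp add: coeff_E flip: E_mult)
      also have "\<dots> = D (dg s) s * D (dg s * degree P) (poly P s)"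
        using coeff_mult_degree_sum[of "E s" "E (poly P s)"] pA assms IH by (simp add: coeff_E)
      also have "\<dots> = lead_coeff P * D (dg s) s ^ Suc (degree P)" using IH by (simp add: algebra_simps)
      finally show ?thesis using 1 False by simp
    qed
  qed
  then show "dg (poly P s) = dg s * degree P"
    "D (dg s * degree P) (poly P s) = lead_coeff P * D (dg s) s ^ degree P" by auto
qed

lemma transcendental:
  assumes "P \<in> polys_over fixed" "s \<in> A" "dg s > 0" "poly P s = 0"
  shows "P = 0"
proof -
  have "s \<noteq> 0" using assms(3) by auto
  then show ?thesis
    using dg_poly(2)[OF assms(1-3)] assms(4) D_dg_nonzero[OF assms(2)] by simp
qed

lemma fixed_algebraically_closed:
  assumes "P \<in> polys_over fixed" "P \<noteq> 0" "poly P s = 0" "s \<in> A"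
  shows "s \<in> fixed"
  using transcendental[of P s] assms by (auto simp: fixed_def)

text \<open>By minimality \<open>D i s\<close> is invariant, so \<open>D (dg s - i)\<close> kills
  it; the composition rule turns this into a binomial coefficient times the non-zero leading
  coefficient. In characteristic zero this forces \<open>dg s = 1\<close>, in characteristic p it
  makes \<open>dg s\<close> a power of p.\<close>

lemma binomial_vanishes:
  assumes s: "s \<in> A" "dg s > 0" "\<And>b. b \<in> A \<Longrightarrow> dg b > 0 \<Longrightarrow> dg s \<le> dg b"
    and i: "0 < i" "i < dg s"
  shows "(of_nat (dg s choose i) :: 'b) = 0"
proof -
  have "dg (D i s) < dg s" using dg_D_le[OF s(1), of i] i by simp
  then have "dg (D i s) = 0" using s(3)[of "D i s"] s(1) by fastforce
  then have "D (dg s - i) (D i s) = 0" using s(1) i by (intro D_above_dg) auto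
  then have "of_nat (dg s choose (dg s - i)) * D (dg s) s = 0"
    using i s(1) by (simp add: D_comp)
  moreover have "s \<noteq> 0" using s(2) by auto
  ultimately show ?thesis using D_dg_nonzero[OF s(1)] i binomial_symmetric[of i "dg s"] by simp
qed

text \<open>Compare coefficients in \<open>(1 + X) ^ m = (1 + X ^ n) ^ (m div n) * (1 + X) ^ (m mod n)\<close>.\<close>

lemma binomial_remainder:
  assumes "\<And>i. 0 < i \<Longrightarrow> i < n \<Longrightarrow> (of_nat (n choose i) :: 'b) = 0" "n > 0"
  shows "(of_nat (m choose (m mod n)) :: 'b) = 1"
proof -
  let ?L = "[:1, 1:] :: 'b poly"
  have L: "coeff (?L ^ j) i = of_nat (j choose i)" for j i
    using coeff_linear_poly_power[of i j 1 1] by (cases "i \<le> j") (auto simp: coeff_eq_0 degree_linear_power binomial_eq_0)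
  have Ln: "?L ^ n = 1 + monom 1 n"
  proof (rule poly_eqI)
    fix i show "coeff (?L ^ n) i = coeff (1 + monom 1 n) i"
      using assms by (cases "i = 0"; cases "i < n"; cases "i = n") (auto simp: L binomial_eq_0)
  qed
  have pw: "\<exists>Q. (1 + monom (1::'b) n) ^ q = 1 + monom 1 n * Q" for q
  proof (induction q)
    case 0 show ?case by (intro exI[of _ 0]) simp
  next
    case (Suc q)
    then obtain Q where "(1 + monom (1::'b) n) ^ q = 1 + monom 1 n * Q" by blast
    then show ?case by (intro exI[of _ "1 + Q + monom 1 n * Q"]) (simp add: algebra_simps)
  qed
  obtain Q where Q: "(1 + monom (1::'b) n) ^ (m div n) = 1 + monom 1 n * Q" using pw by blast
  have "?L ^ m = (?L ^ n) ^ (m div n) * ?L ^ (m mod n)"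
    by (metis mult_div_mod_eq power_add power_mult)
  also have "\<dots> = ?L ^ (m mod n) + monom 1 n * (Q * ?L ^ (m mod n))"
    unfolding Ln Q by (simp add: algebra_simps)
  finally have "coeff (?L ^ m) (m mod n) = coeff (?L ^ (m mod n)) (m mod n)"
    using assms(2) by (simp add: coeff_monom_mult not_le)
  then show ?thesis by (simp add: L)
qed

text \<open>With a remainder \<open>r > 0\<close>, the element \<open>D (dg b - r) b\<close> would
  have degree exactly \<open>r\<close>, because the binomial coefficient produced by
  \<open>D r\<close> is 1. That is smaller than the least positive degree.\<close>

lemma dg_dvd:
  assumes s: "s \<in> A" "dg s > 0" "\<And>b. b \<in> A \<Longrightarrow> dg b > 0 \<Longrightarrow> dg s \<le> dg b"
    and b: "b \<in> A"
  shows "dg s dvd dg b"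
proof (rule ccontr)
  assume "\<not> dg s dvd dg b"
  define r where "r = dg b mod dg s"
  have r: "0 < r" "r < dg s" "r \<le> dg b"
    using \<open>\<not> dg s dvd dg b\<close> s(2) unfolding r_def by (auto intro!: Nat.gr0I)
  have "b \<noteq> 0" using r by auto
  let ?b = "D (dg b - r) b"
  have "D r ?b = of_nat (dg b choose r) * D (dg b) b" using b r by (simp add: D_comp)
  also have "(of_nat (dg b choose r) :: 'b) = 1"
    unfolding r_def using binomial_vanishes[OF s] s(2) by (intro binomial_remainder) auto
  finally have "D r ?b \<noteq> 0" using D_dg_nonzero[OF b \<open>b \<noteq> 0\<close>] by simp
  then have "r \<le> dg ?b" using b by (intro le_dg) auto
  moreover have "dg ?b \<le> r" using dg_D_le[OF b, of "dg b - r"] r by simp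
  ultimately show False using s(3)[of ?b] b r by simp
qed

text \<open>Division with respect to the degree: since \<open>dg s\<close> divides
  \<open>dg b\<close>, a multiple of a power of \<open>s\<close> removes the top term after scaling
  by a power of the leading coefficient. Once that coefficient is inverted, the ring is a polynomial
  ring in \<open>s\<close> over the invariants.\<close>

theorem slice_expansion:
  assumes s: "s \<in> A" "dg s > 0" "\<And>b. b \<in> A \<Longrightarrow> dg b > 0 \<Longrightarrow> dg s \<le> dg b"
    and b: "b \<in> A"
  shows "\<exists>N. \<exists>P\<in>polys_over fixed. D (dg s) s ^ N * b = poly P s"
  using b
proof (induction "dg b" arbitrary: b rule: less_induct)
  case less
  let ?c = "D (dg s) s"
  interpret P: closed_subring "polys_over fixed" by (rule fixed.closed_subring_polys_over)
  have c: "?c \<in> fixed" using s(1) by (intro D_dg_fixed) auto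
  have cA: "?c \<in> A" using s(1) by auto
  show ?case
  proof (cases "dg b = 0")
    case True
    then have "b \<in> fixed" using less.prems by (simp add: fixed_def)
    then have "[:b:] \<in> polys_over fixed" by (rule fixed.polys_over_const)
    then show ?thesis by (intro exI[of _ 0] bexI[of _ "[:b:]"]) auto
  next
    case False
    obtain q where q: "dg b = dg s * q" using dg_dvd[OF s less.prems] by (auto elim: dvdE)
    let ?e = "D (dg b) b"
    have e: "?e \<in> fixed" using less.prems by (intro D_dg_fixed) auto
    have eA: "?e \<in> A" using less.prems by auto
    have sq: "D (dg b) (s ^ q) = ?c ^ q" "dg (s ^ q) = dg b"
      using dg_poly[OF fixed.polys_over_monom[OF fixed.one_closed, of q] s(1,2)] q
      by (simp_all add: poly_monom degree_monom_eq)
    \<comment> \<open>Both terms have the coefficient \<open>?c ^ q * ?e\<close> in degree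
      \<open>dg b\<close>, so the difference drops in degree.\<close>
    let ?b' = "?c ^ q * b - ?e * s ^ q"
    have cq: "?c ^ q \<in> fixed" using c by simp
    have b'A: "?b' \<in> A" using cA eA s(1) less.prems by auto
    have Db': "D n ?b' = ?c ^ q * D n b - ?e * D n (s ^ q)" for n
      using cA eA s(1) less.prems cq e by (simp add: D_diff D_fixed_mult)
    have "dg ?b' \<le> dg b - 1"
    proof (rule dg_leI[OF b'A])
      fix i assume i: "i > dg b - 1"
      show "D i ?b' = 0"
      proof (cases "i = dg b")
        case True then show ?thesis using sq by (simp add: Db')
      next
        case False
        then have "i > dg b" using i by simp
        then show ?thesis using sq s(1) less.prems by (simp add: Db' D_above_dg)
      qed
    qed
    then have "dg ?b' < dg b" using False by simp
    from less.hyps[OF this b'A] obtain N P where NP: "P \<in> polys_over fixed" "?c ^ N * ?b' = poly P s" by blast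
    have "?c ^ (N + q) * b = ?c ^ N * ?b' + ?c ^ N * ?e * s ^ q"
      by (simp add: algebra_simps power_add)
    also have "\<dots> = poly (P + monom (?c ^ N * ?e) q) s" using NP by (simp add: poly_monom)
    finally show ?thesis
      using NP(1) c e fixed.polys_over_monom[of "?c ^ N * ?e" q]
      by (intro exI[of _ "N + q"] bexI[of _ "P + monom (?c ^ N * ?e) q"]) auto
  qed
qed

end

section \<open>Homogenization of an exponential map\<close>

lemma closed_subring_Int: "closed_subring A \<Longrightarrow> closed_subring B \<Longrightarrow> closed_subring (A \<inter> B)"
  by (simp add: closed_subring_def)

text \<open>\<open>F\<close> is the map that moves the invariants of \<open>D\<close>. The sets
  \<open>k0\<close> and \<open>gens\<close> stand for the scalars and the variables: finite
  generation is assumed of the whole ring over common invariants, not of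
  \<open>\<delta>.fixed\<close>.\<close>

locale homogenization =
  \<delta>: exp_map_on UNIV D + \<alpha>: exp_map_on UNIV F
  for D F :: "nat \<Rightarrow> 'b::idom \<Rightarrow> 'b" +
  fixes k0 gens :: "'b set" and s :: 'b
  assumes slice: "\<delta>.dg s > 0" "\<And>b. \<delta>.dg b > 0 \<Longrightarrow> \<delta>.dg s \<le> \<delta>.dg b"
    and lead_fixed: "D (\<delta>.dg s) s \<in> \<alpha>.fixed"
    and generate: "\<And>U. closed_subring U \<Longrightarrow> k0 \<union> gens \<subseteq> U \<Longrightarrow> U = UNIV"
    and finite_gens: "finite gens"
    and k0: "k0 \<subseteq> \<delta>.fixed" "k0 \<subseteq> \<alpha>.fixed"
    and moves: "\<not> \<delta>.fixed \<subseteq> \<alpha>.fixed"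
begin

abbreviation "d \<equiv> \<delta>.dg"
abbreviation "n \<equiv> d s"
abbreviation "c \<equiv> D n s"

lemma c_fixed: "c \<in> \<delta>.fixed" by (intro \<delta>.D_dg_fixed) auto

lemma s_nonzero: "s \<noteq> 0" using slice(1) by auto

lemma c_nonzero: "c \<noteq> 0" using \<delta>.D_dg_nonzero[of s] s_nonzero by simp

lemma expansion: "\<exists>N. \<exists>P\<in>polys_over \<delta>.fixed. c ^ N * b = poly P s"
  using slice by (intro \<delta>.slice_expansion) auto

text \<open>The elements with such an expansion form a subring, because the denominators are powers
  of \<open>c\<close> and \<open>c\<close> lies in \<open>U\<close>; hence it suffices to look at
  generators.\<close>

lemma subring_expansion:
  assumes U: "closed_subring U" "k0 \<subseteq> U" "c \<in> U"
    and g: "\<And>x. x \<in> gens \<Longrightarrow> \<exists>N. \<exists>P\<in>polys_over U. c ^ N * x = poly P s"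
  shows "\<exists>N. \<exists>P\<in>polys_over U. c ^ N * b = poly P s"
proof -
  interpret U: closed_subring U by fact
  interpret P: closed_subring "polys_over U" by (rule U.closed_subring_polys_over)
  let ?S = "{b. \<exists>N. \<exists>P\<in>polys_over U. c ^ N * b = poly P s}"
  have const: "u \<in> ?S" if "u \<in> U" for u
    using U.polys_over_const[OF that] by (intro CollectI exI[of _ 0] bexI[of _ "[:u:]"]) auto
  have "closed_subring ?S"
  proof
    show "1 \<in> ?S" by (intro const) auto
    fix a assume "a \<in> ?S"
    then obtain N P where a: "P \<in> polys_over U" "c ^ N * a = poly P s" by blast
    then show "- a \<in> ?S"
      by (intro CollectI exI[of _ N] bexI[of _ "- P"]) auto
    fix b assume "b \<in> ?S"
    then obtain M Q where b: "Q \<in> polys_over U" "c ^ M * b = poly Q s" by blast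
    have "c ^ (N + M) * (a * b) = (c ^ N * a) * (c ^ M * b)"
      by (simp add: power_add algebra_simps)
    also have "\<dots> = poly (P * Q) s" using a b by simp
    finally show "a * b \<in> ?S" using a b by blast
    have "c ^ (N + M) * (a + b) = c ^ M * (c ^ N * a) + c ^ N * (c ^ M * b)"
      by (simp add: power_add algebra_simps)
    also have "\<dots> = poly (smult (c ^ M) P + smult (c ^ N) Q) s" using a b by simp
    finally show "a + b \<in> ?S"
      using a b U.polys_over_smult[OF U.power_closed[OF U(3)]] by blast
  qed
  moreover have "k0 \<union> gens \<subseteq> ?S" using const U(2) g by auto
  ultimately have "?S = UNIV" by (rule generate)
  then show ?thesis by blast
qed

text \<open>By transcendence of \<open>s\<close>, the expansion of an invariant is constant, and its
  coefficient lies in \<open>U\<close>. So a subring containing the coefficients of the generators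
  is all of \<open>\<delta>.fixed\<close> up to powers of \<open>c\<close>; this substitutes for
  finite generation.\<close>

lemma subring_absorbs:
  assumes U: "closed_subring U" "k0 \<subseteq> U" "c \<in> U" "U \<subseteq> \<delta>.fixed"
    and g: "\<And>x. x \<in> gens \<Longrightarrow> \<exists>N. \<exists>P\<in>polys_over U. c ^ N * x = poly P s"
    and a: "a \<in> \<delta>.fixed"
  shows "\<exists>N. c ^ N * a \<in> U"
proof -
  interpret P: closed_subring "polys_over \<delta>.fixed" by (rule \<delta>.fixed.closed_subring_polys_over)
  obtain N P where P: "P \<in> polys_over U" "c ^ N * a = poly P s"
    using subring_expansion[OF U(1-3) g, of a] by blast
  have ca: "c ^ N * a \<in> \<delta>.fixed" using a c_fixed by auto
  have "P - [:c ^ N * a:] = 0"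
    using P slice(1) U(4) \<delta>.fixed.polys_over_const[OF ca]
    by (intro \<delta>.transcendental[of _ s] P.diff_closed) (auto intro: polys_over_mono)
  then have "c ^ N * a = coeff P 0" by (metis coeff_pCons_0 eq_iff_diff_eq_0)
  then show ?thesis using P(1) by (metis polys_overD)
qed

text \<open>The rational slope \<open>u / v\<close> bounds the growth of the degree of \<open>F j b\<close> in \<open>j\<close>.\<close>

definition filt :: "nat \<Rightarrow> nat \<Rightarrow> nat \<Rightarrow> 'b set" where
  "filt u v m = {b. \<forall>j. v * d (F j b) \<le> m + u * j}"

lemma filt_add: assumes "a \<in> filt u v m" "b \<in> filt u v m" shows "a + b \<in> filt u v m"
  unfolding filt_def
proof (intro CollectI allI)
  fix j
  have "d (F j (a + b)) \<le> max (d (F j a)) (d (F j b))"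
    by (simp add: \<alpha>.D_add \<delta>.E_add degree_add_le_max)
  then have "v * d (F j (a + b)) \<le> max (v * d (F j a)) (v * d (F j b))"
    by (metis mult_le_mono2 nat_mult_max_right)
  also have "\<dots> \<le> m + u * j" using assms by (simp add: filt_def)
  finally show "v * d (F j (a + b)) \<le> m + u * j" .
qed

lemma d_mult_le: "d (a * b) \<le> d a + d b"
  by (simp add: \<delta>.E_mult degree_mult_le)

lemma d_sum_le: "finite I \<Longrightarrow> (\<And>i. i \<in> I \<Longrightarrow> v * d (f i) \<le> m) \<Longrightarrow> v * d (sum f I) \<le> m"
proof (induction I rule: finite_induct)
  case empty then show ?case by simp
next
  case (insert x I)
  have "d (f x + sum f I) \<le> max (d (f x)) (d (sum f I))"
    by (simp add: \<delta>.E_add degree_add_le_max)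
  then have "v * d (f x + sum f I) \<le> max (v * d (f x)) (v * d (sum f I))"
    by (metis mult_le_mono2 nat_mult_max_right)
  also have "\<dots> \<le> m" using insert by simp
  finally show ?case using insert by simp
qed

lemma filt_mult: assumes "a \<in> filt u v m" "b \<in> filt u v m'" shows "a * b \<in> filt u v (m + m')"
  unfolding filt_def
proof (intro CollectI allI)
  fix j
  have "v * d (F i a * F (j - i) b) \<le> m + m' + u * j" if "i \<le> j" for i
  proof -
    have "v * d (F i a * F (j - i) b) \<le> v * d (F i a) + v * d (F (j - i) b)"
      using mult_le_mono2[OF d_mult_le, of v] by (simp only: add_mult_distrib2)
    also have "\<dots> \<le> (m + u * i) + (m' + u * (j - i))"
      using assms by (intro add_mono) (auto simp: filt_def)
    also have "u * i + u * (j - i) = u * j" using that by (simp flip: add_mult_distrib2)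
    then have "(m + u * i) + (m' + u * (j - i)) = m + m' + u * j" by linarith
    finally show ?thesis .
  qed
  then show "v * d (F j (a * b)) \<le> m + m' + u * j"
    unfolding \<alpha>.D_mult[OF UNIV_I UNIV_I] by (intro d_sum_le) auto
qed

lemma filt_mono: "m \<le> m' \<Longrightarrow> filt u v m \<subseteq> filt u v m'"
  unfolding filt_def by (auto intro: order_trans[OF _ add_le_mono1])

lemma filt_fixed: assumes "a \<in> \<alpha>.fixed" shows "a \<in> filt u v (v * d a)"
proof -
  have "v * d (F j a) \<le> v * d a + u * j" for j
    using \<alpha>.fixedD[OF assms, of j] by (cases "j = 0") auto
  then show ?thesis by (simp add: filt_def)
qed

lemma filt_uminus: "a \<in> filt u v m \<Longrightarrow> - a \<in> filt u v m"
proof -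
  have "F j (- a) = - F j a" for j using \<alpha>.D_diff[of 0 a j] by simp
  then show "a \<in> filt u v m \<Longrightarrow> - a \<in> filt u v m" by (simp add: filt_def \<delta>.E_uminus)
qed

lemma filt_subring: "closed_subring (filt u v 0)"
proof
  show "1 \<in> filt u v 0" using filt_fixed[of 1] \<alpha>.fixed.one_closed by simp
  show "a * b \<in> filt u v 0" if "a \<in> filt u v 0" "b \<in> filt u v 0" for a b
    using filt_mult[OF that] by simp
qed (auto intro: filt_add filt_uminus)

text \<open>\<open>G\<close> collects the coefficients in the expansions of the generators. Together
  with \<open>k0\<close> and \<open>c\<close> it generates \<open>\<delta>.fixed\<close> up to
  powers of \<open>c\<close>, by \<open>subring_absorbs\<close>.\<close>

lemma coefficients_exist:
  "\<exists>G. finite G \<and> G \<subseteq> \<delta>.fixed \<and>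
    (\<forall>U x. G \<subseteq> U \<longrightarrow> 0 \<in> U \<longrightarrow> x \<in> gens \<longrightarrow> (\<exists>N. \<exists>P\<in>polys_over U. c ^ N * x = poly P s))"
proof -
  have "\<forall>x. \<exists>P. P \<in> polys_over \<delta>.fixed \<and> (\<exists>N. c ^ N * x = poly P s)" using expansion by blast
  from choice[OF this] obtain P
    where P: "\<And>x. P x \<in> polys_over \<delta>.fixed" "\<And>x. \<exists>N. c ^ N * x = poly (P x) s" by blast
  show ?thesis
  proof (intro exI[of _ "\<Union>x\<in>gens. coeff (P x) ` {..degree (P x)}"] conjI allI impI)
    show "(\<Union>x\<in>gens. coeff (P x) ` {..degree (P x)}) \<subseteq> \<delta>.fixed"
      using polys_overD[OF P(1)] by blast
    fix U x assume U: "(\<Union>x\<in>gens. coeff (P x) ` {..degree (P x)}) \<subseteq> U" "0 \<in> U" and x: "x \<in> gens"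
    have "coeff (P x) i \<in> U" for i
      using U x le_degree[of "P x" i] by (cases "coeff (P x) i = 0") auto
    then have "P x \<in> polys_over U" by (rule polys_overI)
    then show "\<exists>N. \<exists>P\<in>polys_over U. c ^ N * x = poly P s" using P(2)[of x] by blast
  qed (use finite_gens in simp)
qed

text \<open>The slope \<open>u / v\<close> is the maximum of \<open>(d (F j g) - d g) / j\<close>
  over the finitely many relevant pairs with \<open>g = s\<close> or \<open>g\<close> in
  \<open>G\<close>. Being a maximum it bounds the growth everywhere; being attained it keeps the top
  part from becoming trivial.\<close>

lemma weights_exist:
  obtains u v where "v > 0" "\<delta>.fixed \<subseteq> filt u v 0" "s \<in> filt u v (v * n)"
    "\<exists>g j. (g = s \<or> g \<in> \<delta>.fixed) \<and> j > 0 \<and> F j g \<noteq> 0 \<and> v * d (F j g) = v * d g + u * j"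
proof -
  obtain G where G: "finite G" "G \<subseteq> \<delta>.fixed" and G_all:
    "\<forall>U x. G \<subseteq> U \<longrightarrow> 0 \<in> U \<longrightarrow> x \<in> gens \<longrightarrow> (\<exists>N. \<exists>P\<in>polys_over U. c ^ N * x = poly P s)"
    using coefficients_exist by (elim exE conjE) (rule that)
  note G3 = G_all[rule_format]
  \<comment> \<open>Otherwise \<open>F\<close> would fix everything that \<open>G\<close> generates
    up to powers of \<open>c\<close>, and by factorial closedness all of
    \<open>\<delta>.fixed\<close>.\<close>
  have "\<not> G \<subseteq> \<alpha>.fixed"
  proof
    assume *: "G \<subseteq> \<alpha>.fixed"
    have sub: "closed_subring (\<alpha>.fixed \<inter> \<delta>.fixed)"
      by (intro closed_subring_Int \<alpha>.fixed.closed_subring_axioms \<delta>.fixed.closed_subring_axioms)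
    have "a \<in> \<alpha>.fixed" if a: "a \<in> \<delta>.fixed" for a
    proof -
      obtain N where N: "c ^ N * a \<in> \<alpha>.fixed \<inter> \<delta>.fixed"
        using subring_absorbs[OF sub _ _ _ G3 a] k0 c_fixed lead_fixed * G(2) by auto
      show ?thesis
      proof (cases "a = 0")
        case False
        then show ?thesis using N c_nonzero \<alpha>.fixed_factorially_closed[of a "c ^ N"] by (simp add: mult.commute)
      qed auto
    qed
    then show False using moves by blast
  qed
  then obtain g1 j1 where g1: "g1 \<in> G" "j1 > 0" "F j1 g1 \<noteq> 0" using \<alpha>.fixedI by blast
  define S where "S = {(g, j). g \<in> insert s G \<and> j > 0 \<and> F j g \<noteq> 0}"
  have "S \<subseteq> (SIGMA g:insert s G. {..\<alpha>.dg g})"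
    by (auto simp: S_def intro: \<alpha>.le_dg)
  then have fin: "finite S" using G(1) finite_subset by blast
  have g1S: "(g1, j1) \<in> S" using g1 by (auto simp: S_def)
  define r :: "'b \<times> nat \<Rightarrow> real" where "r = (\<lambda>(g, j). (real (d (F j g)) - real (d g)) / real j)"
  obtain g0 j0 where gj0: "(g0, j0) \<in> S" "r (g0, j0) = Max (r ` S)"
    using Max_in[of "r ` S"] fin g1S by (metis (no_types, lifting) empty_iff finite_imageI image_iff surj_pair)
  have max: "r (g, j) \<le> r (g0, j0)" if "(g, j) \<in> S" for g j
    using that fin gj0 by simp
  \<comment> \<open>\<open>g1\<close> has degree zero, so its slope cannot be negative. Hence the
    maximal slope is non-negative and \<open>u\<close> can be a natural number.\<close>
  have "0 \<le> r (g1, j1)" using g1 G(2) by (auto simp: r_def \<delta>.fixed_def)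
  also have "\<dots> \<le> r (g0, j0)" using max g1S by blast
  finally have nonneg: "d g0 \<le> d (F j0 g0)" using gj0 by (auto simp: r_def S_def divide_simps split: if_splits)
  define u v where "u = d (F j0 g0) - d g0" and "v = j0"
  have v: "v > 0" using gj0 by (auto simp: v_def S_def)
  have r0: "r (g0, j0) = real u / real v" using nonneg by (simp add: r_def u_def v_def)
  have bd: "v * d (F j g) \<le> v * d g + u * j" if g: "g \<in> insert s G" for g j
  proof (cases "j = 0 \<or> F j g = 0")
    case False
    then have "(g, j) \<in> S" using g by (auto simp: S_def)
    from max[OF this] r0 have "(real (d (F j g)) - real (d g)) / real j \<le> real u / real v" by (simp add: r_def)
    then have "real v * (real (d (F j g)) - real (d g)) \<le> real u * real j"
      using v False by (simp add: divide_simps mult.commute)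
    then have "real (v * d (F j g)) \<le> real (v * d g + u * j)" by (simp add: algebra_simps)
    then show ?thesis by linarith
  qed auto
  have "G \<subseteq> filt u v 0" using bd G(2) by (fastforce simp: filt_def \<delta>.fixed_def)
  have fsub: "closed_subring (filt u v 0 \<inter> \<delta>.fixed)"
    by (intro closed_subring_Int filt_subring \<delta>.fixed.closed_subring_axioms)
  have fixed0: "a \<in> filt u v 0" if "a \<in> \<alpha>.fixed" "a \<in> \<delta>.fixed" for a
    using filt_fixed[OF that(1), of u v] that(2) by (simp add: \<delta>.fixed_def)
  have absorb: "a \<in> filt u v 0" if a: "a \<in> \<delta>.fixed" for a
  proof -
    have "k0 \<subseteq> filt u v 0 \<inter> \<delta>.fixed" "c \<in> filt u v 0 \<inter> \<delta>.fixed" "G \<subseteq> filt u v 0 \<inter> \<delta>.fixed"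
      using k0 c_fixed lead_fixed \<open>G \<subseteq> filt u v 0\<close> G(2) fixed0
      by (blast, blast, blast)
    then obtain N where N: "c ^ N * a \<in> filt u v 0 \<inter> \<delta>.fixed"
      using subring_absorbs[OF fsub _ _ _ G3 a] closed_subring.zero_closed[OF fsub]
      by (metis (no_types, lifting) inf_le2)
    have cN: "c ^ N \<in> \<alpha>.fixed" "c ^ N \<in> \<delta>.fixed" using lead_fixed c_fixed by auto
    \<comment> \<open>A factor invariant under both maps changes none of these degrees, so the bound
      passes from \<open>c ^ N * a\<close> to \<open>a\<close>.\<close>
    have "d (F j a) = d (F j (c ^ N * a))" for j
    proof (cases "F j a = 0")
      case True then show ?thesis using \<alpha>.D_fixed_mult[OF cN(1)] by simp
    next
      case False
      then have "d (c ^ N * F j a) = d (c ^ N) + d (F j a)" using c_nonzero by (intro \<delta>.dg_mult) auto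
      then show ?thesis using \<alpha>.D_fixed_mult[OF cN(1)] cN(2) by (simp add: \<delta>.fixed_def)
    qed
    then show ?thesis using N by (simp add: filt_def)
  qed
  have attained: "v * d (F j0 g0) = v * d g0 + u * j0"
    using nonneg by (simp add: u_def v_def algebra_simps)
  show ?thesis
  proof (rule that[of v u])
    show "s \<in> filt u v (v * n)" using bd[of s] by (simp add: filt_def)
    show "\<exists>g j. (g = s \<or> g \<in> \<delta>.fixed) \<and> j > 0 \<and> F j g \<noteq> 0 \<and> v * d (F j g) = v * d g + u * j"
      using attained gj0 G(2) by (intro exI[of _ g0] exI[of _ j0]) (auto simp: S_def)
  qed (use v absorb in auto)
qed

end

section \<open>The top part of a map along a fixed slope\<close>

locale weighted_homogenization = homogenization +
  fixes u v :: nat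
  assumes v: "v > 0"
    and fixed_filt: "\<delta>.fixed \<subseteq> filt u v 0"
    and s_filt: "s \<in> filt u v (v * n)"
begin

lemma filt_poly:
  assumes P: "P \<in> polys_over \<delta>.fixed"
  shows "poly P s \<in> filt u v (v * (n * degree P))"
proof -
  interpret F: closed_subring "filt u v 0" by (rule filt_subring)
  have pw: "s ^ i \<in> filt u v (v * n * i)" for i
  proof (induction i)
    case 0 show ?case by simp
  next
    case (Suc i)
    then show ?case using filt_mult[OF s_filt Suc] by (simp add: algebra_simps)
  qed
  have "(\<Sum>i\<in>I. coeff P i * s ^ i) \<in> filt u v (v * (n * degree P))"
    if "finite I" "I \<subseteq> {..degree P}" for I
    using that
  proof (induction I rule: finite_induct)
    case empty
    have "0 \<in> filt u v (v * (n * degree P))" using filt_mono[of 0 "v * (n * degree P)"] F.zero_closed by blast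
    then show ?case by simp
  next
    case (insert i I)
    have "coeff P i * s ^ i \<in> filt u v (0 + v * n * i)"
      using polys_overD[OF P] fixed_filt by (intro filt_mult pw) auto
    moreover have "v * n * i \<le> v * (n * degree P)" using insert by simp
    ultimately have "coeff P i * s ^ i \<in> filt u v (v * (n * degree P))"
      using filt_mono by (metis add_0 subsetD)
    then show ?case using insert by (simp add: filt_add)
  qed
  then show ?thesis by (simp add: poly_altdef)
qed

lemma d_c_mult: "d (c ^ N * b) = d b"
proof (cases "b = 0")
  case False
  have "c ^ N \<in> \<delta>.fixed" using c_fixed by auto
  then show ?thesis using False c_nonzero by (simp add: \<delta>.dg_mult \<delta>.fixed_def)
qed simp

lemma F_c_mult: "F j (c ^ N * b) = c ^ N * F j b"
  using lead_fixed by (intro \<alpha>.D_fixed_mult) auto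

lemma D_c_mult: "D j (c ^ N * b) = c ^ N * D j b"
  using c_fixed by (intro \<delta>.D_fixed_mult) auto

text \<open>Up to a power of \<open>c\<close>, \<open>b\<close> is a polynomial in \<open>s\<close>
  over the invariants. By \<open>dg_poly\<close> its degree is that of the leading term, so the
  level supplied by \<open>filt_poly\<close> is exactly \<open>v * d b\<close>.\<close>

lemma bound: "v * d (F j b) \<le> v * d b + u * j"
proof -
  obtain N P where P: "P \<in> polys_over \<delta>.fixed" "c ^ N * b = poly P s" using expansion by blast
  have "d b = n * degree P" using \<delta>.dg_poly(1)[OF P(1) _ slice(1)] d_c_mult[of N b] P(2) by simp
  moreover have "v * d (F j (c ^ N * b)) \<le> v * (n * degree P) + u * j"
    using filt_poly[OF P(1)] P(2) by (simp add: filt_def)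
  ultimately show ?thesis by (simp add: F_c_mult d_c_mult)
qed

text \<open>
  For \<open>b\<close> of degree at most \<open>m\<close>, the degree of \<open>F j b\<close> is at most \<open>m + (u / v) * j\<close>;
  this is the coefficient of \<open>F j b\<close> in that top degree, and \<open>0\<close> if the degree is fractional.
\<close>

definition top_part :: "nat \<Rightarrow> nat \<Rightarrow> 'a \<Rightarrow> 'a" where
  "top_part m j b = (if v dvd u * j then D (m + u * j div v) (F j b) else 0)"

abbreviation Top :: "nat \<Rightarrow> 'a \<Rightarrow> 'a poly" where
  "Top m \<equiv> exp_poly (top_part m)"

lemma coeff_Top: "coeff (Top m b) j = top_part m j b"
proof -
  obtain N where "\<forall>i\<ge>N. F i b = 0" using \<alpha>.D_finite by blast
  then have "\<forall>i\<ge>N. top_part m i b = 0" by (simp add: top_part_def)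
  then have "\<forall>\<^sub>\<infinity>i. top_part m i b = 0" unfolding MOST_nat_le by blast
  then show ?thesis by (simp add: exp_poly_def Abs_poly_inverse)
qed

lemma Top_add: "Top m (a + b) = Top m a + Top m b"
  by (intro poly_eqI) (simp add: coeff_Top top_part_def \<alpha>.D_add \<delta>.D_add)

lemma Top_low: assumes "d b < m" shows "Top m b = 0"
proof (intro poly_eqI)
  fix j
  have "top_part m j b = 0"
  proof (cases "v dvd u * j")
    case True
    then obtain q where q: "u * j = v * q" by (auto elim: dvdE)
    have "v * d (F j b) \<le> v * d b + v * q" using bound[of j b] q by simp
    also have "\<dots> < v * (m + q)" using assms v by (simp add: algebra_simps)
    finally have "d (F j b) < m + q" by simp
    then show ?thesis using q v by (simp add: top_part_def \<delta>.D_above_dg)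
  qed (simp add: top_part_def)
  then show "coeff (Top m b) j = coeff 0 j" by (simp add: coeff_Top)
qed

lemma Top_fixed: assumes "b \<in> \<alpha>.fixed" shows "Top m b = [:D m b:]"
proof (intro poly_eqI)
  fix j show "coeff (Top m b) j = coeff [:D m b:] j"
    using \<alpha>.fixedD[OF assms, of j] by (cases j) (auto simp: coeff_Top top_part_def)
qed

lemma Top_nonzero: assumes "b \<noteq> 0" shows "Top (d b) b \<noteq> 0"
proof -
  have "coeff (Top (d b) b) 0 = D (d b) b" by (simp add: coeff_Top top_part_def)
  then show ?thesis using \<delta>.D_dg_nonzero[of b] assms by auto
qed

text \<open>In the product rule for \<open>D\<close> and \<open>F\<close>, a summand survives at the
  top level only if both factors reach their bounds. If the level is integral but the bounds of the
  factors are fractional, none survives, in accordance with the value 0 in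
  \<open>top_part\<close>.\<close>

lemma Top_mult:
  assumes a: "d a \<le> m" and b: "d b \<le> m'"
  shows "Top (m + m') (a * b) = Top m a * Top m' b"
proof (intro poly_eqI)
  fix j
  have split_j: "u * i + u * (j - i) = u * j" if "i \<le> j" for i
    using that by (simp flip: add_mult_distrib2)
  have ba: "v * d (F i a) \<le> v * m + u * i" for i
    using bound[of i a] mult_le_mono2[OF a, of v] by linarith
  have bb: "v * d (F i b) \<le> v * m' + u * i" for i
    using bound[of i b] mult_le_mono2[OF b, of v] by linarith
  have "top_part (m + m') j (a * b) = (\<Sum>i\<le>j. top_part m i a * top_part m' (j - i) b)"
  proof (cases "v dvd u * j")
    case False
    have "top_part m i a * top_part m' (j - i) b = 0" if "i \<le> j" for i
    proof -
      have "\<not> (v dvd u * i \<and> v dvd u * (j - i))"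
        using False split_j[OF that] dvd_add by metis
      then show ?thesis by (auto simp: top_part_def)
    qed
    then have "(\<Sum>i\<le>j. top_part m i a * top_part m' (j - i) b) = 0" by (intro sum.neutral) simp
    then show ?thesis using False by (simp add: top_part_def)
  next
    case True
    then obtain q where q: "u * j = v * q" by (auto elim: dvdE)
    let ?M = "m + m' + q"
    have inner: "(\<Sum>l\<le>?M. D l (F i a) * D (?M - l) (F (j - i) b)) = top_part m i a * top_part m' (j - i) b"
      if i: "i \<le> j" for i
    proof -
      \<comment> \<open>Non-zero factors keep \<open>l\<close> and \<open>?M - l\<close> below
        bounds that add up to \<open>?M\<close>, so both bounds are attained.\<close>
      have key: "v * l = v * m + u * i"
        if nz: "D l (F i a) \<noteq> 0" "D (?M - l) (F (j - i) b) \<noteq> 0" and l: "l \<le> ?M" for l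
      proof -
        have "v * l \<le> v * m + u * i" using \<delta>.le_dg[OF _ nz(1)] ba[of i] mult_le_mono2 order_trans by blast
        moreover have "v * (?M - l) \<le> v * m' + u * (j - i)"
          using \<delta>.le_dg[OF _ nz(2)] bb[of "j - i"] mult_le_mono2 order_trans by blast
        moreover have "v * l + v * (?M - l) = v * m + v * m' + v * q"
          using l by (simp flip: add_mult_distrib2)
        ultimately show ?thesis using split_j[OF i] q by linarith
      qed
      show ?thesis
      proof (cases "v dvd u * i")
        case False
        have "D l (F i a) * D (?M - l) (F (j - i) b) = 0" if "l \<le> ?M" for l
        proof (rule ccontr)
          assume "D l (F i a) * D (?M - l) (F (j - i) b) \<noteq> 0"
          then have "v * l = v * m + u * i" using key[of l] that by auto
          then have "v dvd u * i" by (metis dvd_add_right_iff dvd_triv_left)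
          then show False using False by blast
        qed
        then have "(\<Sum>l\<le>?M. D l (F i a) * D (?M - l) (F (j - i) b)) = 0" by (intro sum.neutral) simp
        then show ?thesis using False by (simp add: top_part_def)
      next
        case True
        then obtain p where p: "u * i = v * p" by (auto elim: dvdE)
        have pq: "p \<le> q" using split_j[OF i] p q v by (metis le_add1 mult_le_cancel1)
        have r: "u * (j - i) = v * (q - p)" using split_j[OF i] p q pq
          by (metis add_diff_cancel_left' diff_mult_distrib2)
        have "(\<Sum>l\<le>?M. D l (F i a) * D (?M - l) (F (j - i) b)) =
          (\<Sum>l\<in>{m + p}. D l (F i a) * D (?M - l) (F (j - i) b))"
        proof (rule sum.mono_neutral_right)
          show "\<forall>l\<in>{..?M} - {m + p}. D l (F i a) * D (?M - l) (F (j - i) b) = 0"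
          proof (intro ballI, rule ccontr)
            fix l assume l: "l \<in> {..?M} - {m + p}" "D l (F i a) * D (?M - l) (F (j - i) b) \<noteq> 0"
            then have "v * l = v * m + v * p" using key[of l] p by auto
            then have "v * l = v * (m + p)" by (simp add: add_mult_distrib2)
            then show False using l v by simp
          qed
        qed (use pq in auto)
        also have "\<dots> = D (m + p) (F i a) * D (?M - (m + p)) (F (j - i) b)" by simp
        also have "?M - (m + p) = m' + (q - p)" using pq by simp
        finally show ?thesis using p r v by (simp add: top_part_def)
      qed
    qed
    have "top_part (m + m') j (a * b) = D ?M (\<Sum>i\<le>j. F i a * F (j - i) b)"
      using q v by (simp add: top_part_def \<alpha>.D_mult)
    also have "\<dots> = (\<Sum>i\<le>j. D ?M (F i a * F (j - i) b))"
    proof -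
      have "D M (sum f I) = (\<Sum>i\<in>I. D M (f i))" for M f and I :: "nat set"
        by (induction I rule: infinite_finite_induct) (auto simp: \<delta>.D_add)
      then show ?thesis .
    qed
    also have "\<dots> = (\<Sum>i\<le>j. top_part m i a * top_part m' (j - i) b)"
      by (intro sum.cong refl) (simp add: \<delta>.D_mult inner)
    finally show ?thesis .
  qed
  then show "coeff (Top (m + m') (a * b)) j = coeff (Top m a * Top m' b) j"
    by (simp add: coeff_Top coeff_mult)
qed

lemma Top_power: "d b \<le> m \<Longrightarrow> Top (m * q) (b ^ q) = Top m b ^ q"
proof (induction q)
  case 0
  have "Top 0 1 = [:D 0 1:]" by (intro Top_fixed) auto
  then show ?case by (simp flip: one_pCons)
next
  case (Suc q)
  have "d (b ^ q) \<le> m * q" using Suc.prems by (simp add: \<delta>.dg_power mult.commute)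
  then have "Top (m + m * q) (b * b ^ q) = Top m b * Top (m * q) (b ^ q)"
    using Suc.prems by (intro Top_mult)
  then show ?case using Suc by simp
qed

lemma Top_c_mult: assumes "d b \<le> m" shows "Top m (c ^ N * b) = smult (c ^ N) (Top m b)"
proof -
  have fixed: "c ^ N \<in> \<alpha>.fixed" "c ^ N \<in> \<delta>.fixed" using lead_fixed c_fixed by auto
  have "Top (0 + m) (c ^ N * b) = Top 0 (c ^ N) * Top m b"
    using fixed(2) assms by (intro Top_mult) (auto simp: \<delta>.fixed_def)
  then show ?thesis using Top_fixed[OF fixed(1)] by simp
qed

lemma Top_poly:
  assumes P: "P \<in> polys_over \<delta>.fixed" "P \<noteq> 0"
  shows "Top (n * degree P) (poly P s) = Top 0 (lead_coeff P) * Top n s ^ degree P"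
proof -
  interpret PO: closed_subring "polys_over \<delta>.fixed" by (rule \<delta>.fixed.closed_subring_polys_over)
  let ?q = "degree P"
  define P' where "P' = P - monom (lead_coeff P) ?q"
  have lc: "lead_coeff P \<in> \<delta>.fixed" using P by (auto dest: polys_overD)
  have P': "P' \<in> polys_over \<delta>.fixed" unfolding P'_def using P lc
    by (intro PO.diff_closed \<delta>.fixed.polys_over_monom)
  have low: "Top (n * ?q) (poly P' s) = 0"
  proof (cases "P' = 0")
    case True
    have "Top (n * ?q) 0 = 0" by (metis Top_add add_cancel_right_right add_0)
    then show ?thesis using True by simp
  next
    case False
    have "degree P' \<le> ?q" unfolding P'_def
      by (intro degree_diff_le) (auto simp: degree_monom_le)
    moreover have "coeff P' ?q = 0" by (simp add: P'_def)
    ultimately have "degree P' < ?q" using False by (metis le_neq_implies_less leading_coeff_0_iff)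
    then have "d (poly P' s) < n * ?q" using \<delta>.dg_poly(1)[OF P' _ slice(1)] slice(1) by simp
    then show ?thesis by (rule Top_low)
  qed
  have "poly P s = lead_coeff P * s ^ ?q + poly P' s" by (simp add: P'_def poly_monom)
  then have "Top (n * ?q) (poly P s) = Top (0 + n * ?q) (lead_coeff P * s ^ ?q)"
    using low by (simp add: Top_add)
  also have "\<dots> = Top 0 (lead_coeff P) * Top (n * ?q) (s ^ ?q)"
    using lc by (intro Top_mult) (auto simp: \<delta>.fixed_def \<delta>.dg_power)
  finally show ?thesis by (simp add: Top_power)
qed

text \<open>The hypothesis says that level \<open>m\<close> is level \<open>m0\<close> raised by
  \<open>i\<close> steps along the slope. Both sides therefore read the same
  \<open>D\<close>-coefficient, and the composition rule of \<open>F\<close> supplies the binomial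
  coefficient.\<close>

lemma Top_comp:
  assumes "v * m = v * m0 + u * i"
  shows "top_part m j (F i b) = of_nat ((i + j) choose j) * top_part m0 (i + j) b"
proof -
  have dvd: "v dvd u * (i + j) \<longleftrightarrow> v dvd u * j"
  proof -
    have "v * m0 + u * (i + j) = v * m + u * j" using assms by (simp add: algebra_simps)
    then show ?thesis by (metis dvd_add_right_iff dvd_triv_left)
  qed
  show ?thesis
  proof (cases "v dvd u * j")
    case True
    then obtain q where q: "u * j = v * q" by (auto elim: dvdE)
    have "v * m0 + u * (i + j) = v * (m + q)" using assms q by (simp add: algebra_simps)
    then have "u * (i + j) = v * (m + q - m0)" by (simp add: diff_mult_distrib2 algebra_simps)
    moreover have "m0 \<le> m" using assms v by (metis le_add1 mult_le_cancel1)
    ultimately have "m0 + u * (i + j) div v = m + q" using v by simp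
    then have r: "top_part m0 (i + j) b = D (m + q) (F (i + j) b)" using True dvd by (simp add: top_part_def)
    have nat_mult: "D k (of_nat r * x) = of_nat r * D k x" for k r x
      by (induction r) (simp_all add: algebra_simps \<delta>.D_add)
    have "top_part m j (F i b) = D (m + q) (F j (F i b))" using q v by (simp add: top_part_def)
    then show ?thesis by (simp add: r \<alpha>.D_comp nat_mult)
  qed (use dvd in \<open>simp add: top_part_def\<close>)
qed

text \<open>
  If the top part of \<open>F\<close> moved \<open>s\<close>, its last coefficient would be an invariant that is divisible
  by \<open>s\<close> at the top level, so \<open>s\<close> itself would be invariant. This uses that the slope is non-negative.
\<close>

lemma Top_s: "Top n s = [:c:]"
proof -
  let ?J = "degree (Top n s)"
  have "?J = 0"
  proof (rule ccontr)
    assume J: "?J \<noteq> 0"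
    have nz: "top_part n ?J s \<noteq> 0"
      using Top_nonzero[OF s_nonzero] by (metis coeff_Top leading_coeff_0_iff)
    then have "v dvd u * ?J" by (simp add: top_part_def split: if_splits)
    then obtain q where q: "u * ?J = v * q" by (auto elim: dvdE)
    let ?b = "F ?J s" and ?m = "n + q"
    have D: "D ?m ?b \<noteq> 0" using nz q v by (simp add: top_part_def)
    have "v * d ?b \<le> v * ?m" using bound[of ?J s] q by (simp add: algebra_simps)
    then have db: "d ?b = ?m" using v \<delta>.le_dg[OF _ D] by (simp add: antisym)
    have b0: "?b \<noteq> 0" using D by auto
    have "coeff (Top ?m ?b) j = 0" if "j > 0" for j
    proof -
      have "coeff (Top ?m ?b) j = of_nat ((?J + j) choose j) * coeff (Top n s) (?J + j)"
        unfolding coeff_Top using q by (intro Top_comp) (simp add: algebra_simps)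
      then show ?thesis using that by (simp add: coeff_eq_0)
    qed
    then have deg0: "degree (Top ?m ?b) = 0" by (metis gr0I leading_coeff_0_iff degree_0)
    obtain N P where P: "P \<in> polys_over \<delta>.fixed" "c ^ N * ?b = poly P s" using expansion by blast
    have P0: "P \<noteq> 0" using P b0 c_nonzero by auto
    have m: "?m = n * degree P" using \<delta>.dg_poly(1)[OF P(1) _ slice(1)] d_c_mult[of N ?b] P(2) db by simp
    then have "degree P > 0" using slice(1) by (cases "degree P") auto
    have "smult (c ^ N) (Top ?m ?b) = Top 0 (lead_coeff P) * Top n s ^ degree P"
      using Top_poly[OF P(1) P0] P(2) m db Top_c_mult[of ?b ?m N] by simp
    moreover have "degree (smult (c ^ N) (Top ?m ?b)) = 0" using deg0 by simp
    moreover have "Top 0 (lead_coeff P) \<noteq> 0"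
      using Top_nonzero[of "lead_coeff P"] P0 polys_overD[OF P(1), of "degree P"] by (simp add: \<delta>.fixed_def)
    moreover have "Top n s \<noteq> 0" using Top_nonzero[OF s_nonzero] .
    ultimately have "degree P * ?J = 0"
      by (metis add_is_0 degree_mult_eq degree_power_eq power_not_zero)
    then show False using J \<open>degree P > 0\<close> by simp
  qed
  moreover have "coeff (Top n s) 0 = c" by (simp add: coeff_Top top_part_def)
  ultimately show ?thesis by (metis degree_0_id)
qed

text \<open>Since the top part leaves \<open>s\<close> alone, only the leading coefficient of the
  expansion of \<open>b\<close> is affected. This allows the composition of top parts to be computed
  inside \<open>\<delta>.fixed\<close>.\<close>

lemma Top_lead:
  assumes "d b \<le> m"
  shows "Top m b = Top 0 (D m b)"
proof (cases "d b = m \<and> b \<noteq> 0")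
  case False
  have "Top m b = 0"
  proof (cases "b = 0")
    case True
    have "Top m 0 = 0" by (metis Top_add add_cancel_right_right add_0)
    then show ?thesis using True by simp
  next
    case False
    with \<open>\<not> (d b = m \<and> b \<noteq> 0)\<close> show ?thesis using assms by (intro Top_low) auto
  qed
  moreover have "D m b = 0"
  proof (cases "b = 0")
    case True then show ?thesis by simp
  next
    case b: False
    with False have "d b < m" using assms by auto
    then show ?thesis by (simp add: \<delta>.D_above_dg)
  qed
  moreover have "Top 0 0 = 0" by (metis Top_add add_cancel_right_right add_0)
  ultimately show ?thesis by simp
next
  case True
  obtain N P where P: "P \<in> polys_over \<delta>.fixed" "c ^ N * b = poly P s" using expansion by blast
  have P0: "P \<noteq> 0" using P True c_nonzero by auto
  note dp = \<delta>.dg_poly[OF P(1) _ slice(1), simplified]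
  have m: "m = n * degree P" using dp(1) d_c_mult[of N b] P(2) True by simp
  have lc: "lead_coeff P \<in> \<delta>.fixed" using polys_overD[OF P(1)] .
  have dD: "d (D m b) \<le> 0" using \<delta>.dg_D_le[of b m] True by simp
  have "smult (c ^ N) (Top m b) = Top 0 (lead_coeff P) * [:c:] ^ degree P"
    using Top_poly[OF P(1) P0] P(2) m True Top_c_mult[of b m N] by (simp add: Top_s)
  also have "\<dots> = smult (c ^ degree P) (Top 0 (lead_coeff P))" by (simp add: poly_const_pow)
  also have "\<dots> = Top 0 (c ^ degree P * lead_coeff P)"
    using lc by (intro Top_c_mult[symmetric]) (simp add: \<delta>.fixed_def)
  also have "c ^ degree P * lead_coeff P = c ^ N * D m b"
    using dp(2) P(2) m D_c_mult[of m N b] by (simp add: mult.commute)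
  also have "Top 0 (c ^ N * D m b) = smult (c ^ N) (Top 0 (D m b))"
    using dD by (intro Top_c_mult)
  finally have "smult (c ^ N) (Top m b - Top 0 (D m b)) = 0" by (simp add: smult_diff_right)
  then show ?thesis using c_nonzero by simp
qed

text \<open>By \<open>bound\<close> the value is a top \<open>D\<close>-coefficient of
  \<open>F i a\<close>, hence invariant. For the composition rule, \<open>Top_lead\<close> replaces
  that coefficient by \<open>F i a\<close> at its own level, where \<open>Top_comp\<close>
  applies.\<close>

lemma exp_map_on_top_part: "exp_map_on \<delta>.fixed (top_part 0)"
proof
  fix a b j i assume a: "a \<in> \<delta>.fixed"
  have da: "d a = 0" using a by (simp add: \<delta>.fixed_def)
  have bd: "d (F j a) \<le> u * j div v" for j
    using bound[of j a] v da by (simp add: less_eq_div_iff_mult_less_eq mult.commute)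
  then show "top_part 0 j a \<in> \<delta>.fixed" by (auto simp: top_part_def intro!: \<delta>.D_dg_fixed)
  show "top_part 0 0 a = a" by (simp add: top_part_def)
  obtain N where "\<forall>i\<ge>N. F i a = 0" using \<alpha>.D_finite by blast
  then have "\<forall>i\<ge>N. top_part 0 i a = 0" by (simp add: top_part_def)
  then show "\<exists>n. \<forall>i\<ge>n. top_part 0 i a = 0" by blast
  show "top_part 0 j (top_part 0 i a) = of_nat ((i + j) choose j) * top_part 0 (i + j) a"
  proof (cases "v dvd u * i")
    case True
    then obtain q where q: "u * i = v * q" by (auto elim: dvdE)
    have "top_part 0 j (top_part 0 i a) = coeff (Top 0 (D q (F i a))) j"
      using q v by (simp add: coeff_Top top_part_def)
    also have "\<dots> = coeff (Top q (F i a)) j" using bd[of i] q v by (simp add: Top_lead)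
    also have "\<dots> = of_nat ((i + j) choose j) * top_part 0 (i + j) a"
      unfolding coeff_Top using q by (intro Top_comp) simp
    finally show ?thesis .
  next
    case False
    \<comment> \<open>A fractional step followed by another may land on an integral level. But
      \<open>F i a\<close> then lies strictly below the slope, so the composite does not reach that
      level, and the binomial multiple vanishes.\<close>
    have "top_part 0 (i + j) a = 0 \<or> (of_nat ((i + j) choose j) :: 'a) * top_part 0 (i + j) a = 0"
    proof (cases "v dvd u * (i + j)")
      case True
      then obtain q where q: "u * (i + j) = v * q" by (auto elim: dvdE)
      have ne: "v * d (F i a) \<noteq> u * i" using False by (metis dvd_triv_left)
      have "v * d (F j (F i a)) \<le> v * d (F i a) + u * j" by (rule bound)
      also have "\<dots> < u * i + u * j" using bound[of i a] ne da by simp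
      also have "\<dots> = v * q" using q by (simp add: algebra_simps)
      finally have "d (F j (F i a)) < q" by simp
      then have "D q (F j (F i a)) = 0" by (simp add: \<delta>.D_above_dg)
      moreover have nat_mult: "D k (of_nat r * x) = of_nat r * D k x" for k r x
        by (induction r) (simp_all add: algebra_simps \<delta>.D_add)
      ultimately have "of_nat ((i + j) choose j) * D q (F (i + j) a) = 0" by (simp add: \<alpha>.D_comp)
      then show ?thesis using q v by (simp add: top_part_def)
    qed (simp add: top_part_def)
    moreover have "top_part 0 i a = 0" using False by (simp add: top_part_def)
    moreover have "top_part 0 j 0 = 0" by (simp add: top_part_def)
    ultimately show ?thesis by auto
  qed
  assume b: "b \<in> \<delta>.fixed"
  have "coeff (Top 0 (a + b)) j = coeff (Top 0 a + Top 0 b) j" by (simp only: Top_add)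
  then show "top_part 0 j (a + b) = top_part 0 j a + top_part 0 j b"
    by (simp only: coeff_Top coeff_add)
  have "Top (0 + 0) (a * b) = Top 0 a * Top 0 b"
    using a b by (intro Top_mult) (auto simp: \<delta>.fixed_def)
  then have "coeff (Top 0 (a * b)) j = coeff (Top 0 a * Top 0 b) j" by simp
  then show "top_part 0 j (a * b) = (\<Sum>i\<le>j. top_part 0 i a * top_part 0 (j - i) b)"
    by (simp only: coeff_Top coeff_mult)
qed

end

text \<open>Non-triviality comes from the pair attaining the maximal slope: its top coefficient at
  some \<open>j > 0\<close> is non-zero. The element cannot be \<open>s\<close>, whose top part is
  constant, so it is an invariant of \<open>D\<close>.\<close>

theorem (in homogenization) homogenized_exp_map:
  obtains u v where "v > 0"
    "exp_map_on \<delta>.fixed (\<lambda>j b. if v dvd u * j then D (u * j div v) (F j b) else 0)"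
    "\<exists>a\<in>\<delta>.fixed. \<exists>j>0. (if v dvd u * j then D (u * j div v) (F j a) else 0) \<noteq> 0"
proof (rule weights_exist)
  fix u v :: nat
  assume uv: "v > 0" "\<delta>.fixed \<subseteq> filt u v 0" "s \<in> filt u v (v * n)"
    "\<exists>g j. (g = s \<or> g \<in> \<delta>.fixed) \<and> j > 0 \<and> F j g \<noteq> 0 \<and> v * d (F j g) = v * d g + u * j"
  interpret W: weighted_homogenization D F k0 gens s u v
    by unfold_locales (use uv in auto)
  obtain g j where g: "g = s \<or> g \<in> \<delta>.fixed" "j > 0" "F j g \<noteq> 0" "v * d (F j g) = v * d g + u * j"
    using uv(4) by blast
  have dvd: "v dvd u * j" using g(4) by (metis dvd_add_right_iff dvd_triv_left)
  then obtain q where q: "u * j = v * q" by (auto elim: dvdE)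
  have "d (F j g) = d g + q" using g(4) q uv(1) by (simp flip: add_mult_distrib2)
  then have nz: "coeff (W.Top (d g) g) j \<noteq> 0"
    using q uv(1) \<delta>.D_dg_nonzero[of "F j g"] g(3) by (simp add: W.coeff_Top W.top_part_def)
  have "g \<noteq> s" using nz g(2) W.Top_s by (auto simp: coeff_pCons split: nat.splits)
  then have gi: "g \<in> \<delta>.fixed" using g by blast
  then have "W.top_part 0 j g \<noteq> 0" using nz by (simp add: W.coeff_Top \<delta>.fixed_def)
  moreover have "W.top_part 0 = (\<lambda>j b. if v dvd u * j then D (u * j div v) (F j b) else 0)"
    by (intro ext) (simp add: W.top_part_def)
  ultimately show thesis using that[OF uv(1)] W.exp_map_on_top_part gi g(2) by auto
qed

section \<open>Total degree on a polynomial ring in three variables\<close>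

definition comm_hom :: "('a::comm_ring_1 \<Rightarrow> 'b::comm_ring_1) \<Rightarrow> bool" where
  "comm_hom h \<longleftrightarrow> h 1 = 1 \<and> (\<forall>x y. h (x + y) = h x + h y) \<and> (\<forall>x y. h (x * y) = h x * h y)"

lemma comm_homD:
  assumes "comm_hom h"
  shows "h 1 = 1" "h (x + y) = h x + h y" "h (x * y) = h x * h y" "h 0 = 0" "h (- x) = - h x"
    "h (x - y) = h x - h y" "h (x ^ n) = h x ^ n"
proof -
  show 1: "h 1 = 1" and add: "h (x + y) = h x + h y" and mult: "h (x * y) = h x * h y" for x y
    using assms by (auto simp: comm_hom_def)
  show 0: "h 0 = 0" using add[of 0 0] by simp
  show m: "h (- x) = - h x" for x using add[of x "- x"] 0 by (simp add: add_eq_0_iff)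
  show "h (x - y) = h x - h y" using add[of x "- y"] m by simp
  show "h (x ^ n) = h x ^ n" by (induction n) (simp_all add: 1 mult)
qed

lemma comm_hom_sum: "comm_hom h \<Longrightarrow> h (sum f I) = (\<Sum>i\<in>I. h (f i))"
  by (induction I rule: infinite_finite_induct) (auto simp: comm_homD)

lemma comm_hom_comp: "comm_hom f \<Longrightarrow> comm_hom g \<Longrightarrow> comm_hom (\<lambda>x. f (g x))"
  by (simp add: comm_hom_def)

definition eval_hom :: "('a::comm_ring_1 \<Rightarrow> 'b::comm_ring_1) \<Rightarrow> 'b \<Rightarrow> 'a poly \<Rightarrow> 'b" where
  "eval_hom h x p = poly (map_poly h p) x"

lemma eval_hom_pCons [simp]: "comm_hom h \<Longrightarrow> eval_hom h x (pCons a p) = h a + x * eval_hom h x p"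
  by (simp add: eval_hom_def map_poly_pCons comm_homD)

lemma eval_hom_0 [simp]: "eval_hom h x 0 = 0"
  by (simp add: eval_hom_def)

lemma eval_hom_const: "comm_hom h \<Longrightarrow> eval_hom h x [:a:] = h a"
  by simp

lemma eval_hom_var: "comm_hom h \<Longrightarrow> eval_hom h x [:0, 1:] = x"
  by (simp add: comm_homD)

lemma map_poly_add:
  assumes "f 0 = 0" "\<And>x y. f (x + y) = f x + f y"
  shows "map_poly f (p + q) = map_poly f p + map_poly f q"
  using assms by (intro poly_eqI) (simp add: coeff_map_poly)

lemma comm_hom_eval: assumes h: "comm_hom h" shows "comm_hom (eval_hom h x)"
  unfolding comm_hom_def
proof (intro conjI allI)
  note [simp] = comm_homD[OF h]
  show "eval_hom h x 1 = 1" by (simp add: eval_hom_def)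
  show add: "eval_hom h x (p + q) = eval_hom h x p + eval_hom h x q" for p q
    by (simp add: eval_hom_def map_poly_add)
  have sm: "eval_hom h x (smult a q) = h a * eval_hom h x q" for a q
    by (simp add: eval_hom_def map_poly_smult)
  show "eval_hom h x (p * q) = eval_hom h x p * eval_hom h x q" for p q
    by (induction p) (simp_all add: h add sm algebra_simps)
qed

lemma comm_hom_const_poly: "comm_hom (\<lambda>x. [:x:])"
  by (simp add: comm_hom_def flip: one_pCons)

lemma comm_hom_poly: "comm_hom (\<lambda>p. poly p x)"
  by (simp add: comm_hom_def)

lemma comm_hom_const3: "comm_hom const3"
  using vector_space_const3 unfolding vector_space_scale_via_iff by (simp add: comm_hom_def)

lemma comm_hom_map_poly:
  assumes h: "comm_hom h" shows "comm_hom (map_poly h)"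
  unfolding comm_hom_def
proof (intro conjI allI)
  note [simp] = comm_homD[OF h]
  show "map_poly h 1 = 1" by simp
  show "map_poly h (p + q) = map_poly h p + map_poly h q" for p q by (simp add: map_poly_add)
  show "map_poly h (p * q) = map_poly h p * map_poly h q" for p q
    by (intro poly_eqI) (simp add: coeff_map_poly coeff_mult comm_hom_sum[OF h])
qed

abbreviation X3 :: "'a::field poly poly poly" where "X3 \<equiv> [:[:[:0, 1:]:]:]"
abbreviation Y3 :: "'a::field poly poly poly" where "Y3 \<equiv> [:[:0, 1:]:]"
abbreviation Z3 :: "'a::field poly poly poly" where "Z3 \<equiv> [:0, 1:]"

lemma poly3_generated:
  fixes U :: "'a::field poly poly poly set"
  assumes "closed_subring U" "range const3 \<union> {X3, Y3, Z3} \<subseteq> U"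
  shows "U = UNIV"
proof -
  interpret U: closed_subring U by fact
  have k: "const3 c \<in> U" for c using assms(2) by auto
  have 1: "[:[:p:]:] \<in> U" for p
  proof (induction p)
    case (pCons a p)
    have "[:[:pCons a p:]:] = const3 a + X3 * [:[:p:]:]" by (simp add: const3_def)
    moreover have "const3 a + X3 * [:[:p:]:] \<in> U"
      using k[of a] pCons assms(2) by (intro U.add_closed U.mult_closed) auto
    ultimately show ?case by (simp only:)
  qed simp
  have 2: "[:p:] \<in> U" for p
  proof (induction p)
    case (pCons a p)
    have "[:pCons a p:] = [:[:a:]:] + Y3 * [:p:]" by simp
    moreover have "[:[:a:]:] + Y3 * [:p:] \<in> U"
      using 1[of a] pCons assms(2) by (intro U.add_closed U.mult_closed) auto
    ultimately show ?case by (simp only:)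
  qed simp
  have "p \<in> U" for p
  proof (induction p)
    case (pCons a p)
    have "pCons a p = [:a:] + Z3 * p" by simp
    moreover have "[:a:] + Z3 * p \<in> U"
      using 2[of a] pCons assms(2) by (intro U.add_closed U.mult_closed) auto
    ultimately show ?case by (simp only:)
  qed simp
  then show ?thesis by auto
qed

lemma comm_hom_eq_on_poly3:
  assumes f: "comm_hom f" and g: "comm_hom g"
    and eq: "\<And>c. f (const3 c) = g (const3 c)" "f X3 = g X3" "f Y3 = g Y3" "f Z3 = g Z3"
  shows "f p = g (p :: 'a::field poly poly poly)"
proof -
  have "closed_subring {p. f p = g p}"
    by unfold_locales (auto simp: comm_homD[OF f] comm_homD[OF g])
  then have "{p. f p = g p} = UNIV" using eq by (intro poly3_generated) auto
  then show ?thesis by auto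
qed

text \<open>Every variable is multiplied by a new outermost variable t, so the coefficient of t ^ i
  is the homogeneous component of degree \<open>i\<close>. The total degree becomes an ordinary
  polynomial degree and inherits its additivity on products.\<close>

definition homogenize :: "'a::field poly poly poly \<Rightarrow> 'a poly poly poly poly" where
  "homogenize = eval_hom (eval_hom (eval_hom (\<lambda>c. [:const3 c:]) (monom X3 1)) (monom Y3 1)) (monom Z3 1)"

definition total_degree :: "'a::field poly poly poly \<Rightarrow> nat" where
  "total_degree p = degree (homogenize p)"

lemma comm_hom_homogenize: "comm_hom homogenize"
  unfolding homogenize_def
  by (intro comm_hom_eval comm_hom_comp[OF comm_hom_const_poly comm_hom_const3])

lemma homogenize_const3 [simp]: "homogenize (const3 (c :: 'a)) = [:const3 c:]"
  and homogenize_X3: "homogenize (X3 :: 'a::field poly poly poly) = monom X3 1"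
  and homogenize_Y3: "homogenize (Y3 :: 'a poly poly poly) = monom Y3 1"
  and homogenize_Z3: "homogenize (Z3 :: 'a poly poly poly) = monom Z3 1"
proof -
  have 0: "comm_hom (\<lambda>c :: 'a. [:const3 c:])"
    by (intro comm_hom_comp[OF comm_hom_const_poly comm_hom_const3])
  note 1 = comm_hom_eval[OF 0, of "monom X3 1"]
  note 2 = comm_hom_eval[OF 1, of "monom Y3 1"]
  show "homogenize (const3 c) = [:const3 c:]" for c :: 'a
    by (subst const3_def) (simp only: homogenize_def eval_hom_const 0 1 2)
  show "homogenize (X3 :: 'a poly poly poly) = monom X3 1"
    "homogenize (Y3 :: 'a poly poly poly) = monom Y3 1"
    "homogenize (Z3 :: 'a poly poly poly) = monom Z3 1"
    by (simp_all only: homogenize_def eval_hom_const eval_hom_var 0 1 2)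
qed

lemmas homogenize_simps = comm_homD[OF comm_hom_homogenize]

lemma homogenize_at_1: "poly (homogenize p) 1 = p"
  by (rule comm_hom_eq_on_poly3[OF comm_hom_comp[OF comm_hom_poly comm_hom_homogenize]])
    (auto simp: homogenize_X3 homogenize_Y3 homogenize_Z3 poly_monom comm_hom_def)

definition const_term :: "'a::field poly poly poly \<Rightarrow> 'a" where
  "const_term p = coeff (coeff (coeff p 0) 0) 0"

lemma comm_hom_const_term: "comm_hom const_term"
  by (simp add: comm_hom_def const_term_def coeff_mult)

lemma const_term_const3 [simp]: "const_term (const3 c) = c"
  by (simp add: const_term_def const3_def)

lemma const_term_vars [simp]: "const_term X3 = 0" "const_term Y3 = 0" "const_term Z3 = 0"
  by (simp_all add: const_term_def)

lemma homogenize_at_0: "poly (homogenize p) 0 = const3 (const_term p)"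
  by (rule comm_hom_eq_on_poly3[OF comm_hom_comp[OF comm_hom_poly comm_hom_homogenize]
        comm_hom_comp[OF comm_hom_const3 comm_hom_const_term]])
    (auto simp: homogenize_X3 homogenize_Y3 homogenize_Z3 poly_monom
      comm_homD[OF comm_hom_const3])

lemma homogenize_eq_0_iff [simp]: "homogenize p = 0 \<longleftrightarrow> p = 0"
  using homogenize_at_1[of p] by (auto simp: homogenize_simps)

lemma total_degree_mult: "p \<noteq> 0 \<Longrightarrow> q \<noteq> 0 \<Longrightarrow> total_degree (p * q) = total_degree p + total_degree q"
  by (simp add: total_degree_def homogenize_simps degree_mult_eq)

lemma total_degree_add_le: "total_degree p \<le> n \<Longrightarrow> total_degree q \<le> n \<Longrightarrow> total_degree (p + q) \<le> n"
  by (simp add: total_degree_def homogenize_simps degree_add_le)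

lemma total_degree_diff_le: "total_degree p \<le> n \<Longrightarrow> total_degree q \<le> n \<Longrightarrow> total_degree (p - q) \<le> n"
  by (simp add: total_degree_def homogenize_simps degree_diff_le)

lemma total_degree_const3 [simp]: "total_degree (const3 c) = 0"
  by (simp add: total_degree_def)

text \<open>If the homogenization does not involve the new variable, its values at 1 and at 0 agree;
  these are \<open>p\<close> and the constant term of \<open>p\<close>.\<close>

lemma total_degree_eq_0_iff: "total_degree p = 0 \<longleftrightarrow> p \<in> range const3"
proof
  assume "total_degree p = 0"
  then obtain q where "homogenize p = [:q:]" unfolding total_degree_def by (metis degree_0_id)
  then show "p \<in> range const3" using homogenize_at_1[of p] homogenize_at_0[of p] by auto
qed auto

lemma const3_eq_iff [simp]: "const3 a = const3 b \<longleftrightarrow> a = b"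
  by (simp add: const3_def)

lemma const3_eq_0_iff [simp]: "const3 a = 0 \<longleftrightarrow> a = 0"
  by (simp add: const3_def)

section \<open>Base change to the algebraic closure\<close>

text \<open>Used for the embedding \<open>to_ac\<close> and also for additive functionals back to
  the base field, so no multiplicativity is built in.\<close>

definition ext3 :: "('a::zero \<Rightarrow> 'b::zero) \<Rightarrow> 'a poly poly poly \<Rightarrow> 'b poly poly poly" where
  "ext3 f = map_poly (map_poly (map_poly f))"

lemma coeff_ext3 [simp]: "f 0 = 0 \<Longrightarrow> coeff (coeff (coeff (ext3 f p) i) j) l = f (coeff (coeff (coeff p i) j) l)"
  by (simp add: ext3_def coeff_map_poly)

lemma poly3_eqI: "(\<And>i j l. coeff (coeff (coeff p i) j) l = coeff (coeff (coeff q i) j) l) \<Longrightarrow> p = q"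
  by (intro poly_eqI)

lemma coeff_const3_mult [simp]:
  "coeff (coeff (coeff (const3 c * p) i) j) l = c * coeff (coeff (coeff p i) j) l"
  by (simp add: const3_def)

abbreviation to_ac3 :: "'k::field poly poly poly \<Rightarrow> 'k alg_closure poly poly poly" where
  "to_ac3 \<equiv> ext3 to_ac"

lemma comm_hom_to_ac: "comm_hom to_ac"
  by (simp add: comm_hom_def)

lemma comm_hom_to_ac3: "comm_hom to_ac3"
  unfolding ext3_def by (intro comm_hom_map_poly comm_hom_to_ac)

lemmas to_ac3_simps = comm_homD[OF comm_hom_to_ac3]

lemma to_ac3_eq_0_iff [simp]: "to_ac3 p = 0 \<longleftrightarrow> p = 0"
  by (simp add: ext3_def map_poly_eq_0_iff)

lemma to_ac3_const3 [simp]: "to_ac3 (const3 c) = const3 (to_ac c)"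
  by (simp add: ext3_def const3_def map_poly_pCons)

lemma to_ac3_vars [simp]: "to_ac3 X3 = X3" "to_ac3 Y3 = Y3" "to_ac3 Z3 = Z3"
  by (simp_all add: ext3_def map_poly_pCons)

text \<open>Such functionals perform the descent: applied to coefficients they map polynomials over
  the closure back to polynomials over \<open>k\<close>, linearly over the latter, so an identity
  over the closure yields identities over \<open>k\<close>.\<close>

definition ac_functional :: "('k::field alg_closure \<Rightarrow> 'k) \<Rightarrow> bool" where
  "ac_functional \<psi> \<longleftrightarrow> (\<forall>x y. \<psi> (x + y) = \<psi> x + \<psi> y) \<and> (\<forall>c x. \<psi> (to_ac c * x) = c * \<psi> x)"

lemma ac_functionalD:
  assumes "ac_functional \<psi>"
  shows "\<psi> (x + y) = \<psi> x + \<psi> y" "\<psi> (to_ac c * x) = c * \<psi> x" "\<psi> 0 = 0"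
proof -
  show "\<psi> (x + y) = \<psi> x + \<psi> y" "\<psi> (to_ac c * x) = c * \<psi> x"
    using assms unfolding ac_functional_def by blast+
  have "\<psi> (to_ac 0 * 0) = 0 * \<psi> 0" using assms unfolding ac_functional_def by blast
  then show "\<psi> 0 = 0" by simp
qed

text \<open>One level of the projection formula, stated abstractly so that it can be applied to each
  of the three nested levels of polynomials.\<close>

lemma map_poly_semilinear:
  assumes add: "\<And>x y. f (x + y) = f x + f y" and 0: "f 0 = 0" "g 0 = 0"
    and fg: "\<And>x y. f (g x * y) = x * f y"
  shows "map_poly f (map_poly g b * q) = b * map_poly f q"
proof (intro poly_eqI)
  have sum: "f (sum h I) = (\<Sum>i\<in>I. f (h i))" for h and I :: "nat set"
    by (induction I rule: infinite_finite_induct) (auto simp: add 0)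
  show "coeff (map_poly f (map_poly g b * q)) n = coeff (b * map_poly f q) n" for n
    by (simp add: coeff_map_poly 0 coeff_mult sum fg)
qed

lemma ext3_functional_add:
  "ac_functional \<psi> \<Longrightarrow> ext3 \<psi> (p + q) = ext3 \<psi> p + ext3 \<psi> q"
  by (intro poly3_eqI) (simp add: ac_functionalD)

lemma ext3_functional_mult:
  assumes "ac_functional \<psi>"
  shows "ext3 \<psi> (to_ac3 b * q) = b * ext3 \<psi> q"
proof -
  note [simp] = ac_functionalD[OF assms]
  show ?thesis unfolding ext3_def
    by (intro map_poly_semilinear map_poly_add) (simp_all add: map_poly_add)
qed

lemma ext3_functional_const3: "ac_functional \<psi> \<Longrightarrow> ext3 \<psi> (const3 x) = const3 (\<psi> x)"
  by (simp add: ext3_def const3_def map_poly_pCons ac_functionalD)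

lemma ext3_functional_tensor:
  "ac_functional \<psi> \<Longrightarrow> ext3 \<psi> (const3 x * to_ac3 b) = const3 (\<psi> x) * b"
  by (metis ext3_functional_mult ext3_functional_const3 mult.commute)

lemma ext3_functional_0: "ac_functional \<psi> \<Longrightarrow> ext3 \<psi> 0 = 0"
  by (simp add: ext3_def)

lemma ext3_functional_uminus: assumes "ac_functional \<psi>" shows "ext3 \<psi> (- p) = - ext3 \<psi> p"
proof -
  have "ext3 \<psi> (p + - p) = 0" using assms ext3_functional_0 by (simp del: add_uminus_conv_diff)
  then show ?thesis using ext3_functional_add[OF assms, of p "- p"] by (simp add: add_eq_0_iff)
qed

lemma ext3_functional_sum: "ac_functional \<psi> \<Longrightarrow> ext3 \<psi> (sum f I) = (\<Sum>i\<in>I. ext3 \<psi> (f i))"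
  by (induction I rule: infinite_finite_induct) (auto simp: ext3_functional_add ext3_functional_0)

section \<open>Coordinates with respect to a basis of the algebraic closure\<close>

interpretation ac: vector_space "\<lambda>(c :: 'k::field) (x :: 'k alg_closure). to_ac c * x"
  by unfold_locales (simp_all add: algebra_simps)

text \<open>The basis arises by extending the empty independent set. At elements outside the basis
  the coordinate is 0, so \<open>e\<close> may range over the whole closure.\<close>

definition ac_coord :: "'k::field alg_closure \<Rightarrow> 'k alg_closure \<Rightarrow> 'k" where
  "ac_coord e x = ac.representation (ac.extend_basis {}) x e"

lemma ac_functional_coord: "ac_functional (ac_coord e)"
  unfolding ac_functional_def ac_coord_def
  by (simp add: ac.representation_add ac.representation_scale ac.independent_empty
      ac.independent_extend_basis ac.span_extend_basis)

lemma finite_ac_coord: "finite {e. ac_coord e x \<noteq> 0}"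
  unfolding ac_coord_def by (rule ac.finite_representation)

lemma ac_coord_expansion:
  assumes "finite I" "{e. ac_coord e x \<noteq> 0} \<subseteq> I"
  shows "(\<Sum>e\<in>I. e * to_ac (ac_coord e x)) = x"
proof -
  have "(\<Sum>e\<in>I. to_ac (ac_coord e x) * e) = (\<Sum>e | ac_coord e x \<noteq> 0. to_ac (ac_coord e x) * e)"
    using assms by (intro sum.mono_neutral_right) auto
  also have "\<dots> = x" unfolding ac_coord_def
    by (intro ac.sum_nonzero_representation_eq)
      (simp_all add: ac.independent_empty ac.independent_extend_basis ac.span_extend_basis)
  finally show ?thesis by (simp add: mult.commute)
qed

abbreviation coord3 :: "'k::field alg_closure \<Rightarrow> 'k alg_closure poly poly poly \<Rightarrow> 'k poly poly poly" where
  "coord3 e \<equiv> ext3 (ac_coord e)"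

lemmas ac_coord_simps = ac_functionalD[OF ac_functional_coord]
lemmas coord3_add = ext3_functional_add[OF ac_functional_coord]
lemmas coord3_mult = ext3_functional_mult[OF ac_functional_coord]
lemmas coord3_const3 = ext3_functional_const3[OF ac_functional_coord]
lemmas coord3_tensor = ext3_functional_tensor[OF ac_functional_coord]
lemmas coord3_sum = ext3_functional_sum[OF ac_functional_coord]
lemmas coord3_0 = ext3_functional_0[OF ac_functional_coord]
lemmas coord3_uminus = ext3_functional_uminus[OF ac_functional_coord]

definition supp3 :: "'k::field alg_closure poly poly poly \<Rightarrow> 'k alg_closure set" where
  "supp3 b = {e. coord3 e b \<noteq> 0}"

lemma finite_supp3: "finite (supp3 b)"
proof -
  define V where "V = insert 0 (\<Union>p\<in>set (coeffs b). \<Union>q\<in>set (coeffs p). set (coeffs q))"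
  have V: "coeff (coeff (coeff b i) j) l \<in> V" for i j l
  proof (cases "coeff (coeff (coeff b i) j) l = 0")
    case False
    have nz: "coeff p k \<in> set (coeffs p)" if "coeff p k \<noteq> 0" for p :: "'c::zero poly" and k
    proof (rule coeff_in_coeffs)
      show "p \<noteq> 0" using that by auto
      show "k \<le> degree p" by (rule le_degree[OF that])
    qed
    have 1: "coeff (coeff b i) j \<noteq> 0" "coeff b i \<noteq> 0" using False by auto
    show ?thesis unfolding V_def
      by (rule insertI2, rule UN_I, rule nz[OF 1(2)], rule UN_I, rule nz[OF 1(1)], rule nz[OF False])
  next
    case True
    show ?thesis unfolding V_def True by (rule insertI1)
  qed
  have "supp3 b \<subseteq> (\<Union>x\<in>V. {e. ac_coord e x \<noteq> 0})"
  proof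
    fix e assume "e \<in> supp3 b"
    then have "coord3 e b \<noteq> 0" by (simp add: supp3_def)
    have "\<exists>i j l. coeff (coeff (coeff (coord3 e b) i) j) l \<noteq> 0"
    proof (rule ccontr)
      assume *: "\<not> (\<exists>i j l. coeff (coeff (coeff (coord3 e b) i) j) l \<noteq> 0)"
      have "coord3 e b = 0" by (rule poly3_eqI) (use * in \<open>simp del: coeff_ext3\<close>)
      with \<open>coord3 e b \<noteq> 0\<close> show False by blast
    qed
    then obtain i j l where "coeff (coeff (coeff (coord3 e b) i) j) l \<noteq> 0" by blast
    then have "ac_coord e (coeff (coeff (coeff b i) j) l) \<noteq> 0" by (simp add: ac_coord_simps)
    then show "e \<in> (\<Union>x\<in>V. {e. ac_coord e x \<noteq> 0})" by (intro UN_I[OF V[of i j l]] CollectI)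
  qed
  moreover have "finite (\<Union>x\<in>V. {e. ac_coord e x \<noteq> 0})"
    unfolding V_def by (intro finite_UN_I finite_ac_coord) auto
  ultimately show ?thesis by (rule finite_subset)
qed

lemma coord3_expansion:
  assumes "finite I" "supp3 b \<subseteq> I"
  shows "(\<Sum>e\<in>I. const3 e * to_ac3 (coord3 e b)) = b"
proof (rule poly3_eqI)
  fix i j l
  let ?x = "coeff (coeff (coeff b i) j) l"
  have "{e. ac_coord e ?x \<noteq> 0} \<subseteq> I"
  proof
    fix e assume "e \<in> {e. ac_coord e ?x \<noteq> 0}"
    then have "coeff (coeff (coeff (coord3 e b) i) j) l \<noteq> 0" by (simp add: ac_coord_simps)
    then have "coord3 e b \<noteq> 0" by (metis coeff_0)
    then show "e \<in> I" using assms(2) unfolding supp3_def by blast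
  qed
  then have "(\<Sum>e\<in>I. e * to_ac (ac_coord e ?x)) = ?x" using assms(1) by (intro ac_coord_expansion)
  then show "coeff (coeff (coeff (\<Sum>e\<in>I. const3 e * to_ac3 (coord3 e b)) i) j) l = ?x"
    by (simp only: coeff_sum coeff_const3_mult coeff_ext3 to_ac_0 ac_coord_simps)
qed

lemma coord3_eqI:
  assumes "\<And>e. coord3 e a = coord3 e b" shows "a = b"
proof -
  have supp: "supp3 a = supp3 b" unfolding supp3_def assms ..
  have "a = (\<Sum>e\<in>supp3 a. const3 e * to_ac3 (coord3 e a))"
    by (rule coord3_expansion[OF finite_supp3 order_refl, symmetric])
  also have "\<dots> = (\<Sum>e\<in>supp3 b. const3 e * to_ac3 (coord3 e b))"
    by (intro sum.cong supp arg_cong2[where f = "(*)"] arg_cong[where f = to_ac3] assms refl)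
  also have "\<dots> = b" by (rule coord3_expansion[OF finite_supp3 order_refl])
  finally show ?thesis .
qed

text \<open>The numbers \<open>ac_coord e (x * y)\<close> are the structure constants of the closure
  as a \<open>k\<close>-algebra. They reduce product rules over the closure to product rules for the
  coordinates.\<close>

lemma coord3_prod:
  assumes "finite I" "supp3 a \<subseteq> I" "finite J" "supp3 b \<subseteq> J"
  shows "coord3 e (a * b) = (\<Sum>x\<in>I. \<Sum>y\<in>J. const3 (ac_coord e (x * y)) * (coord3 x a * coord3 y b))"
proof -
  have "a * b = (\<Sum>x\<in>I. const3 x * to_ac3 (coord3 x a)) * (\<Sum>y\<in>J. const3 y * to_ac3 (coord3 y b))"
    by (simp only: coord3_expansion[OF assms(1,2)] coord3_expansion[OF assms(3,4)])
  also have "\<dots> = (\<Sum>x\<in>I. \<Sum>y\<in>J. const3 (x * y) * to_ac3 (coord3 x a * coord3 y b))"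
    by (simp add: sum_product to_ac3_simps comm_homD[OF comm_hom_const3] algebra_simps)
  finally show ?thesis by (simp add: coord3_sum coord3_tensor)
qed

section \<open>Extension of scalars for linear maps and exponential maps\<close>

definition k_linear :: "('k::field poly poly poly \<Rightarrow> 'k poly poly poly) \<Rightarrow> bool" where
  "k_linear g \<longleftrightarrow> (\<forall>a b. g (a + b) = g a + g b) \<and> (\<forall>c a. g (const3 c * a) = const3 c * g a)"

lemma k_linearD:
  assumes "k_linear g"
  shows "g (a + b) = g a + g b" "g (const3 c * a) = const3 c * g a" "g 0 = 0"
proof -
  show "g (a + b) = g a + g b" "g (const3 c * a) = const3 c * g a"
    using assms unfolding k_linear_def by blast+
  have "g (const3 0 * 0) = const3 0 * g 0" using assms unfolding k_linear_def by blast
  then show "g 0 = 0" by (simp add: comm_homD[OF comm_hom_const3])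
qed

lemma k_linear_sum: "k_linear g \<Longrightarrow> g (sum f I) = (\<Sum>i\<in>I. g (f i))"
  by (induction I rule: infinite_finite_induct) (auto simp: k_linearD)

text \<open>For \<open>k\<close>-linear \<open>g\<close>, this is the tensor product of the identity
  of the closure with \<open>g\<close>, written in coordinates.\<close>

definition extend_scalars ::
    "('k::field poly poly poly \<Rightarrow> 'k poly poly poly) \<Rightarrow> 'k alg_closure poly poly poly \<Rightarrow> 'k alg_closure poly poly poly" where
  "extend_scalars g b = (\<Sum>e\<in>supp3 b. const3 e * to_ac3 (g (coord3 e b)))"

lemma functional_extend_scalars:
  assumes g: "k_linear g" and \<psi>: "ac_functional \<psi>"
  shows "ext3 \<psi> (extend_scalars g b) = g (ext3 \<psi> b)"
proof -
  have "ext3 \<psi> (extend_scalars g b) = (\<Sum>e\<in>supp3 b. const3 (\<psi> e) * g (coord3 e b))"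
    by (simp add: extend_scalars_def ext3_functional_sum[OF \<psi>] ext3_functional_tensor[OF \<psi>])
  also have "\<dots> = g (\<Sum>e\<in>supp3 b. const3 (\<psi> e) * coord3 e b)"
    by (simp add: k_linear_sum[OF g] k_linearD[OF g])
  also have "(\<Sum>e\<in>supp3 b. const3 (\<psi> e) * coord3 e b) = ext3 \<psi> (\<Sum>e\<in>supp3 b. const3 e * to_ac3 (coord3 e b))"
    by (simp add: ext3_functional_sum[OF \<psi>] ext3_functional_tensor[OF \<psi>])
  also have "\<dots> = ext3 \<psi> b" by (simp only: coord3_expansion[OF finite_supp3 order_refl])
  finally show ?thesis .
qed

lemmas coord3_extend_scalars = functional_extend_scalars[OF _ ac_functional_coord]

text \<open>For a \<open>k\<close>-subspace \<open>V\<close>, this is the tensor product of the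
  closure with \<open>V\<close>.\<close>

definition base_change :: "'k::field poly poly poly set \<Rightarrow> 'k alg_closure poly poly poly set" where
  "base_change V = {b. \<forall>e. coord3 e b \<in> V}"

text \<open>Extension of scalars commutes with taking coordinates, and coordinates determine an
  element, so every axiom is checked coordinatewise. Finiteness survives because only finitely many
  coordinates are non-zero.\<close>

lemma exp_map_on_base_change:
  assumes D: "exp_map_on A D" and lin: "\<And>n. k_linear (D n)" and k: "range const3 \<subseteq> A"
  shows "exp_map_on (base_change A) (\<lambda>n. extend_scalars (D n))"
proof -
  interpret exp_map_on A D by fact
  note ces = coord3_extend_scalars[OF lin]
  have kA: "const3 c \<in> A" for c using k by auto
  show ?thesis
  proof
    show "1 \<in> base_change A"
    proof -
      have "coord3 e 1 = const3 (ac_coord e 1)" for e :: "'a alg_closure"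
        using coord3_const3[of e 1] by (simp only: comm_homD(1)[OF comm_hom_const3])
      then show ?thesis using kA by (simp add: base_change_def)
    qed
    fix a assume a: "a \<in> base_change A"
    then have aA: "coord3 e a \<in> A" for e by (simp add: base_change_def)
    show "- a \<in> base_change A" using aA by (simp add: base_change_def coord3_uminus)
    show "extend_scalars (D n) a \<in> base_change A" for n using aA by (simp add: base_change_def ces)
    show "extend_scalars (D 0) a = a" using aA by (intro coord3_eqI) (simp add: ces)
    show "extend_scalars (D j) (extend_scalars (D i) a) = of_nat ((i + j) choose j) * extend_scalars (D (i + j)) a"
      for i j
    proof (rule coord3_eqI)
      fix e :: "'a alg_closure"
      have of_nat: "to_ac3 (of_nat r :: 'a poly poly poly) = of_nat r" for r
        by (induction r) (simp_all add: to_ac3_simps)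
      have "coord3 e (of_nat r * x) = of_nat r * coord3 e x" for r and x :: "'a alg_closure poly poly poly"
        using coord3_mult[of e "of_nat r" x] by (simp only: of_nat)
      then show "coord3 e (extend_scalars (D j) (extend_scalars (D i) a)) =
        coord3 e (of_nat ((i + j) choose j) * extend_scalars (D (i + j)) a)"
        using aA by (simp add: ces coord3_mult D_comp)
    qed
    show "\<exists>n. \<forall>i\<ge>n. extend_scalars (D i) a = 0"
    proof -
      have "\<forall>e. \<exists>n. \<forall>i\<ge>n. D i (coord3 e a) = 0" using D_finite[OF aA] by blast
      from choice[OF this] obtain N where N: "\<And>e i. i \<ge> N e \<Longrightarrow> D i (coord3 e a) = 0" by blast
      have "extend_scalars (D i) a = 0" if i: "i \<ge> Max (insert 0 (N ` supp3 a))" for i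
      proof (rule coord3_eqI)
        fix e
        have "D i (coord3 e a) = 0"
        proof (cases "e \<in> supp3 a")
          case True
          then have "N e \<le> i" using i finite_supp3[of a] by (meson Max_ge finite.insertI finite_imageI imageI insertI2 order_trans)
          then show ?thesis by (rule N)
        next
          case False
          then show ?thesis by (simp add: supp3_def)
        qed
        then show "coord3 e (extend_scalars (D i) a) = coord3 e 0" by (simp add: ces coord3_0)
      qed
      then show ?thesis by blast
    qed
    fix b assume b: "b \<in> base_change A"
    then have bA: "coord3 e b \<in> A" for e by (simp add: base_change_def)
    show "a + b \<in> base_change A" using aA bA by (simp add: base_change_def coord3_add)
    show "a * b \<in> base_change A"
      using aA bA kA by (auto simp: base_change_def coord3_prod[OF finite_supp3 order_refl finite_supp3 order_refl]
          intro!: sum_closed mult_closed)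
    show "extend_scalars (D n) (a + b) = extend_scalars (D n) a + extend_scalars (D n) b" for n
      by (intro coord3_eqI) (simp add: ces coord3_add k_linearD[OF lin])
    show "extend_scalars (D n) (a * b) = (\<Sum>i\<le>n. extend_scalars (D i) a * extend_scalars (D (n - i)) b)" for n
    proof (rule coord3_eqI)
      fix e
      have sub: "supp3 (extend_scalars (D i) b) \<subseteq> supp3 b" for i b
        by (auto simp: supp3_def ces)
      let ?S = "\<lambda>i. \<Sum>x\<in>supp3 a. \<Sum>y\<in>supp3 b. const3 (ac_coord e (x * y)) * (D i (coord3 x a) * D (n - i) (coord3 y b))"
      have "coord3 e (extend_scalars (D n) (a * b)) =
          (\<Sum>x\<in>supp3 a. \<Sum>y\<in>supp3 b. const3 (ac_coord e (x * y)) * D n (coord3 x a * coord3 y b))"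
        by (simp add: ces coord3_prod[OF finite_supp3 order_refl finite_supp3 order_refl]
            k_linear_sum[OF lin] k_linearD[OF lin])
      also have "\<dots> = (\<Sum>x\<in>supp3 a. \<Sum>y\<in>supp3 b. \<Sum>i\<le>n. const3 (ac_coord e (x * y)) * (D i (coord3 x a) * D (n - i) (coord3 y b)))"
        by (simp add: D_mult aA bA sum_distrib_left)
      also have "\<dots> = (\<Sum>x\<in>supp3 a. \<Sum>i\<le>n. \<Sum>y\<in>supp3 b. const3 (ac_coord e (x * y)) * (D i (coord3 x a) * D (n - i) (coord3 y b)))"
        by (intro sum.cong refl sum.swap)
      also have "\<dots> = (\<Sum>i\<le>n. ?S i)" by (rule sum.swap)
      also have "\<dots> = (\<Sum>i\<le>n. coord3 e (extend_scalars (D i) a * extend_scalars (D (n - i)) b))"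
        by (simp add: ces coord3_prod[OF finite_supp3 sub finite_supp3 sub])
      finally show "coord3 e (extend_scalars (D n) (a * b)) =
        coord3 e (\<Sum>i\<le>n. extend_scalars (D i) a * extend_scalars (D (n - i)) b)"
        by (simp add: coord3_sum)
    qed
  qed
qed

lemma fixed_base_change:
  assumes D: "exp_map_on A D" and lin: "\<And>n. k_linear (D n)" and k: "range const3 \<subseteq> A"
  shows "exp_map_on.fixed (base_change A) (\<lambda>n. extend_scalars (D n)) = base_change (exp_map_on.fixed A D)"
proof -
  interpret D: exp_map_on A D by fact
  interpret K: exp_map_on "base_change A" "\<lambda>n. extend_scalars (D n)"
    by (intro exp_map_on_base_change assms)
  note ces = coord3_extend_scalars[OF lin]
  show ?thesis
  proof (intro equalityI subsetI)
    fix b assume b: "b \<in> K.fixed"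
    have "coord3 e b \<in> D.fixed" for e
    proof (rule D.fixedI)
      show "coord3 e b \<in> A" using b K.fixed_subset by (auto simp: base_change_def)
      fix n :: nat assume "n > 0"
      then have "coord3 e (extend_scalars (D n) b) = coord3 e 0" using K.fixedD[OF b] by simp
      then show "D n (coord3 e b) = 0" by (simp add: ces coord3_0)
    qed
    then show "b \<in> base_change D.fixed" by (simp add: base_change_def)
  next
    fix b assume "b \<in> base_change D.fixed"
    then have b: "coord3 e b \<in> D.fixed" for e by (simp add: base_change_def)
    show "b \<in> K.fixed"
    proof (rule K.fixedI)
      show "b \<in> base_change A" using b D.fixed_subset by (auto simp: base_change_def)
      show "extend_scalars (D n) b = 0" if "n > 0" for n
        using D.fixedD[OF b that] by (intro coord3_eqI) (simp add: ces coord3_0)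
    qed
  qed
qed

lemma homogenize_to_ac3: "homogenize (to_ac3 b) = map_poly to_ac3 (homogenize b)"
  by (rule comm_hom_eq_on_poly3[OF comm_hom_comp[OF comm_hom_homogenize comm_hom_to_ac3]
        comm_hom_comp[OF comm_hom_map_poly[OF comm_hom_to_ac3] comm_hom_homogenize]])
    (simp_all only: to_ac3_const3 to_ac3_vars homogenize_const3 homogenize_X3 homogenize_Y3 homogenize_Z3
      map_poly_monom map_poly_pCons map_poly_0 to_ac3_simps)

lemma total_degree_to_ac3 [simp]: "total_degree (to_ac3 b) = total_degree b"
  by (simp add: total_degree_def homogenize_to_ac3 degree_map_poly)

text \<open>The functional commutes with homogenization on pure tensors, hence on their sums. It
  thus acts on each homogeneous component separately and cannot create one above the degree.\<close>

lemma total_degree_functional_le: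
  assumes \<psi>: "ac_functional \<psi>"
  shows "total_degree (ext3 \<psi> b) \<le> total_degree b"
proof -
  have 0: "ext3 \<psi> 0 = 0" by (rule ext3_functional_0[OF \<psi>])
  have add: "map_poly (ext3 \<psi>) (p + q) = map_poly (ext3 \<psi>) p + map_poly (ext3 \<psi>) q" for p q
    by (intro map_poly_add 0 ext3_functional_add[OF \<psi>])
  have sum: "map_poly (ext3 \<psi>) (sum f I) = (\<Sum>i\<in>I. map_poly (ext3 \<psi>) (f i))" for f and I :: "'a alg_closure set"
    by (induction I rule: infinite_finite_induct) (auto simp: add)
  let ?t = "\<lambda>e. const3 e * to_ac3 (coord3 e b)"
  have t: "homogenize (ext3 \<psi> (?t e)) = map_poly (ext3 \<psi>) (homogenize (?t e))" for e
    by (intro poly_eqI) (simp add: ext3_functional_tensor[OF \<psi>] homogenize_simps homogenize_to_ac3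
        coeff_map_poly 0 to_ac3_simps)
  have b: "b = (\<Sum>e\<in>supp3 b. ?t e)" by (simp only: coord3_expansion[OF finite_supp3 order_refl])
  have "homogenize (ext3 \<psi> (\<Sum>e\<in>supp3 b. ?t e)) = (\<Sum>e\<in>supp3 b. homogenize (ext3 \<psi> (?t e)))"
    by (simp add: ext3_functional_sum[OF \<psi>] comm_hom_sum[OF comm_hom_homogenize])
  also have "\<dots> = map_poly (ext3 \<psi>) (homogenize (\<Sum>e\<in>supp3 b. ?t e))"
    by (simp only: t sum comm_hom_sum[OF comm_hom_homogenize])
  finally have "homogenize (ext3 \<psi> b) = map_poly (ext3 \<psi>) (homogenize b)" unfolding b[symmetric] .
  then have c: "coeff (homogenize (ext3 \<psi> b)) i = ext3 \<psi> (coeff (homogenize b) i)" for i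
    by (simp only: coeff_map_poly[of "ext3 \<psi>", OF 0])
  show ?thesis unfolding total_degree_def
  proof (rule degree_le, intro allI impI)
    fix i assume "i > degree (homogenize b)"
    then have "coeff (homogenize b) i = 0" by (rule coeff_eq_0)
    then show "coeff (homogenize (ext3 \<psi> b)) i = 0" by (simp only: c 0)
  qed
qed

section \<open>Algebraic dependence\<close>

text \<open>An indexed family is used because different exponents may give the same product. A
  repetition is itself a relation, with coefficients 1 and -1; without one, the usual dimension
  bound applies.\<close>

lemma (in vector_space) family_dependent:
  assumes "finite T" "finite I" "card T < card I" "\<And>e. e \<in> I \<Longrightarrow> w e \<in> span T"
  shows "\<exists>c. (\<exists>e\<in>I. c e \<noteq> 0) \<and> (\<Sum>e\<in>I. scale (c e) (w e)) = 0"
proof (cases "inj_on w I")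
  case True
  have "dependent (w ` I)"
  proof (rule ccontr)
    assume "\<not> dependent (w ` I)"
    then have "independent (w ` I)" by simp
    from independent_span_bound[OF assms(1) this] have "card (w ` I) \<le> card T" using assms(4) by auto
    then show False using assms(3) card_image[OF True] by simp
  qed
  then obtain u where u: "(\<Sum>v\<in>w ` I. scale (u v) v) = 0" "\<exists>v\<in>w ` I. u v \<noteq> 0"
    using dependent_finite[of "w ` I"] assms(2) by auto
  then show ?thesis by (intro exI[of _ "\<lambda>e. u (w e)"]) (auto simp: sum.reindex[OF True])
next
  case False
  then obtain e e' where e: "e \<in> I" "e' \<in> I" "e \<noteq> e'" "w e = w e'" by (auto simp: inj_on_def)
  let ?c = "\<lambda>x. if x = e then 1 else if x = e' then - 1 else 0"
  have "(\<Sum>x\<in>I. scale (?c x) (w x)) = (\<Sum>x\<in>{e, e'}. scale (?c x) (w x))"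
    using e assms(2) by (intro sum.mono_neutral_right) auto
  also have "\<dots> = 0" using e by simp
  finally show ?thesis using e(1) by (intro exI[of _ ?c]) auto
qed

section \<open>Counting monomials\<close>

interpretation k3: vector_space "scale_via (const3 :: 'k::field \<Rightarrow> 'k poly poly poly)"
  by (rule vector_space_const3)

text \<open>Bounding each exponent separately, instead of their sum, keeps the count at
  \<open>(N + 1) ^ r\<close> and the bounds additive under products.\<close>

definition box :: "(nat \<Rightarrow> 'b::comm_monoid_mult) \<Rightarrow> nat \<Rightarrow> nat \<Rightarrow> 'b set" where
  "box z r N = (\<lambda>e. \<Prod>i<r. z i ^ e i) ` (PiE {..<r} (\<lambda>_. {..N}))"

lemma card_box: "card (box z r N) \<le> (N + 1) ^ r"
proof -
  have "card (box z r N) \<le> card (PiE {..<r} (\<lambda>_. {..N}))"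
    unfolding box_def by (intro card_image_le finite_PiE) auto
  then show ?thesis by (simp add: card_PiE)
qed

lemma finite_box: "finite (box z r N)"
  unfolding box_def by (intro finite_imageI finite_PiE) auto

lemma boxI: "(\<And>i. i < r \<Longrightarrow> e i \<le> N) \<Longrightarrow> (\<Prod>i<r. z i ^ e i) \<in> box z r N"
  unfolding box_def by (rule image_eqI[of _ _ "restrict e {..<r}"]) auto

lemma box_mono: "N \<le> M \<Longrightarrow> box z r N \<subseteq> box z r M"
  unfolding box_def by (intro image_mono PiE_mono) auto

lemma box_mult: "a \<in> box z r N \<Longrightarrow> b \<in> box z r M \<Longrightarrow> a * b \<in> box z r (N + M)"
proof -
  assume "a \<in> box z r N" "b \<in> box z r M"
  then obtain e e' where e: "a = (\<Prod>i<r. z i ^ e i)" "e \<in> PiE {..<r} (\<lambda>_. {..N})"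
    "b = (\<Prod>i<r. z i ^ e' i)" "e' \<in> PiE {..<r} (\<lambda>_. {..M})" unfolding box_def by blast
  have "e i \<le> N" "e' i \<le> M" if "i < r" for i using e(2,4) that by auto
  then have "(\<Prod>i<r. z i ^ (e i + e' i)) \<in> box z r (N + M)" by (intro boxI add_mono)
  then show "a * b \<in> box z r (N + M)" by (simp add: e(1,3) power_add prod.distrib)
qed

lemma span_box_mult:
  assumes a: "a \<in> k3.span (box z r N)" and b: "b \<in> k3.span (box z r M)"
  shows "a * b \<in> k3.span (box z r (N + M))"
proof -
  have 1: "x * b \<in> k3.span (box z r (N + M))" if x: "x \<in> box z r N" for x
    using b
  proof (induction rule: k3.span_induct)
    case base
    show ?case
    proof (rule k3.subspaceI)
      show "0 \<in> {b. x * b \<in> k3.span (box z r (N + M))}" by (simp add: k3.span_zero)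
      show "u + v \<in> {b. x * b \<in> k3.span (box z r (N + M))}"
        if "u \<in> {b. x * b \<in> k3.span (box z r (N + M))}" "v \<in> {b. x * b \<in> k3.span (box z r (N + M))}" for u v
        using that by (simp add: distrib_left k3.span_add)
      show "scale_via const3 c u \<in> {b. x * b \<in> k3.span (box z r (N + M))}"
        if "u \<in> {b. x * b \<in> k3.span (box z r (N + M))}" for c u
      proof -
        have "x * scale_via const3 c u = scale_via const3 c (x * u)" by (simp add: scale_via_def)
        then show ?thesis using that k3.span_scale by auto
      qed
    qed
  next
    case (step y)
    then show ?case using box_mult[OF x] k3.span_base by blast
  qed
  show ?thesis
    using a
  proof (induction rule: k3.span_induct)
    case base
    show ?case
    proof (rule k3.subspaceI)
      show "0 \<in> {a. a * b \<in> k3.span (box z r (N + M))}" by (simp add: k3.span_zero)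
      show "u + v \<in> {a. a * b \<in> k3.span (box z r (N + M))}"
        if "u \<in> {a. a * b \<in> k3.span (box z r (N + M))}" "v \<in> {a. a * b \<in> k3.span (box z r (N + M))}" for u v
        using that by (simp add: distrib_right k3.span_add)
      show "scale_via const3 c u \<in> {a. a * b \<in> k3.span (box z r (N + M))}"
        if "u \<in> {a. a * b \<in> k3.span (box z r (N + M))}" for c u
      proof -
        have "scale_via const3 c u * b = scale_via const3 c (u * b)" by (simp add: scale_via_def)
        then show ?thesis using that k3.span_scale by auto
      qed
    qed
  next
    case (step y)
    then show ?case by (rule 1)
  qed
qed

lemma span_box_mono: "N \<le> M \<Longrightarrow> a \<in> k3.span (box z r N) \<Longrightarrow> a \<in> k3.span (box z r M)"
  using box_mono k3.span_mono by blast

lemma one_in_box: "1 \<in> box z r N"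
  using boxI[of r "\<lambda>_. 0" N z] by simp

lemma var_in_box:
  assumes "j < r" shows "z j \<in> box z r 1"
proof -
  have "(\<Prod>i<r. z i ^ (if i = j then 1 else 0)) \<in> box z r 1" by (rule boxI) simp
  also have "(\<Prod>i<r. z i ^ (if i = j then 1 else 0)) = (\<Prod>i<r. if i = j then z i else 1)"
    by (intro prod.cong) auto
  also have "\<dots> = z j" using assms by simp
  finally show ?thesis .
qed

lemma span_box_power: "a \<in> k3.span (box z r N) \<Longrightarrow> a ^ k \<in> k3.span (box z r (N * k))"
proof (induction k)
  case 0 show ?case by (simp add: one_in_box k3.span_base)
next
  case (Suc k)
  then have "a * a ^ k \<in> k3.span (box z r (N + N * k))" by (intro span_box_mult)
  then show ?case by simp
qed

lemma span_box_prod: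
  assumes "finite J" "\<And>j. j \<in> J \<Longrightarrow> f j \<in> k3.span (box z r (N j))"
  shows "(\<Prod>j\<in>J. f j) \<in> k3.span (box z r (\<Sum>j\<in>J. N j))"
  using assms
proof (induction J rule: finite_induct)
  case empty show ?case by (simp add: one_in_box k3.span_base)
next
  case (insert j J)
  have "f j * prod f J \<in> k3.span (box z r (N j + sum N J))"
    using insert by (intro span_box_mult) auto
  then show ?case using insert.hyps by simp
qed

lemma closed_subring_span_box: "closed_subring {b. \<exists>N. b \<in> k3.span (box z r N)}"
proof
  fix a b assume "a \<in> {b. \<exists>N. b \<in> k3.span (box z r N)}" "b \<in> {b. \<exists>N. b \<in> k3.span (box z r N)}"
  then obtain N M where NM: "a \<in> k3.span (box z r N)" "b \<in> k3.span (box z r M)" by blast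
  show "a * b \<in> {b. \<exists>N. b \<in> k3.span (box z r N)}" using span_box_mult[OF NM] by blast
  have "a \<in> k3.span (box z r (max N M))" "b \<in> k3.span (box z r (max N M))"
    using NM span_box_mono[of N "max N M"] span_box_mono[of M "max N M"] by auto
  then show "a + b \<in> {b. \<exists>N. b \<in> k3.span (box z r N)}" using k3.span_add by blast
next
  fix a assume "a \<in> {b. \<exists>N. b \<in> k3.span (box z r N)}"
  then show "- a \<in> {b. \<exists>N. b \<in> k3.span (box z r N)}" using k3.span_neg by blast
next
  show "1 \<in> {b. \<exists>N. b \<in> k3.span (box z r N)}" using one_in_box k3.span_base by blast
qed

text \<open>The hypothesis \<open>gen\<close> puts each \<open>p j\<close> into the algebra
  generated by the \<open>z i\<close>. The number of monomials in \<open>p\<close> with exponents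
  below \<open>M\<close> grows like \<open>M ^ m\<close>, while the space containing them has
  dimension of order at most \<open>M ^ r\<close>, so they become dependent for large
  \<open>M\<close>.\<close>

theorem algebraically_dependent:
  fixes p z :: "nat \<Rightarrow> 'k::field poly poly poly"
  assumes gen: "\<And>U j. closed_subring U \<Longrightarrow> range const3 \<subseteq> U \<Longrightarrow> (\<And>i. i < r \<Longrightarrow> z i \<in> U) \<Longrightarrow> j < m \<Longrightarrow> p j \<in> U"
    and "r < m"
  shows "\<exists>M c. (\<exists>e\<in>PiE {..<m} (\<lambda>_. {..<M}). c e \<noteq> 0) \<and>
    (\<Sum>e\<in>PiE {..<m} (\<lambda>_. {..<M}). const3 (c e) * (\<Prod>j<m. p j ^ e j)) = 0"
proof -
  let ?U = "{b. \<exists>N. b \<in> k3.span (box z r N)}"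
  have "p j \<in> ?U" if "j < m" for j
  proof (rule gen[OF closed_subring_span_box _ _ that])
    show "range const3 \<subseteq> ?U"
    proof clarify
      fix c
      have "scale_via const3 c 1 \<in> k3.span (box z r 0)" by (intro k3.span_scale k3.span_base one_in_box)
      then show "\<exists>N. const3 c \<in> k3.span (box z r N)" by (auto simp: scale_via_def)
    qed
    show "z i \<in> ?U" if "i < r" for i using var_in_box[OF that] k3.span_base by blast
  qed
  then have "\<forall>j\<in>{..<m}. \<exists>N. p j \<in> k3.span (box z r N)" by auto
  from bchoice[OF this] obtain N where N: "\<And>j. j < m \<Longrightarrow> p j \<in> k3.span (box z r (N j))" by auto
  define d where "d = (\<Sum>j<m. N j)"
  have d: "p j \<in> k3.span (box z r d)" if "j < m" for j
  proof (rule span_box_mono[OF _ N[OF that]])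
    show "N j \<le> d" unfolding d_def using that by (intro member_le_sum) auto
  qed
  \<comment> \<open>Large enough that \<open>((d * m + 1) * M) ^ r < M ^ Suc r\<close>; the left
    side bounds the size of the spanning box.\<close>
  define M where "M = (d * m + 1) ^ r + 1"
  let ?I = "PiE {..<m} (\<lambda>_. {..<M})"
  have sp: "(\<Prod>j<m. p j ^ e j) \<in> k3.span (box z r (d * m * M))" if "e \<in> ?I" for e
  proof -
    have "(\<Prod>j<m. p j ^ e j) \<in> k3.span (box z r (\<Sum>j<m. d * e j))"
      using d by (intro span_box_prod span_box_power) auto
    moreover have "(\<Sum>j<m. d * e j) \<le> (\<Sum>j<m. d * M)"
      using that by (intro sum_mono mult_le_mono2) (auto simp: PiE_def Pi_def less_imp_le)
    ultimately show ?thesis by (elim span_box_mono[rotated]) (simp add: algebra_simps)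
  qed
  have "card (box z r (d * m * M)) \<le> (d * m * M + 1) ^ r" by (rule card_box)
  also have "\<dots> \<le> ((d * m + 1) * M) ^ r" by (intro power_mono) (auto simp: M_def)
  also have "\<dots> = (d * m + 1) ^ r * M ^ r" by (rule power_mult_distrib)
  also have "\<dots> < M * M ^ r" by (simp add: M_def)
  also have "\<dots> = M ^ Suc r" by simp
  also have "\<dots> \<le> M ^ m" using \<open>r < m\<close> by (intro power_increasing) (auto simp: M_def)
  also have "\<dots> = card ?I" by (simp add: card_PiE)
  finally have "card (box z r (d * m * M)) < card ?I" .
  from k3.family_dependent[OF finite_box _ this, of "\<lambda>e. \<Prod>j<m. p j ^ e j"] sp
  obtain c where "\<exists>e\<in>?I. c e \<noteq> 0" "(\<Sum>e\<in>?I. scale_via const3 (c e) (\<Prod>j<m. p j ^ e j)) = 0"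
    by (auto simp: finite_PiE)
  then show ?thesis by (intro exI[of _ M] exI[of _ c]) (simp add: scale_via_def)
qed

section \<open>Algebraic relations in three variables\<close>

lemma monomial3: "X3 ^ a * Y3 ^ b * Z3 ^ c = (monom (monom (monom 1 a) b) c :: 'k::field poly poly poly)"
proof -
  have X: "X3 ^ a = ([:[:monom 1 a:]:] :: 'k poly poly poly)"
    by (simp add: poly_const_pow monom_altdef)
  have Y: "Y3 ^ b = ([:monom 1 b:] :: 'k poly poly poly)"
    by (simp add: poly_const_pow monom_altdef)
  have Z: "Z3 ^ c = (monom 1 c :: 'k poly poly poly)"
    by (simp add: monom_altdef)
  show ?thesis unfolding X Y Z by (simp add: smult_monom)
qed

lemma coeff_monomial3:
  "coeff (coeff (coeff (X3 ^ a * Y3 ^ b * Z3 ^ c) i) j) l = (if i = c \<and> j = b \<and> l = a then 1 else (0 :: 'k::field))"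
  by (simp add: monomial3)

lemma PiE_eqI_lessThan:
  "e \<in> PiE {..<m} S \<Longrightarrow> e' \<in> PiE {..<m} S' \<Longrightarrow> (\<And>i. i < m \<Longrightarrow> e i = e' i) \<Longrightarrow> e = e'"
  by (rule PiE_ext) auto

lemma all_less_3: "(\<forall>i<3. P i) \<longleftrightarrow> P 0 \<and> P 1 \<and> P (2::nat)"
  by (auto simp: numeral_eq_Suc less_Suc_eq)

lemma all_less_4: "(\<forall>i<4. P i) \<longleftrightarrow> P 0 \<and> P 1 \<and> P 2 \<and> P (3::nat)"
  by (auto simp: numeral_eq_Suc less_Suc_eq)

text \<open>Excludes the case that the smaller ring of invariants consists of constants.\<close>

lemma not_generated_by_two:
  fixes y s :: "'k::field poly poly poly"
  assumes U: "\<And>U. closed_subring U \<Longrightarrow> range const3 \<union> {y, s} \<subseteq> U \<Longrightarrow> U = UNIV"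
  shows False
proof -
  define z where "z = (\<lambda>i::nat. if i = 0 then y else s)"
  define p :: "nat \<Rightarrow> 'k poly poly poly" where "p = (\<lambda>i. if i = 0 then X3 else if i = 1 then Y3 else Z3)"
  have "\<exists>M c. (\<exists>e\<in>PiE {..<3} (\<lambda>_. {..<M}). c e \<noteq> 0) \<and>
    (\<Sum>e\<in>PiE {..<3} (\<lambda>_. {..<M}). const3 (c e) * (\<Prod>j<3. p j ^ e j)) = 0"
  proof (rule algebraically_dependent[of 2 z])
    fix U :: "'k poly poly poly set" and j
    assume c: "closed_subring U" "range const3 \<subseteq> U" "\<And>i. i < 2 \<Longrightarrow> z i \<in> U"
    have "y \<in> U" "s \<in> U" using c(3)[of 0] c(3)[of 1] by (auto simp: z_def)
    then have "U = UNIV" using c by (intro U) auto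
    then show "p j \<in> U" by simp
  qed simp
  then obtain M c e0 where e0: "e0 \<in> PiE {..<3} (\<lambda>_. {..<M})" "c e0 \<noteq> 0"
    and rel: "(\<Sum>e\<in>PiE {..<3} (\<lambda>_. {..<M}). const3 (c e) * (\<Prod>j<3. p j ^ e j)) = 0" by blast
  let ?I = "PiE {..<3::nat} (\<lambda>_. {..<M})"
  have fin: "finite ?I" by (intro finite_PiE) auto
  have pr: "(\<Prod>j<3. p j ^ e j) = X3 ^ e 0 * Y3 ^ e 1 * Z3 ^ e 2" for e
    by (simp add: lessThan_nat_numeral lessThan_Suc p_def mult.assoc numeral_2_eq_2)
  have "0 = coeff (coeff (coeff (\<Sum>e\<in>?I. const3 (c e) * (X3 ^ e 0 * Y3 ^ e 1 * Z3 ^ e 2)) (e0 2)) (e0 1)) (e0 0)"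
    using rel by (simp only: pr coeff_0)
  also have "\<dots> = (\<Sum>e\<in>?I. c e * (if e0 2 = e 2 \<and> e0 1 = e 1 \<and> e0 0 = e 0 then 1 else 0))"
    by (simp only: coeff_sum coeff_const3_mult coeff_monomial3)
  also have "\<dots> = (\<Sum>e\<in>?I. if e = e0 then c e else 0)"
  proof (intro sum.cong refl)
    fix e assume e: "e \<in> ?I"
    have "e = e0" if "e0 2 = e 2 \<and> e0 1 = e 1 \<and> e0 0 = e 0"
    proof (rule PiE_eqI_lessThan[OF e e0(1)])
      fix i :: nat assume "i < 3"
      moreover have "\<forall>i<3. e i = e0 i" unfolding all_less_3 using that by simp
      ultimately show "e i = e0 i" by blast
    qed
    then have "(e0 2 = e 2 \<and> e0 1 = e 1 \<and> e0 0 = e 0) = (e = e0)" by blast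
    then show "c e * (if e0 2 = e 2 \<and> e0 1 = e 1 \<and> e0 0 = e 0 then 1 else 0) = (if e = e0 then c e else 0)"
      by (simp only: split: if_split) simp
  qed
  also have "\<dots> = c e0" using e0 fin by simp
  finally show False using e0 by simp
qed

definition eval2 :: "'k::field poly poly poly \<Rightarrow> 'k poly poly poly \<Rightarrow> 'k poly poly \<Rightarrow> 'k poly poly poly" where
  "eval2 f g = eval_hom (eval_hom const3 f) g"

lemma comm_hom_eval2: "comm_hom (eval2 f g)"
  unfolding eval2_def by (intro comm_hom_eval comm_hom_const3)

lemma eval_hom_monom: assumes "comm_hom h" shows "eval_hom h x (monom a n) = h a * x ^ n"
  using assms by (simp add: eval_hom_def map_poly_monom comm_homD poly_monom)

lemma eval2_monom: "eval2 f g (monom (monom c i) j) = const3 c * f ^ i * g ^ j"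
  by (simp add: eval2_def eval_hom_monom comm_hom_eval comm_hom_const3)

text \<open>The four elements \<open>f\<close>, \<open>g\<close>, \<open>y\<close>, \<open>s\<close>
  of a ring in three variables satisfy a relation. As \<open>s\<close> is transcendental over the
  larger ring of invariants and \<open>y\<close> over the smaller, its coefficients at powers of
  \<open>s\<close> and then of \<open>y\<close> vanish one by one; the coefficient selected by the
  exponent \<open>e0\<close> is a non-trivial relation between \<open>f\<close> and
  \<open>g\<close>.\<close>

lemma fixed_pair_dependent:
  fixes f g :: "'k::field poly poly poly"
  assumes \<delta>: "exp_map_on UNIV D" and \<phi>: "exp_map_on (exp_map_on.fixed UNIV D) F"
    and k: "range const3 \<subseteq> exp_map_on.fixed (exp_map_on.fixed UNIV D) F"
    and fg: "f \<in> exp_map_on.fixed (exp_map_on.fixed UNIV D) F" "g \<in> exp_map_on.fixed (exp_map_on.fixed UNIV D) F"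
    and y: "y \<in> exp_map_on.fixed UNIV D" "degree (exp_poly F y) > 0"
    and s: "degree (exp_poly D s) > 0"
  shows "\<exists>G. G \<noteq> 0 \<and> eval2 f g G = 0"
proof -
  interpret \<delta>: exp_map_on UNIV D by fact
  interpret \<phi>: exp_map_on \<delta>.fixed F by fact
  define p where "p = (\<lambda>i::nat. if i = 0 then f else if i = 1 then g else if i = 2 then y else s)"
  define z :: "nat \<Rightarrow> 'k poly poly poly" where "z = (\<lambda>i. if i = 0 then X3 else if i = 1 then Y3 else Z3)"
  have "\<exists>M c. (\<exists>e\<in>PiE {..<4} (\<lambda>_. {..<M}). c e \<noteq> 0) \<and>
    (\<Sum>e\<in>PiE {..<4} (\<lambda>_. {..<M}). const3 (c e) * (\<Prod>j<4. p j ^ e j)) = 0"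
  proof (rule algebraically_dependent[of 3 z])
    fix U :: "'k poly poly poly set" and j
    assume c: "closed_subring U" "range const3 \<subseteq> U" "\<And>i. i < 3 \<Longrightarrow> z i \<in> U"
    have "X3 \<in> U" "Y3 \<in> U" "Z3 \<in> U" using c(3)[of 0] c(3)[of 1] c(3)[of 2] by (auto simp: z_def)
    then have "U = UNIV" using c by (intro poly3_generated) auto
    then show "p j \<in> U" by simp
  qed simp
  then obtain M c e0 where e0: "e0 \<in> PiE {..<4} (\<lambda>_. {..<M})" "c e0 \<noteq> 0"
    and rel: "(\<Sum>e\<in>PiE {..<4} (\<lambda>_. {..<M}). const3 (c e) * (\<Prod>j<4. p j ^ e j)) = 0" by blast
  let ?I = "PiE {..<4::nat} (\<lambda>_. {..<M})"
  have fin: "finite ?I" by (intro finite_PiE) auto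
  let ?m = "\<lambda>e. const3 (c e) * f ^ e 0 * g ^ e 1"
  have pr: "const3 (c e) * (\<Prod>j<4. p j ^ e j) = ?m e * y ^ e 2 * s ^ e 3" for e
    by (simp add: lessThan_nat_numeral lessThan_Suc p_def algebra_simps numeral_2_eq_2 numeral_3_eq_3)
  have mR: "?m e \<in> \<phi>.fixed" for e using k fg by (intro \<phi>.fixed.mult_closed \<phi>.fixed.power_closed) auto
  then have mA: "?m e \<in> \<delta>.fixed" for e using \<phi>.fixed_subset by blast
  define P where "P = (\<Sum>e\<in>?I. monom (?m e * y ^ e 2) (e 3))"
  interpret PO: closed_subring "polys_over \<delta>.fixed" by (rule \<delta>.fixed.closed_subring_polys_over)
  interpret PR: closed_subring "polys_over \<phi>.fixed" by (rule \<phi>.fixed.closed_subring_polys_over)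
  have "P = 0"
  proof (rule \<delta>.transcendental[OF _ _ s])
    show "P \<in> polys_over \<delta>.fixed" unfolding P_def
      by (intro PO.sum_closed \<delta>.fixed.polys_over_monom \<delta>.fixed.mult_closed[OF mA] \<delta>.fixed.power_closed y(1))
    have "poly P s = (\<Sum>e\<in>?I. ?m e * y ^ e 2 * s ^ e 3)" by (simp add: P_def poly_sum poly_monom)
    also have "\<dots> = 0" using rel by (simp only: pr)
    finally show "poly P s = 0" .
  qed simp
  define Q where "Q = (\<Sum>e\<in>?I. monom (if e 3 = e0 3 then ?m e else 0) (e 2))"
  have Q0: "Q = 0"
  proof (rule \<phi>.transcendental[OF _ y])
    show "Q \<in> polys_over \<phi>.fixed" unfolding Q_def
      using mR by (intro PR.sum_closed \<phi>.fixed.polys_over_monom) auto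
    have "poly Q y = (\<Sum>e\<in>?I. if e 3 = e0 3 then ?m e * y ^ e 2 else 0)"
      unfolding Q_def poly_sum poly_monom by (intro sum.cong) auto
    also have "\<dots> = coeff P (e0 3)" unfolding P_def coeff_sum by (intro sum.cong) auto
    also have "\<dots> = 0" using \<open>P = 0\<close> by simp
    finally show "poly Q y = 0" .
  qed
  define G where "G = (\<Sum>e\<in>?I. if e 2 = e0 2 \<and> e 3 = e0 3 then monom (monom (c e) (e 0)) (e 1) else 0)"
  have ev: "eval2 f g G = (\<Sum>e\<in>?I. if e 2 = e0 2 \<and> e 3 = e0 3 then ?m e else 0)"
    unfolding G_def comm_hom_sum[OF comm_hom_eval2]
    by (intro sum.cong) (auto simp: eval2_monom comm_homD(4)[OF comm_hom_eval2])
  have cQ: "(\<Sum>e\<in>?I. if e 2 = e0 2 \<and> e 3 = e0 3 then ?m e else 0) = coeff Q (e0 2)"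
    unfolding Q_def coeff_sum by (intro sum.cong) auto
  have 0: "eval2 f g G = 0" unfolding ev cQ Q0 by (rule coeff_0)
  have "coeff (coeff G (e0 1)) (e0 0) = (\<Sum>e\<in>?I. coeff (coeff (if e 2 = e0 2 \<and> e 3 = e0 3 then monom (monom (c e) (e 0)) (e 1) else 0) (e0 1)) (e0 0))"
    by (simp only: G_def coeff_sum)
  also have "\<dots> = (\<Sum>e\<in>?I. if e = e0 then c e else 0)"
  proof (rule sum.cong[OF refl])
    fix e assume e: "e \<in> ?I"
    have "e = e0" if "(e 0 = e0 0 \<and> e 1 = e0 1) \<and> e 2 = e0 2 \<and> e 3 = e0 3"
    proof (rule PiE_eqI_lessThan[OF e e0(1)])
      fix i :: nat assume "i < 4"
      moreover have "\<forall>i<4. e i = e0 i" unfolding all_less_4 using that by simp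
      ultimately show "e i = e0 i" by blast
    qed
    then have eq: "((e 0 = e0 0 \<and> e 1 = e0 1) \<and> e 2 = e0 2 \<and> e 3 = e0 3) = (e = e0)" by blast
    have A: "coeff (coeff (if e 2 = e0 2 \<and> e 3 = e0 3 then monom (monom (c e) (e 0)) (e 1) else 0) (e0 1)) (e0 0) =
      (if (e 0 = e0 0 \<and> e 1 = e0 1) \<and> e 2 = e0 2 \<and> e 3 = e0 3 then c e else 0)" by auto
    have B: "(if (e 0 = e0 0 \<and> e 1 = e0 1) \<and> e 2 = e0 2 \<and> e 3 = e0 3 then c e else 0) = (if e = e0 then c e else 0)"
      by (rule arg_cong[OF eq])
    show "coeff (coeff (if e 2 = e0 2 \<and> e 3 = e0 3 then monom (monom (c e) (e 0)) (e 1) else 0) (e0 1)) (e0 0) =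
      (if e = e0 then c e else 0)" by (rule trans[OF A B])
  qed
  also have "\<dots> = c e0" using e0(1) fin by simp
  finally have "coeff (coeff G (e0 1)) (e0 0) = c e0" .
  then have "G \<noteq> 0" using e0(2) by (metis coeff_0)
  then show ?thesis using 0 by blast
qed

section \<open>Units, substitution into one-variable polynomials, and descent from the
  closure\<close>

lemma total_degree_add_const: "total_degree p > 0 \<Longrightarrow> total_degree (p + const3 c) = total_degree p"
  unfolding total_degree_def by (simp add: homogenize_simps degree_add_eq_left)

lemma total_degree_const_add: "total_degree p > 0 \<Longrightarrow> total_degree (const3 c + p) = total_degree p"
  using total_degree_add_const by (metis add.commute)

lemma total_degree_diff_const: "total_degree p > 0 \<Longrightarrow> total_degree (p - const3 c) = total_degree p"
  using total_degree_add_const[of p "- c"] by (simp add: comm_homD(5)[OF comm_hom_const3])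

lemma const3_cancel: "c \<noteq> 0 \<Longrightarrow> const3 (inverse c) * (const3 c * p) = p"
  by (simp add: mult.assoc[symmetric] comm_homD(3)[OF comm_hom_const3, symmetric] comm_homD(1)[OF comm_hom_const3])

lemma total_degree_eq_0_unit:
  assumes "total_degree p = 0" "p \<noteq> 0" shows "p dvd 1"
proof -
  obtain c where c: "p = const3 c" using assms(1) total_degree_eq_0_iff by auto
  then have "c \<noteq> 0" using assms(2) by auto
  then have "const3 (inverse c) * (const3 c * 1) = 1" by (rule const3_cancel)
  then show ?thesis using c by (metis dvdI mult.commute mult.right_neutral)
qed

lemma unit_total_degree: assumes "p dvd 1" shows "total_degree p = 0"
proof -
  obtain q where q: "1 = p * q" using assms by (auto elim: dvdE)
  then have "p \<noteq> 0" "q \<noteq> 0" by auto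
  moreover have "total_degree (1 :: 'a poly poly poly) = 0"
    using total_degree_const3[of 1] by (simp only: comm_homD(1)[OF comm_hom_const3])
  ultimately show ?thesis using total_degree_mult[of p q] q by simp
qed

abbreviation poly_in :: "'k::field poly poly poly \<Rightarrow> 'k poly \<Rightarrow> 'k poly poly poly" where
  "poly_in \<equiv> eval_hom const3"

lemma comm_hom_poly_in: "comm_hom (poly_in x)"
  by (intro comm_hom_eval comm_hom_const3)

lemmas poly_in_simps = comm_homD[OF comm_hom_poly_in]

lemma poly_in_pCons: "poly_in x (pCons a p) = const3 a + x * poly_in x p"
  by (simp add: comm_hom_const3)

lemma total_degree_poly_in:
  assumes f: "total_degree f > 0" and "p \<noteq> 0"
  shows "poly_in f p \<noteq> 0 \<and> total_degree (poly_in f p) = degree p * total_degree f"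
  using assms(2)
proof (induction p)
  case 0 then show ?case by simp
next
  case (pCons a p)
  show ?case
  proof (cases "p = 0")
    case True
    then show ?thesis using pCons by (simp add: poly_in_pCons del: eval_hom_pCons)
  next
    case False
    have f0: "f \<noteq> 0" using f by (auto simp: total_degree_def homogenize_simps)
    have "total_degree (f * poly_in f p) = total_degree f + degree p * total_degree f"
      using pCons.IH[OF False] f0 by (simp add: total_degree_mult)
    moreover from this have "total_degree (poly_in f (pCons a p)) = total_degree (f * poly_in f p)"
      unfolding poly_in_pCons using f by (intro total_degree_const_add) simp
    ultimately have td: "total_degree (poly_in f (pCons a p)) = degree (pCons a p) * total_degree f"
      using False by simp
    then have "total_degree (poly_in f (pCons a p)) > 0" using f False by simp
    then have "poly_in f (pCons a p) \<noteq> 0" by (auto simp: total_degree_def homogenize_simps)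
    then show ?thesis using td by blast
  qed
qed

lemma poly_in_closed:
  assumes "closed_subring U" "range const3 \<subseteq> U" "x \<in> U" shows "poly_in x p \<in> U"
proof -
  interpret closed_subring U by fact
  show ?thesis using assms(2,3) by (induction p) (auto simp: poly_in_pCons simp del: eval_hom_pCons)
qed

lemma poly_in_to_ac3: "to_ac3 (poly_in f p) = poly_in (to_ac3 f) (map_poly to_ac p)"
  by (induction p) (simp_all add: poly_in_pCons to_ac3_simps map_poly_pCons del: eval_hom_pCons)

lemma poly_in_remainder: "x - const3 c dvd poly_in x p - const3 (poly p c)"
proof (induction p)
  case 0 then show ?case by (simp add: comm_homD(4)[OF comm_hom_const3])
next
  case (pCons a p)
  have "poly_in x (pCons a p) - const3 (poly (pCons a p) c) =
    (x - const3 c) * poly_in x p + const3 c * (poly_in x p - const3 (poly p c))"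
    by (simp add: poly_in_pCons comm_homD[OF comm_hom_const3] algebra_simps del: eval_hom_pCons)
  then show ?case using pCons by (simp add: dvd_add)
qed

lemma functional_poly_in:
  assumes "ac_functional \<psi>"
  shows "ext3 \<psi> (poly_in (to_ac3 f) p) = poly_in f (map_poly \<psi> p)"
  by (induction p) (simp_all add: poly_in_pCons ext3_functional_add[OF assms] ext3_functional_const3[OF assms]
      ext3_functional_mult[OF assms] ext3_functional_0[OF assms] map_poly_pCons ac_functionalD[OF assms] del: eval_hom_pCons)

text \<open>Over an algebraically closed field the polynomial splits into linear factors and a
  non-zero constant. The constant is a unit, so the prime divides one of the linear factors.\<close>

lemma prime_dvd_poly_in:
  fixes q :: "'k::field alg_closure poly poly poly"
  assumes q: "prime_elem q" and "p \<noteq> 0" "q dvd poly_in x p"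
  shows "\<exists>c. q dvd x - const3 c"
  using assms(2,3)
proof (induction "degree p" arbitrary: p)
  case 0
  then obtain a where a: "p = [:a:]" by (metis degree_0_id)
  then have "a \<noteq> 0" "poly_in x p = const3 a" using 0 by (auto simp: eval_hom_const[OF comm_hom_const3] simp del: eval_hom_pCons)
  then have "q dvd const3 a" "const3 a dvd 1" using 0 total_degree_eq_0_unit[of "const3 a"] by auto
  then have "q dvd 1" using dvd_trans by blast
  then show ?case using q by (simp add: prime_elem_def)
next
  case (Suc d)
  obtain c where "poly p c = 0" using alg_closed_imp_poly_has_root[of p] Suc by auto
  then obtain r where r: "p = [:- c, 1:] * r" by (auto simp: poly_eq_0_iff_dvd elim: dvdE)
  have r0: "r \<noteq> 0" using Suc r by auto
  have "degree p = Suc (degree r)" unfolding r using r0 by (subst degree_mult_eq) auto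
  have "poly_in x p = (x - const3 c) * poly_in x r"
    unfolding r poly_in_simps by (simp add: poly_in_pCons comm_homD[OF comm_hom_const3] del: eval_hom_pCons)
  then have "q dvd x - const3 c \<or> q dvd poly_in x r"
    using Suc.prems(2) prime_elem_dvd_multD[OF q] by metis
  then show ?case
  proof
    assume "q dvd poly_in x r"
    then show ?thesis using Suc.hyps(1)[of r] Suc.hyps(2) \<open>degree p = Suc (degree r)\<close> r0 by simp
  qed auto
qed

text \<open>For descent, a coordinate functional that is non-zero at 1 is applied to the equation
  with the quotient; it multiplies \<open>b\<close> by a non-zero scalar and sends the quotient to
  \<open>k\<close>.\<close>

lemma dvd_to_ac3_iff: "to_ac3 a dvd to_ac3 b \<longleftrightarrow> a dvd b"
proof
  assume "to_ac3 a dvd to_ac3 b"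
  then obtain q where q: "to_ac3 b = to_ac3 a * q" by (auto elim: dvdE)
  have "\<exists>e. ac_coord e (1 :: 'a alg_closure) \<noteq> 0"
  proof (rule ccontr)
    assume "\<not> (\<exists>e. ac_coord e (1 :: 'a alg_closure) \<noteq> 0)"
    then have "(1 :: 'a alg_closure) = 0" using ac_coord_expansion[of "{}" 1] by simp
    then show False by simp
  qed
  then obtain e where e: "ac_coord e (1 :: 'a alg_closure) \<noteq> 0" by blast
  have "coord3 e (const3 1 * to_ac3 b) = coord3 e (to_ac3 a * q)"
    using q by (simp add: comm_homD(1)[OF comm_hom_const3])
  then have "const3 (ac_coord e 1) * b = a * coord3 e q" by (simp only: coord3_tensor coord3_mult)
  then have "b = const3 (inverse (ac_coord e 1)) * (a * coord3 e q)" using const3_cancel[OF e] by metis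
  also have "\<dots> = a * (const3 (inverse (ac_coord e 1)) * coord3 e q)" by (simp add: algebra_simps)
  finally show "a dvd b" by (rule dvdI)
next
  assume "a dvd b"
  then show "to_ac3 a dvd to_ac3 b" by (auto simp: to_ac3_simps elim!: dvdE)
qed

text \<open>The coefficients of the quotient by \<open>T - c\<close> are the intermediate values of
  Horner's scheme.\<close>

lemma coeff_synthetic_div: "coeff (synthetic_div p c) j = poly (poly_shift (Suc j) p) c"
proof (induction p arbitrary: j)
  case 0 then show ?case by simp
next
  case (pCons a p)
  have "poly_shift (Suc j) (pCons a p) = poly_shift j p"
    by (intro poly_eqI) (simp add: coeff_poly_shift)
  moreover have "poly_shift 0 p = p" by (intro poly_eqI) (simp add: coeff_poly_shift)
  ultimately show ?case using pCons.IH by (cases j) simp_all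
qed

lemma minimal_polynomial:
  fixes c :: "'k::field alg_closure"
  assumes "g \<noteq> 0" "poly (map_poly to_ac g) c = 0"
  obtains p :: "'k poly" where "lead_coeff p = 1" "poly (map_poly to_ac p) c = 0" "degree p > 0"
    "\<And>r. poly (map_poly to_ac r) c = 0 \<Longrightarrow> p dvd r"
    "\<And>r. r \<noteq> 0 \<Longrightarrow> poly (map_poly to_ac r) c = 0 \<Longrightarrow> degree p \<le> degree r"
proof -
  let ?Z = "\<lambda>r :: 'k poly. poly (map_poly to_ac r) c"
  have hom: "comm_hom ?Z" by (intro comm_hom_comp[OF comm_hom_poly] comm_hom_map_poly comm_hom_to_ac)
  note Z = comm_homD[OF hom]
  obtain q where q: "q \<noteq> 0 \<and> ?Z q = 0" and qmin: "\<And>r. r \<noteq> 0 \<and> ?Z r = 0 \<Longrightarrow> degree q \<le> degree r"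
    using ex_has_least_nat[of "\<lambda>r. r \<noteq> 0 \<and> ?Z r = 0" g degree] assms by blast
  define p where "p = smult (inverse (lead_coeff q)) q"
  have p: "lead_coeff p = 1" using q by (simp add: p_def)
  have dp: "degree p = degree q" using q by (simp add: p_def)
  have Zp: "?Z p = 0" using q by (simp add: p_def map_poly_smult)
  have pmin: "degree p \<le> degree r" if "r \<noteq> 0" "?Z r = 0" for r using qmin that dp by auto
  have p0: "p \<noteq> 0" using p by auto
  have deg: "degree p > 0"
  proof (rule ccontr)
    assume "\<not> degree p > 0"
    then obtain a where a: "p = [:a:]" by (metis degree_0_id gr0I)
    then show False using Zp p by (simp add: map_poly_pCons)
  qed
  have "p dvd r" if "?Z r = 0" for r
  proof -
    have "?Z (p * (r div p) + r mod p) = 0" using that by simp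
    then have "?Z (r mod p) = 0" using Zp by (simp only: Z mult_zero_left add_0)
    then have "r mod p = 0" using pmin[of "r mod p"] degree_mod_less[OF p0, of r] by (meson not_le)
    then show ?thesis by (rule mod_0_imp_dvd)
  qed
  then show ?thesis using that p Zp deg pmin by blast
qed

text \<open>A linear relation between the powers of \<open>c\<close> below \<open>d\<close> would be
  a polynomial of too small a degree vanishing at \<open>c\<close>. So the powers are independent
  and a functional may be prescribed on them.\<close>

lemma power_functional:
  fixes c :: "'k::field alg_closure"
  assumes indep: "\<And>r :: 'k poly. r \<noteq> 0 \<Longrightarrow> poly (map_poly to_ac r) c = 0 \<Longrightarrow> d \<le> degree r" and "d > 0"
  obtains \<psi> where "ac_functional \<psi>" "\<And>i. i < d \<Longrightarrow> \<psi> (c ^ i) = (if i = d - 1 then 1 else 0)"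
proof -
  have rel: "u i = 0" if u: "(\<Sum>i<d. to_ac (u i) * c ^ i) = 0" and i: "i < d" for u i
  proof -
    define r where "r = (\<Sum>i<d. monom (u i) i)"
    have coeff_r: "coeff r i = (if i < d then u i else 0)" for i
      by (simp add: r_def coeff_sum)
    have "degree r < d"
      using \<open>d > 0\<close> by (intro le_less_trans[OF degree_le[of "d - 1"]]) (auto simp: coeff_r)
    have "map_poly to_ac r = (\<Sum>i<d. monom (to_ac (u i)) i)"
      by (intro poly_eqI) (simp add: coeff_map_poly coeff_r coeff_sum)
    then have "poly (map_poly to_ac r) c = 0" using u by (simp add: poly_sum poly_monom)
    then have "r = 0" using indep[of r] \<open>degree r < d\<close> by force
    then show "u i = 0" using coeff_r[of i] i by simp
  qed
  have inj: "inj_on (\<lambda>i. c ^ i) {..<d}"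
  proof (rule inj_onI, rule ccontr)
    fix i j assume ij: "i \<in> {..<d}" "j \<in> {..<d}" "c ^ i = c ^ j" "i \<noteq> j"
    let ?u = "\<lambda>x. if x = i then 1 else if x = j then - 1 else (0 :: 'k)"
    have "(\<Sum>x<d. to_ac (?u x) * c ^ x) = (\<Sum>x\<in>{i, j}. to_ac (?u x) * c ^ x)"
      using ij by (intro sum.mono_neutral_right) auto
    also have "\<dots> = 0" using ij by simp
    finally have "?u i = 0" by (rule rel) (use ij in auto)
    then show False by simp
  qed
  let ?B = "(\<lambda>i. c ^ i) ` {..<d}"
  have "ac.independent ?B"
  proof (rule ac.independent_if_scalars_zero)
    fix u x assume u: "(\<Sum>x\<in>?B. to_ac (u x) * x) = 0" and x: "x \<in> ?B"
    then obtain i where i: "i < d" "x = c ^ i" by auto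
    have "(\<Sum>i<d. to_ac (u (c ^ i)) * c ^ i) = 0" using u by (simp add: sum.reindex[OF inj])
    from rel[OF this i(1)] show "u x = 0" using i(2) by simp
  qed simp
  interpret vp: vector_space_pair "\<lambda>(a :: 'k) (x :: 'k alg_closure). to_ac a * x" "(*) :: 'k \<Rightarrow> 'k \<Rightarrow> 'k"
    by unfold_locales (simp_all add: algebra_simps)
  obtain \<psi> where lin: "Vector_Spaces.linear (\<lambda>a x. to_ac a * x) (*) \<psi>"
    and val: "\<forall>x\<in>?B. \<psi> x = (if x = c ^ (d - 1) then 1 else 0)"
    using vp.linear_independent_extend[OF \<open>ac.independent ?B\<close>, of "\<lambda>x. if x = c ^ (d - 1) then 1 else 0"] by blast
  interpret lin: Vector_Spaces.linear "\<lambda>a x. to_ac a * x" "(*)" \<psi> by (rule lin)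
  show ?thesis
  proof (rule that)
    show "ac_functional \<psi>" unfolding ac_functional_def using lin.add lin.scale by auto
    fix i assume i: "i < d"
    have "c ^ i = c ^ (d - 1) \<longleftrightarrow> i = d - 1" using inj i by (auto simp: inj_on_def)
    then show "\<psi> (c ^ i) = (if i = d - 1 then 1 else 0)" using val i by simp
  qed
qed

text \<open>
  With \<open>p = (T - c) * w\<close> over the algebraic closure, the functional that reads off the
  coefficient of \<open>c ^ (degree p - 1)\<close> kills all coefficients of \<open>w\<close> except the constant one.
\<close>

lemma functional_synthetic_div:
  assumes \<psi>: "ac_functional \<psi>" "\<And>i. i < degree p \<Longrightarrow> \<psi> (c ^ i) = (if i = degree p - 1 then 1 else 0)"
    and p: "lead_coeff p = 1" "degree p > 0"
  shows "map_poly \<psi> (synthetic_div (map_poly to_ac p) c) = 1"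
proof (rule poly_eqI)
  fix j
  note [simp] = ac_functionalD[OF \<psi>(1)]
  have sum: "\<psi> (sum g I) = (\<Sum>i\<in>I. \<psi> (g i))" for g and I :: "nat set"
    by (induction I rule: infinite_finite_induct) auto
  let ?s = "poly_shift (Suc j) (map_poly to_ac p)"
  have cs: "coeff ?s i = to_ac (coeff p (i + Suc j))" for i
    by (simp add: coeff_poly_shift coeff_map_poly)
  have "poly ?s c = (\<Sum>i\<le>degree ?s. coeff ?s i * c ^ i)" by (rule poly_altdef)
  also have "\<dots> = (\<Sum>i<degree p. coeff ?s i * c ^ i)"
  proof (rule sum.mono_neutral_left)
    show "{..degree ?s} \<subseteq> {..<degree p}"
    proof
      fix i assume "i \<in> {..degree ?s}"
      moreover have "degree ?s \<le> degree p - 1"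
        by (intro degree_le allI impI) (simp add: cs coeff_eq_0)
      ultimately show "i \<in> {..<degree p}" using p(2) by auto
    qed
  qed (auto simp: coeff_eq_0)
  finally have "\<psi> (poly ?s c) = (\<Sum>i<degree p. coeff p (i + Suc j) * \<psi> (c ^ i))"
    by (simp only: sum cs ac_functionalD(2)[OF \<psi>(1)])
  also have "\<dots> = (\<Sum>i<degree p. if i = degree p - 1 then coeff p (degree p + j) else 0)"
    using \<psi>(2) p(2) by (intro sum.cong refl) auto
  also have "\<dots> = coeff p (degree p + j)" using p(2) by simp
  also have "\<dots> = coeff 1 j" using p by (cases j) (auto simp: coeff_eq_0)
  finally show "coeff (map_poly \<psi> (synthetic_div (map_poly to_ac p) c)) j = coeff 1 j"
    by (simp add: coeff_map_poly coeff_synthetic_div)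
qed

section \<open>A tower of two exponential maps\<close>

lemma total_degree_0 [simp]: "total_degree 0 = 0"
  by (simp add: total_degree_def homogenize_simps)

text \<open>\<open>f\<close> is substituted for the inner variable, so modulo \<open>f\<close> only
  the terms free of that variable remain.\<close>

lemma eval2_remainder: "f dvd eval2 f g H - poly_in g (map_poly (\<lambda>p. coeff p 0) H)"
proof (induction H)
  case 0 show ?case by (simp add: eval2_def)
next
  case (pCons p H)
  have "eval2 f g (pCons p H) = poly_in f p + g * eval2 f g H"
    unfolding eval2_def by (rule eval_hom_pCons[OF comm_hom_poly_in])
  moreover obtain a q where p: "p = pCons a q" by (cases p)
  moreover have "map_poly (\<lambda>p. coeff p 0) (pCons p H) = pCons a (map_poly (\<lambda>p. coeff p 0) H)"
    by (simp add: map_poly_pCons p)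
  moreover have "(const3 a + f * u) + g * v - (const3 a + g * w) = f * u + g * (v - w)" for u v w
    by (simp add: right_diff_distrib)
  ultimately have "eval2 f g (pCons p H) - poly_in g (map_poly (\<lambda>p. coeff p 0) (pCons p H)) =
    f * poly_in f q + g * (eval2 f g H - poly_in g (map_poly (\<lambda>p. coeff p 0) H))"
    by (simp only: poly_in_pCons)
  moreover have "f dvd f * poly_in f q + g * (eval2 f g H - poly_in g (map_poly (\<lambda>p. coeff p 0) H))"
    using pCons.IH by (intro dvd_add dvd_triv_left dvd_mult)
  ultimately show ?case by (simp only:)
qed

text \<open>Take a relation whose leading coefficient has least degree in the inner variable. Were
  it zero at inner variable 0, that variable could be divided out of it; cancelling \<open>f\<close>
  would leave a relation with a leading coefficient of smaller degree.\<close>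

lemma relation_residue:
  fixes f g :: "'a::field poly poly poly"
  assumes f: "f \<noteq> 0" and "G \<noteq> 0" "eval2 f g G = 0"
  shows "\<exists>\<gamma>. \<gamma> \<noteq> 0 \<and> f dvd poly_in g \<gamma>"
proof -
  obtain G where G: "G \<noteq> 0 \<and> eval2 f g G = 0"
    and Gmin: "\<And>H. H \<noteq> 0 \<and> eval2 f g H = 0 \<Longrightarrow> degree (lead_coeff G) \<le> degree (lead_coeff H)"
    using ex_has_least_nat[of "\<lambda>G. G \<noteq> 0 \<and> eval2 f g G = 0" _ "\<lambda>G. degree (lead_coeff G)"] assms(2,3) by blast
  define \<gamma> where "\<gamma> = map_poly (\<lambda>p. coeff p 0) G"
  have \<gamma>0: "\<gamma> \<noteq> 0"
  proof
    assume "\<gamma> = 0"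
    then have c0: "coeff (coeff G i) 0 = 0" for i
      by (metis (no_types, lifting) \<gamma>_def coeff_0 coeff_map_poly)
    define H where "H = map_poly (poly_shift (Suc 0)) G"
    have sh: "[:0, 1:] * poly_shift (Suc 0) p = p" if "coeff p 0 = 0" for p :: "'a poly"
      using that by (intro poly_eqI) (auto simp: coeff_pCons coeff_poly_shift split: nat.splits)
    have GH: "G = smult [:0, 1:] H"
      by (rule poly_eqI) (simp add: H_def coeff_map_poly sh[OF c0] del: mult_pCons_left)
    have H0: "H \<noteq> 0"
    proof
      assume "H = 0"
      then have "G = 0" using GH by (simp only: smult_0_right)
      then show False using G by blast
    qed
    have eH: "eval2 f g (smult [:0, 1:] H) = f * eval2 f g H"
    proof -
      have "smult [:0, 1:] H = [:[:0, 1:]:] * H" by simp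
      then have "eval2 f g (smult [:0, 1:] H) = eval2 f g [:[:0, 1:]:] * eval2 f g H"
        by (simp only: comm_homD(3)[OF comm_hom_eval2])
      also have "eval2 f g [:[:0, 1:]:] = f"
        unfolding eval2_def by (simp only: eval_hom_const[OF comm_hom_poly_in] eval_hom_var[OF comm_hom_const3])
      finally show ?thesis .
    qed
    have "eval2 f g G = f * eval2 f g H" unfolding GH by (rule eH)
    then have "f * eval2 f g H = 0" using G by metis
    then have "eval2 f g H = 0" using f by simp
    then have "degree (lead_coeff G) \<le> degree (lead_coeff H)" using Gmin H0 by blast
    moreover have "lead_coeff G = [:0, 1:] * lead_coeff H" unfolding GH by (rule lead_coeff_smult)
    moreover have "degree ([:0, 1:] * lead_coeff H) = Suc (degree (lead_coeff H))"
      using H0 by (subst degree_mult_eq) auto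
    ultimately show False by simp
  qed
  from eval2_remainder[of f g G] have "f dvd 0 - poly_in g \<gamma>" using G by (simp only: \<gamma>_def)
  then have dvd: "f dvd poly_in g \<gamma>" by (simp only: diff_0 dvd_minus_iff)
  show ?thesis using \<gamma>0 dvd by blast
qed

locale tower =
  \<delta>: exp_map_on UNIV D + \<phi>: exp_map_on \<delta>.fixed F
  for D F :: "nat \<Rightarrow> 'k::field poly poly poly \<Rightarrow> 'k poly poly poly" +
  assumes lin: "k_linear (D n)" "k_linear (F n)"
    and scalars: "range const3 \<subseteq> \<phi>.fixed"
begin

abbreviation "A \<equiv> \<delta>.fixed"
abbreviation "R \<equiv> \<phi>.fixed"

lemma R_subset_A: "R \<subseteq> A"
  by (rule \<phi>.fixed_subset)

text \<open>The factors may come from the whole ring: factorial closedness of \<open>A\<close> first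
  brings both into \<open>A\<close>, where that of \<open>R\<close> takes over.\<close>

lemma R_factorially_closed: "a * b \<in> R \<Longrightarrow> a * b \<noteq> 0 \<Longrightarrow> a \<in> R"
proof -
  assume ab: "a * b \<in> R" "a * b \<noteq> 0"
  then have abA: "a * b \<in> A" "b * a \<in> A" using R_subset_A by (auto simp: mult.commute)
  have "a \<in> A" using abA(1) ab(2) by (rule \<delta>.fixed_factorially_closed) auto
  moreover have "b \<in> A" using abA(2) ab(2) by (intro \<delta>.fixed_factorially_closed[of b a]) (auto simp: mult.commute)
  ultimately show "a \<in> R" using ab \<phi>.fixed_factorially_closed by blast
qed

text \<open>Both maps extend to the closure and their invariants are the base changes, so the
  two-step argument for \<open>R\<close> repeats there.\<close>

lemma base_change_R_factorially_closed:
  assumes ab: "a * b \<in> base_change R" "a * b \<noteq> 0"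
  shows "a \<in> base_change R"
proof -
  have U: "base_change (UNIV :: 'k poly poly poly set) = UNIV" by (simp add: base_change_def)
  have scalars_A: "range const3 \<subseteq> A" using scalars R_subset_A by blast
  interpret KD: exp_map_on UNIV "\<lambda>n. extend_scalars (D n)"
    using exp_map_on_base_change[OF \<delta>.exp_map_on_axioms lin(1)] U by simp
  have KD: "KD.fixed = base_change A"
    using fixed_base_change[OF \<delta>.exp_map_on_axioms lin(1)] U by simp
  interpret KF: exp_map_on "base_change A" "\<lambda>n. extend_scalars (F n)"
    by (rule exp_map_on_base_change[OF \<phi>.exp_map_on_axioms lin(2) scalars_A])
  have KF: "KF.fixed = base_change R"
    by (rule fixed_base_change[OF \<phi>.exp_map_on_axioms lin(2) scalars_A])
  have "base_change R \<subseteq> base_change A" using R_subset_A by (auto simp: base_change_def)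
  then have abA: "a * b \<in> KD.fixed" "b * a \<in> KD.fixed" using ab KD by (auto simp: mult.commute)
  have "a \<in> KD.fixed" using abA(1) ab(2) by (rule KD.fixed_factorially_closed) auto
  moreover have "b \<in> KD.fixed" using abA(2) ab(2) by (intro KD.fixed_factorially_closed[of b a]) (auto simp: mult.commute)
  ultimately show "a \<in> base_change R"
    using ab KF.fixed_factorially_closed[of a b] unfolding KD KF by blast
qed

end

text \<open>The normalization \<open>f_0\<close> makes every multiple of \<open>f\<close> have
  constant term 0, which excludes the unwanted factor in \<open>f_dvd_of_relation\<close>.\<close>

locale tower_generator = tower +
  fixes f :: "'a poly poly poly"
  assumes f_in: "f \<in> R" and f_nonconst: "total_degree f > 0"
    and f_minimal: "\<And>g. g \<in> R \<Longrightarrow> total_degree g > 0 \<Longrightarrow> total_degree f \<le> total_degree g"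
    and f_0: "const_term f = 0"
begin

text \<open>Some coordinate of \<open>g\<close> is non-constant, since otherwise \<open>g\<close>
  would be constant. That coordinate lies in \<open>R\<close>, and its total degree does not exceed
  that of \<open>g\<close>.\<close>

lemma base_change_minimal:
  assumes g: "g \<in> base_change R" "total_degree g > 0"
  shows "total_degree f \<le> total_degree g"
proof -
  have "\<exists>e. total_degree (coord3 e g) > 0"
  proof (rule ccontr)
    assume *: "\<not> (\<exists>e. total_degree (coord3 e g) > 0)"
    have t0: "total_degree (const3 e * to_ac3 (coord3 e g)) = 0" for e
    proof -
      have "coord3 e g \<in> range const3" using * total_degree_eq_0_iff by blast
      then obtain x where "coord3 e g = const3 x" by blast
      then have "const3 e * to_ac3 (coord3 e g) = const3 (e * to_ac x)"
        by (simp add: comm_homD(3)[OF comm_hom_const3])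
      then show ?thesis by simp
    qed
    have "total_degree (\<Sum>e\<in>I. const3 e * to_ac3 (coord3 e g)) \<le> 0" for I
    proof (induction I rule: infinite_finite_induct)
      case (insert x I)
      have "total_degree (const3 x * to_ac3 (coord3 x g) + (\<Sum>e\<in>I. const3 e * to_ac3 (coord3 e g))) \<le> 0"
        using insert.IH t0 by (intro total_degree_add_le) simp_all
      then show ?case using insert.hyps by simp
    qed simp_all
    from this[of "supp3 g"] have "total_degree g \<le> 0"
      unfolding coord3_expansion[OF finite_supp3 order_refl] .
    then show False using g(2) by simp
  qed
  then obtain e where e: "total_degree (coord3 e g) > 0" by blast
  have "total_degree f \<le> total_degree (coord3 e g)"
    using g(1) e by (intro f_minimal) (auto simp: base_change_def)
  also have "\<dots> \<le> total_degree g" by (rule total_degree_functional_le[OF ac_functional_coord])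
  finally show ?thesis .
qed

text \<open>By factorial closedness a factor lies in the base change of \<open>R\<close>. A factor
  of positive degree therefore already has at least the degree of \<open>f\<close>, so its cofactor
  is constant. Irreducible elements are prime because polynomial rings over a field are
  factorial.\<close>

lemma prime_fibre: "prime_elem (to_ac3 f - const3 c)"
proof -
  let ?q = "to_ac3 f - const3 c"
  have td: "total_degree ?q = total_degree f" using f_nonconst by (simp add: total_degree_diff_const)
  have q0: "?q \<noteq> 0"
  proof
    assume "?q = 0"
    then have "total_degree ?q = 0" by (simp only: total_degree_0)
    then show False using td f_nonconst by simp
  qed
  have qR: "?q \<in> base_change R"
    unfolding base_change_def
  proof (intro CollectI allI)
    fix e
    have "?q = to_ac3 f * const3 1 + const3 (- c)" by (simp add: comm_homD[OF comm_hom_const3])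
    then have "coord3 e ?q = f * const3 (ac_coord e 1) + const3 (ac_coord e (- c))"
      by (simp only: coord3_add coord3_mult coord3_const3)
    also have "\<dots> \<in> R" using scalars f_in by (intro \<phi>.fixed.add_closed \<phi>.fixed.mult_closed) auto
    finally show "coord3 e ?q \<in> R" .
  qed
  have "irreducible ?q"
  proof (rule irreducibleI)
    show "?q \<noteq> 0" by (rule q0)
    show "\<not> ?q dvd 1" using unit_total_degree[of ?q] td f_nonconst by auto
    fix a b assume ab: "?q = a * b"
    then have ab0: "a * b \<noteq> 0" "a \<noteq> 0" "b \<noteq> 0" using q0 by auto
    have aR: "a \<in> base_change R" using qR ab ab0(1) base_change_R_factorially_closed[of a b] by simp
    have sum: "total_degree a + total_degree b = total_degree f"
      using td ab total_degree_mult[OF ab0(2,3)] by simp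
    have "total_degree a = 0 \<or> total_degree b = 0"
    proof (rule ccontr)
      assume *: "\<not> (total_degree a = 0 \<or> total_degree b = 0)"
      then have "total_degree f \<le> total_degree a" using base_change_minimal[OF aR] by auto
      then show False using sum * by simp
    qed
    then show "a dvd 1 \<or> b dvd 1" using total_degree_eq_0_unit ab0 by blast
  qed
  then show ?thesis by (rule irreducible_imp_prime_elem)
qed

lemma f_prime: "f dvd a * b \<Longrightarrow> f dvd a \<or> f dvd b"
proof -
  assume "f dvd a * b"
  then have "to_ac3 f dvd to_ac3 a * to_ac3 b" unfolding to_ac3_simps(3)[symmetric] dvd_to_ac3_iff .
  moreover have "prime_elem (to_ac3 f)" using prime_fibre[of 0] by (simp add: comm_homD(4)[OF comm_hom_const3])
  ultimately show ?thesis using prime_elem_dvd_multD dvd_to_ac3_iff by metis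
qed

lemma f_nonzero: "f \<noteq> 0"
proof
  assume "f = 0"
  then have "total_degree f = 0" by (simp only: total_degree_0)
  then show False using f_nonconst by simp
qed

lemma f_not_unit: "\<not> f dvd 1"
proof
  assume "f dvd 1"
  then have "total_degree f = 0" by (rule unit_total_degree)
  then show False using f_nonconst by simp
qed

lemma f_prime_power: "f dvd g ^ n \<Longrightarrow> f dvd g"
proof (induction n)
  case 0 then show ?case using f_not_unit by simp
next
  case (Suc n) then show ?case using f_prime[of g "g ^ n"] by auto
qed

lemma const_term_poly_in: "const_term (poly_in g p) = poly p (const_term g)"
  by (induction p) (simp_all add: poly_in_pCons comm_homD[OF comm_hom_const_term] del: eval_hom_pCons)

text \<open>Modulo the prime \<open>f\<close>, \<open>g\<close> is a root of a non-zero
  \<open>\<gamma>\<close>. Splitting the powers of the variable off \<open>\<gamma>\<close> leaves a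
  cofactor whose value at \<open>g\<close> has non-zero constant term, so \<open>f\<close> does not
  divide it and must divide a power of \<open>g\<close>.\<close>

lemma f_dvd_of_relation:
  assumes G: "G \<noteq> 0" "eval2 f g G = 0" and g0: "const_term g = 0"
  shows "f dvd g"
proof -
  obtain \<gamma> where \<gamma>0: "\<gamma> \<noteq> 0" and dvd: "f dvd poly_in g \<gamma>"
    using relation_residue[OF f_nonzero G] by blast
  obtain \<gamma>' where \<gamma>': "\<gamma> = [:- 0, 1:] ^ order 0 \<gamma> * \<gamma>'" "\<not> [:- 0, 1:] dvd \<gamma>'"
    using order_decomp[OF \<gamma>0, of 0] by blast
  have v: "poly_in g [:- 0, 1:] = g" using eval_hom_var[OF comm_hom_const3] by simp
  have "poly_in g \<gamma> = poly_in g ([:- 0, 1:] ^ order 0 \<gamma> * \<gamma>')" by (rule arg_cong[OF \<gamma>'(1)])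
  also have "\<dots> = g ^ order 0 \<gamma> * poly_in g \<gamma>'" by (simp only: poly_in_simps v)
  finally have "f dvd g ^ order 0 \<gamma> * poly_in g \<gamma>'" using dvd by (simp only:)
  then have "f dvd g ^ order 0 \<gamma> \<or> f dvd poly_in g \<gamma>'" by (rule f_prime)
  then show ?thesis
  proof
    assume "f dvd poly_in g \<gamma>'"
    then obtain h where "poly_in g \<gamma>' = f * h" by (auto elim: dvdE)
    then have "const_term (poly_in g \<gamma>') = 0" by (simp add: comm_homD[OF comm_hom_const_term] f_0)
    then have "poly \<gamma>' 0 = 0" by (simp add: const_term_poly_in g0)
    then have "[:- 0, 1:] dvd \<gamma>'" by (rule iffD1[OF poly_eq_0_iff_dvd])
    then show ?thesis using \<gamma>'(2) by blast
  next
    assume "f dvd g ^ order 0 \<gamma>"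
    then show ?thesis by (rule f_prime_power)
  qed
qed

end

locale tower_slices = tower_generator +
  fixes y s :: "'a poly poly poly"
  assumes y: "y \<in> A" "\<phi>.dg y > 0" and s: "\<delta>.dg s > 0"
begin

text \<open>Once its constant term is subtracted, a member of \<open>R\<close> is divisible by
  \<open>f\<close>. The quotient stays in \<open>R\<close> by factorial closedness and has smaller
  total degree.\<close>

lemma R_generated: "g \<in> R \<Longrightarrow> \<exists>p. g = poly_in f p"
proof (induction "total_degree g" arbitrary: g rule: less_induct)
  case less
  show ?case
  proof (cases "total_degree g = 0")
    case True
    then obtain c where "g = const3 c" using total_degree_eq_0_iff by auto
    then have "g = poly_in f [:c:]" by (simp add: eval_hom_const[OF comm_hom_const3] del: eval_hom_pCons)
    then show ?thesis by blast
  next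
    case False
    let ?c = "const_term g"
    let ?g = "g - const3 ?c"
    have td: "total_degree ?g = total_degree g" using False by (simp add: total_degree_diff_const)
    have gR: "?g \<in> R" using less.prems scalars by (intro \<phi>.fixed.diff_closed) auto
    obtain G where "G \<noteq> 0" "eval2 f ?g G = 0"
      using fixed_pair_dependent[OF \<delta>.exp_map_on_axioms \<phi>.exp_map_on_axioms scalars f_in gR y s] by blast
    then have "f dvd ?g" by (rule f_dvd_of_relation) (simp add: comm_homD[OF comm_hom_const_term])
    then obtain h where h: "?g = f * h" by (auto elim: dvdE)
    have g0: "?g \<noteq> 0"
    proof
      assume "?g = 0"
      then have "total_degree ?g = 0" by (simp only: total_degree_0)
      then show False using td False by simp
    qed
    then have h0: "h \<noteq> 0" using h by auto
    have "h \<in> R" using R_factorially_closed[of h f] gR g0 h by (simp add: mult.commute)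
    moreover have "total_degree h < total_degree g"
      using total_degree_mult[OF f_nonzero h0] h td f_nonconst by simp
    ultimately obtain p where "h = poly_in f p" using less.hyps by blast
    then have "g = poly_in f (pCons ?c p)" using h by (simp add: poly_in_pCons algebra_simps del: eval_hom_pCons)
    then show ?thesis by blast
  qed
qed

lemma poly_in_f_in_R: "poly_in f p \<in> R"
  by (intro poly_in_closed scalars f_in \<phi>.fixed.closed_subring_axioms)

text \<open>This expresses that \<open>x\<close> generates \<open>A\<close> over the fraction field
  of \<open>R\<close>, with denominators written out instead of a fraction field.\<close>

definition generic :: "'a poly poly poly \<Rightarrow> bool" where
  "generic x \<longleftrightarrow> x \<in> A \<and> x \<notin> R \<and> (\<forall>a\<in>A. \<exists>g\<in>R. g \<noteq> 0 \<and> (\<exists>P\<in>polys_over R. g * a = poly P x))"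

lemma polys_over_R_pcompose:
  assumes "P \<in> polys_over R" "Q \<in> polys_over R" shows "pcompose P Q \<in> polys_over R"
proof -
  interpret PR: closed_subring "polys_over R" by (rule \<phi>.fixed.closed_subring_polys_over)
  show ?thesis using assms(1)
  proof (induction P)
    case 0 then show ?case by simp
  next
    case (pCons a P)
    have "a \<in> R" using polys_overD[OF pCons.prems, of 0] by simp
    moreover have "P \<in> polys_over R"
      using polys_overD[OF pCons.prems, of "Suc _"] by (auto intro!: polys_overI)
    ultimately show ?case using pCons.IH assms(2) \<phi>.fixed.polys_over_const by (simp add: pcompose_pCons)
  qed
qed

text \<open>\<open>x\<close> is an affine function of \<open>x'\<close> over \<open>R\<close>, so
  polynomials in \<open>x\<close> can be rewritten in \<open>x'\<close>. As \<open>t(f)\<close> has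
  smaller total degree than \<open>p(f)\<close>, it cannot compensate for the degree of
  \<open>p(f)\<close> in the product \<open>p(f) * x'\<close>.\<close>

lemma generic_reduce:
  assumes x: "generic x" and eq: "x = poly_in f t + poly_in f p * x'"
    and deg: "degree t < degree p"
  shows "generic x' \<and> total_degree x' < total_degree x"
proof -
  have xA: "x \<in> A" and xR: "x \<notin> R" using x by (auto simp: generic_def)
  have p0: "p \<noteq> 0" using deg by auto
  have x'0: "x' \<noteq> 0" using eq xR poly_in_f_in_R by auto
  note tp = total_degree_poly_in[OF f_nonconst p0]
  have prod0: "poly_in f p * x' \<noteq> 0" using tp x'0 by simp
  have "poly_in f p * x' = x - poly_in f t" using eq by simp
  moreover have "x - poly_in f t \<in> A" using xA poly_in_f_in_R R_subset_A by (intro \<delta>.fixed.diff_closed) auto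
  ultimately have "x' * poly_in f p \<in> A" by (simp add: mult.commute)
  then have x'A: "x' \<in> A" using prod0 by (intro \<delta>.fixed_factorially_closed[of x' "poly_in f p"]) (auto simp: mult.commute)
  have x'R: "x' \<notin> R" using eq xR poly_in_f_in_R by (metis \<phi>.fixed.add_closed \<phi>.fixed.mult_closed)
  have td: "total_degree (poly_in f p * x') = degree p * total_degree f + total_degree x'"
    using total_degree_mult[of "poly_in f p" x'] tp x'0 by simp
  have "total_degree (poly_in f t) \<le> degree t * total_degree f"
    using total_degree_poly_in[OF f_nonconst, of t] by (cases "t = 0") (auto simp: total_degree_def homogenize_simps)
  moreover have "Suc (degree t) * total_degree f \<le> degree p * total_degree f" using deg by (intro mult_right_mono) auto
  ultimately have tt: "total_degree (poly_in f t) < degree p * total_degree f" using f_nonconst by simp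
  have less: "total_degree x' < total_degree x"
  proof (rule ccontr)
    assume "\<not> total_degree x' < total_degree x"
    let ?m = "max (total_degree x) (total_degree (poly_in f t))"
    have "total_degree (x - poly_in f t) \<le> ?m" by (intro total_degree_diff_le) auto
    moreover have "x - poly_in f t = poly_in f p * x'" using eq by simp
    ultimately have "degree p * total_degree f + total_degree x' \<le> ?m" using td by simp
    moreover have "?m < degree p * total_degree f + total_degree x'"
      using tt \<open>\<not> total_degree x' < total_degree x\<close> by auto
    ultimately show False by simp
  qed
  have "\<exists>g\<in>R. g \<noteq> 0 \<and> (\<exists>P\<in>polys_over R. g * a = poly P x')" if a: "a \<in> A" for a
  proof -
    obtain g P where g: "g \<in> R" "g \<noteq> 0" "P \<in> polys_over R" "g * a = poly P x"
      using x a unfolding generic_def by blast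
    let ?Q = "[:poly_in f t, poly_in f p:]"
    have "?Q \<in> polys_over R" using poly_in_f_in_R by (auto simp: polys_over_def coeff_pCons split: nat.splits)
    then have "pcompose P ?Q \<in> polys_over R" using g(3) by (intro polys_over_R_pcompose)
    moreover have "g * a = poly (pcompose P ?Q) x'" using g(4) eq by (simp add: poly_pcompose mult.commute)
    ultimately show ?thesis using g by blast
  qed
  then show ?thesis using x'A x'R less by (simp add: generic_def)
qed

text \<open>An element of least positive \<open>\<phi>\<close>-degree works: the denominators in its
  slice expansion are powers of its leading coefficient, which lies in \<open>R\<close>.\<close>

lemma generic_exists: "\<exists>x. generic x"
proof -
  obtain x where x: "x \<in> A \<and> \<phi>.dg x > 0" and min: "\<And>b. b \<in> A \<and> \<phi>.dg b > 0 \<Longrightarrow> \<phi>.dg x \<le> \<phi>.dg b"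
    using ex_has_least_nat[of "\<lambda>x. x \<in> A \<and> \<phi>.dg x > 0" y \<phi>.dg] y by blast
  let ?c = "F (\<phi>.dg x) x"
  have c: "?c \<in> R" using x by (intro \<phi>.D_dg_fixed) auto
  have "x \<noteq> 0" using x by auto
  then have c0: "?c \<noteq> 0" using \<phi>.D_dg_nonzero x by blast
  have "generic x"
    unfolding generic_def
  proof (intro conjI ballI)
    show "x \<in> A" "x \<notin> R" using x by (auto simp: \<phi>.fixed_def)
    fix a assume a: "a \<in> A"
    have "\<exists>N. \<exists>P\<in>polys_over R. ?c ^ N * a = poly P x"
      using x min a by (intro \<phi>.slice_expansion) auto
    then obtain N P where "P \<in> polys_over R" "?c ^ N * a = poly P x" by blast
    moreover have "?c ^ N \<in> R" "?c ^ N \<noteq> 0" using c c0 by auto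
    ultimately show "\<exists>g\<in>R. g \<noteq> 0 \<and> (\<exists>P\<in>polys_over R. g * a = poly P x)" by blast
  qed
  then show ?thesis by blast
qed

text \<open>A reduced denominator of \<open>a\<close> has a root \<open>c\<close> in the closure.
  Reduction at \<open>f = c\<close> yields a non-trivial polynomial relation for \<open>x\<close>
  modulo \<open>f - c\<close>, so \<open>x\<close> is congruent to a constant there. The cofactor of
  \<open>f - c\<close> in the minimal polynomial and a suitable functional turn this into a
  reduction of \<open>x\<close> over \<open>k\<close>.\<close>

lemma generic_or_reducible:
  assumes x: "generic x" and a: "a \<in> A" "\<not> (\<exists>P\<in>polys_over R. a = poly P x)"
  shows "\<exists>x'. generic x' \<and> total_degree x' < total_degree x"
proof -
  obtain g P where gP: "g \<in> R" "g \<noteq> 0" "P \<in> polys_over R" "g * a = poly P x"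
    using x a(1) unfolding generic_def by blast
  then obtain \<gamma>0 where "g = poly_in f \<gamma>0" using R_generated by blast
  then have ex: "\<gamma>0 \<noteq> 0 \<and> (\<exists>P\<in>polys_over R. poly_in f \<gamma>0 * a = poly P x)" using gP by auto
  obtain \<gamma> where \<gamma>: "\<gamma> \<noteq> 0 \<and> (\<exists>P\<in>polys_over R. poly_in f \<gamma> * a = poly P x)"
    and \<gamma>min: "\<And>\<gamma>'. \<gamma>' \<noteq> 0 \<and> (\<exists>P\<in>polys_over R. poly_in f \<gamma>' * a = poly P x) \<Longrightarrow> degree \<gamma> \<le> degree \<gamma>'"
    using ex_has_least_nat[of "\<lambda>\<gamma>. \<gamma> \<noteq> 0 \<and> (\<exists>P\<in>polys_over R. poly_in f \<gamma> * a = poly P x)" \<gamma>0 degree] ex by blast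
  obtain P where P: "P \<in> polys_over R" "poly_in f \<gamma> * a = poly P x" using \<gamma> by blast
  \<comment> \<open>A constant denominator is a unit, so \<open>a\<close> would already be a
    polynomial in \<open>x\<close> over \<open>R\<close>.\<close>
  have d\<gamma>: "degree \<gamma> > 0"
  proof (rule ccontr)
    assume "\<not> degree \<gamma> > 0"
    then obtain c where c: "\<gamma> = [:c:]" by (metis degree_0_id gr0I)
    then have c0: "c \<noteq> 0" using \<gamma> by auto
    have "const3 c * a = poly P x" using P(2) c by (simp add: eval_hom_const[OF comm_hom_const3] del: eval_hom_pCons)
    then have "a = poly (smult (const3 (inverse c)) P) x" using const3_cancel[OF c0, of a] by simp
    moreover have "smult (const3 (inverse c)) P \<in> polys_over R"
      using scalars P(1) by (intro \<phi>.fixed.polys_over_smult) auto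
    ultimately show False using a(2) by blast
  qed
  have "degree (map_poly to_ac \<gamma>) > 0" using d\<gamma> by (simp add: degree_map_poly)
  then obtain c where c: "poly (map_poly to_ac \<gamma>) c = 0" using alg_closed_imp_poly_has_root by blast
  obtain p where p: "lead_coeff p = 1" "poly (map_poly to_ac p) c = 0" "degree p > 0"
    and pdvd: "\<And>r. poly (map_poly to_ac r) c = 0 \<Longrightarrow> p dvd r"
    and pmin: "\<And>r. r \<noteq> 0 \<Longrightarrow> poly (map_poly to_ac r) c = 0 \<Longrightarrow> degree p \<le> degree r"
    using minimal_polynomial[of \<gamma> c] \<gamma> c by metis
  have p0: "p \<noteq> 0" using p(1) by auto
  have "\<forall>i. \<exists>q. coeff P i = poly_in f q" using R_generated polys_overD[OF P(1)] by blast
  from choice[OF this] obtain q where q: "\<And>i. coeff P i = poly_in f (q i)" by blast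
  let ?f = "to_ac3 f" and ?x = "to_ac3 x"
  let ?\<pi> = "?f - const3 c"
  \<comment> \<open>The numerator \<open>P\<close> modulo \<open>?\<pi>\<close>, where
    \<open>f\<close> becomes the constant \<open>c\<close>.\<close>
  define S where "S = (\<Sum>i\<le>degree P. monom (poly (map_poly to_ac (q i)) c) i)"
  have coeff_S: "coeff S i = (if i \<le> degree P then poly (map_poly to_ac (q i)) c else 0)" for i
    by (simp add: S_def coeff_sum)
  \<comment> \<open>Otherwise \<open>p\<close> divides all coefficients of the numerator as well as
    \<open>\<gamma>\<close>, and cancelling \<open>p(f)\<close> contradicts the least degree of
    \<open>\<gamma>\<close>.\<close>
  have S0: "S \<noteq> 0"
  proof
    assume "S = 0"
    then have "p dvd q i" if "i \<le> degree P" for i using coeff_S[of i] that by (intro pdvd) simp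
    then have qd: "q i = p * (q i div p)" if "i \<le> degree P" for i using that by simp
    obtain \<gamma>' where \<gamma>': "\<gamma> = p * \<gamma>'" using pdvd[OF c] by (auto elim: dvdE)
    have \<gamma>'0: "\<gamma>' \<noteq> 0" using \<gamma> \<gamma>' by auto
    define P' where "P' = (\<Sum>i\<le>degree P. monom (poly_in f (q i div p)) i)"
    interpret PR: closed_subring "polys_over R" by (rule \<phi>.fixed.closed_subring_polys_over)
    have P'R: "P' \<in> polys_over R"
      unfolding P'_def by (intro PR.sum_closed \<phi>.fixed.polys_over_monom poly_in_f_in_R)
    have "poly P x = (\<Sum>i\<le>degree P. poly_in f (q i) * x ^ i)" by (simp add: poly_altdef q)
    also have "\<dots> = (\<Sum>i\<le>degree P. poly_in f p * (poly_in f (q i div p) * x ^ i))"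
    proof (intro sum.cong refl)
      fix i assume "i \<in> {..degree P}"
      then have "poly_in f (q i) = poly_in f p * poly_in f (q i div p)"
        using qd[of i] poly_in_simps(3) by (metis atMost_iff)
      then show "poly_in f (q i) * x ^ i = poly_in f p * (poly_in f (q i div p) * x ^ i)" by simp
    qed
    also have "\<dots> = poly_in f p * poly P' x"
      by (simp add: P'_def poly_sum poly_monom sum_distrib_left)
    finally have "poly_in f p * (poly_in f \<gamma>' * a) = poly_in f p * poly P' x"
      using P(2) by (simp add: \<gamma>' poly_in_simps)
    moreover have "poly_in f p \<noteq> 0" using total_degree_poly_in[OF f_nonconst p0] by blast
    ultimately have "poly_in f \<gamma>' * a = poly P' x" by simp
    then have "degree \<gamma> \<le> degree \<gamma>'" using \<gamma>min \<gamma>'0 P'R by blast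
    moreover have "degree \<gamma> = degree p + degree \<gamma>'" unfolding \<gamma>' using p0 \<gamma>'0 by (rule degree_mult_eq)
    ultimately show False using p(3) by simp
  qed
  have rem: "?\<pi> dvd to_ac3 (poly_in f r) - const3 (poly (map_poly to_ac r) c)" for r
    unfolding poly_in_to_ac3 by (rule poly_in_remainder)
  have "?\<pi> dvd poly_in ?x S"
  proof -
    have "?\<pi> dvd to_ac3 (poly_in f \<gamma>)"
      using rem[of \<gamma>] c by (simp add: comm_homD(4)[OF comm_hom_const3])
    then have 1: "?\<pi> dvd to_ac3 (poly_in f \<gamma> * a)" by (simp add: to_ac3_simps)
    have "to_ac3 (poly_in f \<gamma> * a) = (\<Sum>i\<le>degree P. to_ac3 (poly_in f (q i)) * ?x ^ i)"
      by (simp add: P(2) poly_altdef q comm_hom_sum[OF comm_hom_to_ac3] to_ac3_simps)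
    moreover have "poly_in ?x S = (\<Sum>i\<le>degree P. const3 (poly (map_poly to_ac (q i)) c) * ?x ^ i)"
      by (simp add: S_def comm_hom_sum[OF comm_hom_poly_in] eval_hom_monom[OF comm_hom_const3])
    ultimately have "to_ac3 (poly_in f \<gamma> * a) - poly_in ?x S =
      (\<Sum>i\<le>degree P. (to_ac3 (poly_in f (q i)) - const3 (poly (map_poly to_ac (q i)) c)) * ?x ^ i)"
      by (simp add: sum_subtractf left_diff_distrib)
    moreover have "?\<pi> dvd \<dots>" by (intro dvd_sum dvd_mult2 rem)
    ultimately have "?\<pi> dvd to_ac3 (poly_in f \<gamma> * a) - poly_in ?x S" by (simp only:)
    from dvd_diff[OF 1 this] show ?thesis by (simp only: diff_diff_eq2 add_diff_cancel_left')
  qed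
  then obtain \<mu> where "?\<pi> dvd ?x - const3 \<mu>" using prime_dvd_poly_in[OF prime_fibre S0] by blast
  then obtain h where h: "?x - const3 \<mu> = ?\<pi> * h" by (auto elim: dvdE)
  define w where "w = synthetic_div (map_poly to_ac p) c"
  have w: "map_poly to_ac p = [:- c, 1:] * w"
    using synthetic_div_correct'[of c "map_poly to_ac p"] p(2) by (simp add: w_def)
  have "poly_in ?f [:- c, 1:] = ?\<pi>"
    by (simp add: poly_in_pCons comm_homD[OF comm_hom_const3] del: eval_hom_pCons)
  then have pw: "to_ac3 (poly_in f p) = ?\<pi> * poly_in ?f w"
    unfolding poly_in_to_ac3 w by (simp only: poly_in_simps)
  \<comment> \<open>Multiplying the congruence by \<open>w(f)\<close> completes the factor
    \<open>f - c\<close> to \<open>p(f)\<close>, which is defined over \<open>k\<close>, so a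
    functional can be applied to both sides.\<close>
  have key: "?x * poly_in ?f w + poly_in ?f (smult (- \<mu>) w) = to_ac3 (poly_in f p) * h"
  proof -
    have "smult (- \<mu>) w = [:- \<mu>:] * w" by simp
    then have "poly_in ?f (smult (- \<mu>) w) = poly_in ?f ([:- \<mu>:] * w)" by (rule arg_cong)
    also have "\<dots> = poly_in ?f [:- \<mu>:] * poly_in ?f w" by (rule poly_in_simps(3))
    also have "poly_in ?f [:- \<mu>:] = const3 (- \<mu>)" by (rule eval_hom_const[OF comm_hom_const3])
    finally have "?x * poly_in ?f w + poly_in ?f (smult (- \<mu>) w) = (?x - const3 \<mu>) * poly_in ?f w"
      by (simp add: comm_homD[OF comm_hom_const3] algebra_simps)
    also have "\<dots> = to_ac3 (poly_in f p) * h" unfolding h pw by (simp add: algebra_simps)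
    finally show ?thesis .
  qed
  obtain \<psi> where \<psi>: "ac_functional \<psi>" "\<And>i. i < degree p \<Longrightarrow> \<psi> (c ^ i) = (if i = degree p - 1 then 1 else 0)"
    using power_functional[of c "degree p"] pmin p(3) by metis
  \<comment> \<open>After applying \<open>\<psi>\<close>, the coefficient of \<open>x\<close> is
    therefore exactly 1.\<close>
  have \<psi>w: "map_poly \<psi> w = 1" unfolding w_def by (rule functional_synthetic_div[OF \<psi> p(1,3)])
  define t where "t = map_poly \<psi> (smult (- \<mu>) w)"
  have "x * ext3 \<psi> (poly_in ?f w) + ext3 \<psi> (poly_in ?f (smult (- \<mu>) w)) = poly_in f p * ext3 \<psi> h"
    using arg_cong[OF key, of "ext3 \<psi>"]
    by (simp only: ext3_functional_add[OF \<psi>(1)] ext3_functional_mult[OF \<psi>(1)])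
  then have "x + poly_in f t = poly_in f p * ext3 \<psi> h"
    by (simp only: functional_poly_in[OF \<psi>(1)] \<psi>w t_def poly_in_simps mult_1_right)
  then have eq: "x = poly_in f (- t) + poly_in f p * ext3 \<psi> h"
    by (simp add: poly_in_simps algebra_simps)
  have "degree t \<le> degree w"
    unfolding t_def by (intro degree_le allI impI)
      (simp add: coeff_map_poly ac_functionalD[OF \<psi>(1)] coeff_eq_0)
  also have "degree w = degree p - 1" by (simp add: w_def degree_synthetic_div degree_map_poly)
  finally have "degree (- t) < degree p" using p(3) by simp
  from generic_reduce[OF x eq this] show ?thesis by blast
qed

theorem fixed_is_polynomial_ring: "\<exists>x\<in>A. \<phi>.dg x > 0 \<and> (\<forall>a\<in>A. \<exists>P\<in>polys_over R. a = poly P x)"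
proof -
  obtain x0 where x0: "generic x0" using generic_exists by blast
  obtain x where x: "generic x" and min: "\<And>x'. generic x' \<Longrightarrow> total_degree x \<le> total_degree x'"
    using ex_has_least_nat[of generic x0 total_degree] x0 by blast
  have "\<exists>P\<in>polys_over R. a = poly P x" if "a \<in> A" for a
    using generic_or_reducible[OF x that] min by (meson not_le)
  moreover have "x \<in> A" "\<phi>.dg x > 0" using x by (auto simp: generic_def \<phi>.fixed_def)
  ultimately show ?thesis by blast
qed

theorem polynomial_ring2_fixed: "polynomial_ring2 const3 A"
proof -
  obtain x where x: "x \<in> A" "\<phi>.dg x > 0" and gen: "\<And>a. a \<in> A \<Longrightarrow> \<exists>P\<in>polys_over R. a = poly P x"
    using fixed_is_polynomial_ring by blast
  let ?e = "eval2 f x"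
  note e = comm_homD[OF comm_hom_eval2]
  have e_map: "?e P = poly (map_poly (poly_in f) P) x" for P by (simp add: eval2_def eval_hom_def)
  have e_monom: "?e (monom r i) = poly_in f r * x ^ i" for r i
    unfolding eval2_def by (rule eval_hom_monom[OF comm_hom_poly_in])
  have zero: "poly_in f 0 = 0" by simp
  have over: "map_poly (poly_in f) P \<in> polys_over R" for P
    by (intro polys_overI) (simp add: coeff_map_poly poly_in_f_in_R)
  have const: "?e (const2 c) = const3 c" for c
    by (simp only: const2_def eval2_def eval_hom_const[OF comm_hom_poly_in] eval_hom_const[OF comm_hom_const3])
  have lin: "Vector_Spaces.linear (scale_via const2) (scale_via const3) ?e"
  proof -
    interpret v2: vector_space "scale_via (const2 :: 'a \<Rightarrow> _)" by (rule vector_space_const2)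
    interpret v3: vector_space "scale_via (const3 :: 'a \<Rightarrow> _)" by (rule vector_space_const3)
    show ?thesis by unfold_locales (simp_all add: e scale_via_def const)
  qed
  have inj: "inj ?e"
  proof (rule injI)
    fix P Q assume "?e P = ?e Q"
    then have "?e (P - Q) = 0" by (simp add: e)
    then have 0: "map_poly (poly_in f) (P - Q) = 0"
      using \<phi>.transcendental[OF over x] by (simp add: e_map)
    have "coeff (P - Q) i = 0" for i
    proof (rule ccontr)
      assume "coeff (P - Q) i \<noteq> 0"
      then have "poly_in f (coeff (P - Q) i) \<noteq> 0" using total_degree_poly_in[OF f_nonconst] by blast
      moreover have "poly_in f (coeff (P - Q) i) = coeff (map_poly (poly_in f) (P - Q)) i"
        by (rule coeff_map_poly[of "poly_in f", OF zero, symmetric])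
      ultimately show False unfolding 0 by simp
    qed
    then have "P - Q = 0" by (intro poly_eqI) (simp only: coeff_0)
    then show "P = Q" by simp
  qed
  have "range ?e = A"
  proof (intro equalityI subsetI)
    fix a assume "a \<in> range ?e"
    then obtain P where "a = poly (map_poly (poly_in f) P) x" using e_map by blast
    moreover have "map_poly (poly_in f) P \<in> polys_over A" by (rule polys_over_mono[OF over R_subset_A])
    ultimately show "a \<in> A" using x(1) \<delta>.fixed.poly_closed by blast
  next
    fix a assume "a \<in> A"
    then obtain P where P: "P \<in> polys_over R" "a = poly P x" using gen by blast
    have "\<forall>i. \<exists>q. coeff P i = poly_in f q" using R_generated polys_overD[OF P(1)] by blast
    from choice[OF this] obtain q where q: "\<And>i. coeff P i = poly_in f (q i)" by blast
    define Q where "Q = (\<Sum>i\<le>degree P. monom (q i) i)"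
    have "?e Q = (\<Sum>i\<le>degree P. poly_in f (q i) * x ^ i)"
      by (simp only: Q_def comm_hom_sum[OF comm_hom_eval2] e_monom)
    also have "\<dots> = a" by (simp add: P(2) poly_altdef q)
    finally show "a \<in> range ?e" by blast
  qed
  then have "bij_betw ?e UNIV A" using inj by (simp add: bij_betw_def)
  then show ?thesis unfolding polynomial_ring2_def using lin e(1,3) by blast
qed

end

section \<open>Conclusion\<close>

lemma exp_map_on_of_exponential_map:
  fixes D :: "nat \<Rightarrow> 'k::field poly poly poly \<Rightarrow> 'k poly poly poly"
  assumes "exponential_map const3 D"
  shows "exp_map_on UNIV D" "k_linear (D n)"
proof -
  have lin: "Vector_Spaces.linear (scale_via const3) (scale_via const3) (D n)" for n
    using assms by (simp add: exponential_map_def)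
  have add: "D n (a + b) = D n a + D n b" for n a b
  proof -
    interpret Vector_Spaces.linear "scale_via const3" "scale_via const3" "D n" by (rule lin)
    show ?thesis by (rule add)
  qed
  have scale: "D n (const3 c * a) = const3 c * D n a" for n c a
  proof -
    interpret Vector_Spaces.linear "scale_via const3" "scale_via const3" "D n" by (rule lin)
    show ?thesis using scale[of c a] by (simp add: scale_via_def)
  qed
  show "k_linear (D n)" using add scale by (simp add: k_linear_def)
  have fin: "\<exists>n. \<forall>i\<ge>n. D i a = 0" and D0: "D 0 = id"
    and mult: "D n (a * b) = (\<Sum>i=0..n. D i a * D (n - i) b)"
    and comp: "D j (D i a) = of_nat ((i + j) choose j) * D (i + j) a" for n a b i j
    using assms unfolding exponential_map_def by blast+
  show "exp_map_on UNIV D"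
    by unfold_locales (use add fin D0 mult comp in \<open>simp_all add: atMost_atLeast0\<close>)
qed

lemma (in exp_map_on) fixed_eq_invariants:
  assumes "A = UNIV" shows "fixed = invariants D"
proof -
  have eq: "degree (exp_poly D b) = 0 \<longleftrightarrow> exp_poly D b = [:b:]" for b
  proof
    assume "degree (exp_poly D b) = 0"
    then have "exp_poly D b = [:coeff (exp_poly D b) 0:]" by (metis degree_0_id)
    moreover have "coeff (exp_poly D b) 0 = b" using assms by (simp add: coeff_E)
    ultimately show "exp_poly D b = [:b:]" by (simp only:)
  next
    assume "exp_poly D b = [:b:]"
    then show "degree (exp_poly D b) = 0" by (simp only: degree_pCons_0)
  qed
  have "fixed = {a \<in> A. dg a = 0}" by (rule fixed_def)
  also have "\<dots> = invariants D" unfolding invariants_def eq using assms by blast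
  finally show ?thesis .
qed

lemma const3_fixed:
  assumes D: "exp_map_on A D" and lin: "\<And>n. k_linear (D n)" and c: "const3 c \<in> A"
  shows "const3 c \<in> exp_map_on.fixed A D"
proof -
  interpret exp_map_on A D by (rule D)
  show ?thesis
  proof (rule fixedI[OF c])
    fix n :: nat assume "n > 0"
    have "D n (const3 c) = const3 c * D n 1" using k_linearD(2)[OF lin, of n c 1] by simp
    also have "D n 1 = 0" using \<open>n > 0\<close> by (intro D_above_dg) auto
    finally show "D n (const3 c) = 0" by simp
  qed
qed

text \<open>An invariant of \<open>F\<close> not fixed by \<open>D\<close> has a non-constant slice
  expansion, which is an algebraic equation for \<open>s\<close> over the invariants of
  \<open>F\<close>. Then \<open>s\<close> is \<open>F\<close>-invariant, and by slice expansion so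
  is every element, against non-triviality.\<close>

lemma fixed_subset_imp_eq:
  assumes \<delta>: "exp_map_on UNIV D" and \<alpha>: "exp_map_on UNIV F"
    and sub: "exp_map_on.fixed UNIV D \<subseteq> exp_map_on.fixed UNIV F" and nontriv: "exp_map_on.fixed UNIV F \<noteq> UNIV"
    and s: "degree (exp_poly D s) > 0" "\<And>b. degree (exp_poly D b) > 0 \<Longrightarrow> degree (exp_poly D s) \<le> degree (exp_poly D b)"
  shows "exp_map_on.fixed UNIV D = exp_map_on.fixed UNIV F"
proof -
  interpret \<delta>: exp_map_on UNIV D by fact
  interpret \<alpha>: exp_map_on UNIV F by fact
  let ?c = "D (\<delta>.dg s) s"
  have c: "?c \<in> \<delta>.fixed" by (intro \<delta>.D_dg_fixed) auto
  have "s \<noteq> 0" using s(1) by auto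
  then have c0: "?c \<noteq> 0" using \<delta>.D_dg_nonzero by blast
  have ex: "\<exists>N. \<exists>P\<in>polys_over \<delta>.fixed. ?c ^ N * b = poly P s" for b
    using s by (intro \<delta>.slice_expansion) auto
  have "b \<in> \<delta>.fixed" if b: "b \<in> \<alpha>.fixed" for b
  proof (rule ccontr)
    assume nb: "b \<notin> \<delta>.fixed"
    obtain N P where P: "P \<in> polys_over \<delta>.fixed" "?c ^ N * b = poly P s" using ex by blast
    have cN: "?c ^ N \<in> \<delta>.fixed" using c by auto
    have b0: "b \<noteq> 0" using nb by auto
    have "degree P \<noteq> 0"
    proof
      assume "degree P = 0"
      then have "poly P s = coeff P 0" by (metis degree_0_id poly_const_conv)
      then have "b * ?c ^ N \<in> \<delta>.fixed" using P polys_overD by (metis mult.commute)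
      then show False using nb \<delta>.fixed_factorially_closed[of b "?c ^ N"] b0 c0 by simp
    qed
    define Q where "Q = P - [:?c ^ N * b:]"
    interpret PO: closed_subring "polys_over \<alpha>.fixed" by (rule \<alpha>.fixed.closed_subring_polys_over)
    have "Q \<in> polys_over \<alpha>.fixed"
      unfolding Q_def using P(1) sub cN b by (intro PO.diff_closed \<alpha>.fixed.polys_over_const \<alpha>.fixed.mult_closed) (auto intro: polys_over_mono)
    moreover have "Q \<noteq> 0"
    proof
      assume "Q = 0"
      then have "P = [:?c ^ N * b:]" by (simp add: Q_def)
      then have "degree P = 0" by (metis degree_pCons_0)
      then show False using \<open>degree P \<noteq> 0\<close> by blast
    qed
    moreover have "poly Q s = 0" using P(2) by (simp add: Q_def)
    ultimately have s\<alpha>: "s \<in> \<alpha>.fixed" by (rule \<alpha>.fixed_algebraically_closed) auto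
    have "x \<in> \<alpha>.fixed" for x
    proof -
      obtain M S where S: "S \<in> polys_over \<delta>.fixed" "?c ^ M * x = poly S s" using ex by blast
      have "poly S s \<in> \<alpha>.fixed" using S(1) sub s\<alpha> polys_over_mono \<alpha>.fixed.poly_closed by blast
      then have xc: "x * ?c ^ M \<in> \<alpha>.fixed" using S(2) by (simp only: mult.commute[of x])
      show ?thesis
      proof (cases "x = 0")
        case True then show ?thesis by simp
      next
        case False
        then have "x * ?c ^ M \<noteq> 0" using c0 by simp
        then show ?thesis by (rule \<alpha>.fixed_factorially_closed[OF xc]) auto
      qed
    qed
    then show False using nontriv by blast
  qed
  then show ?thesis using sub by blast
qed

text \<open>If the smaller ring consists of constants, the leading coefficients of both slices are
  units. The two slice expansions then hold without denominators, and \<open>y\<close> and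
  \<open>s\<close> generate the polynomial ring in three variables.\<close>

lemma no_constant_tower:
  fixes D F :: "nat \<Rightarrow> 'k::field poly poly poly \<Rightarrow> 'k poly poly poly"
  assumes \<delta>: "exp_map_on UNIV D" and \<phi>: "exp_map_on (exp_map_on.fixed UNIV D) F"
    and R: "exp_map_on.fixed (exp_map_on.fixed UNIV D) F \<subseteq> range const3"
    and c: "D (degree (exp_poly D s)) s \<in> exp_map_on.fixed (exp_map_on.fixed UNIV D) F"
    and s: "degree (exp_poly D s) > 0" "\<And>b. degree (exp_poly D b) > 0 \<Longrightarrow> degree (exp_poly D s) \<le> degree (exp_poly D b)"
    and y: "y \<in> exp_map_on.fixed UNIV D" "degree (exp_poly F y) > 0"
      "\<And>b. b \<in> exp_map_on.fixed UNIV D \<Longrightarrow> degree (exp_poly F b) > 0 \<Longrightarrow> degree (exp_poly F y) \<le> degree (exp_poly F b)"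
  shows False
proof (rule not_generated_by_two[of y s])
  interpret \<delta>: exp_map_on UNIV D by fact
  interpret \<phi>: exp_map_on \<delta>.fixed F by fact
  fix U :: "'k poly poly poly set"
  assume U: "closed_subring U" "range const3 \<union> {y, s} \<subseteq> U"
  interpret U: closed_subring U by fact
  have cancel: "b \<in> U" if e: "e \<in> range const3" "e \<noteq> 0" and eb: "e * b \<in> U" for e b
  proof -
    obtain x where x: "e = const3 x" using e(1) by blast
    then have "x \<noteq> 0" using e(2) by auto
    have "const3 (inverse x) \<in> U" using U(2) by auto
    then have "const3 (inverse x) * (const3 x * b) \<in> U" using eb unfolding x by (rule U.mult_closed)
    then show ?thesis unfolding const3_cancel[OF \<open>x \<noteq> 0\<close>] .
  qed
  have "y \<noteq> 0" "s \<noteq> 0" using y(2) s(1) by auto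
  have AU: "a \<in> U" if a: "a \<in> \<delta>.fixed" for a
  proof -
    let ?e = "F (\<phi>.dg y) y"
    obtain N P where P: "P \<in> polys_over \<phi>.fixed" "?e ^ N * a = poly P y"
      using \<phi>.slice_expansion[OF y a] by blast
    have e: "?e \<in> \<phi>.fixed" using y(1) by (intro \<phi>.D_dg_fixed) auto
    have e0: "?e \<noteq> 0" using \<phi>.D_dg_nonzero y(1) \<open>y \<noteq> 0\<close> by blast
    have "?e ^ N \<in> \<phi>.fixed" using e by auto
    then have eN: "?e ^ N \<in> range const3" using R by blast
    have "poly P y \<in> U" using P(1) R U(2) by (intro U.poly_closed) (auto intro: polys_over_mono)
    then have "?e ^ N * a \<in> U" using P(2) by (simp only:)
    then show ?thesis by (rule cancel[OF eN power_not_zero[OF e0]])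
  qed
  have "b \<in> U" for b
  proof -
    let ?c = "D (\<delta>.dg s) s"
    have "\<exists>N. \<exists>P\<in>polys_over \<delta>.fixed. ?c ^ N * b = poly P s" using s by (intro \<delta>.slice_expansion) auto
    then obtain N P where P: "P \<in> polys_over \<delta>.fixed" "?c ^ N * b = poly P s" by blast
    have c0: "?c \<noteq> 0" using \<delta>.D_dg_nonzero \<open>s \<noteq> 0\<close> by blast
    have "?c ^ N \<in> \<phi>.fixed" using c by auto
    then have cN: "?c ^ N \<in> range const3" using R by blast
    have "P \<in> polys_over U" using P(1) AU by (auto simp: polys_over_def)
    then have "poly P s \<in> U" using U(2) by (intro U.poly_closed) auto
    then have "?c ^ N * b \<in> U" using P(2) by (simp only:)
    then show ?thesis by (rule cancel[OF cN power_not_zero[OF c0]])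
  qed
  then show "U = UNIV" by auto
qed

lemma k_linear_comp: "k_linear g \<Longrightarrow> k_linear h \<Longrightarrow> k_linear (\<lambda>x. g (h x))"
  by (simp add: k_linear_def)

lemma k_linear_zero: "k_linear (\<lambda>x. 0)"
  by (simp add: k_linear_def)

theorem polynomial_ring2_of_moving_map:
  fixes D \<alpha> :: "nat \<Rightarrow> 'k::field poly poly poly \<Rightarrow> 'k poly poly poly"
  assumes \<delta>: "exp_map_on UNIV D" and Dlin: "\<And>n. k_linear (D n)"
    and \<alpha>: "exp_map_on UNIV \<alpha>" and \<alpha>lin: "\<And>n. k_linear (\<alpha> n)"
    and s: "degree (exp_poly D s) > 0" "\<And>b. degree (exp_poly D b) > 0 \<Longrightarrow> degree (exp_poly D s) \<le> degree (exp_poly D b)"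
    and c: "D (degree (exp_poly D s)) s \<in> exp_map_on.fixed UNIV \<alpha>"
    and moves: "\<not> exp_map_on.fixed UNIV D \<subseteq> exp_map_on.fixed UNIV \<alpha>"
  shows "polynomial_ring2 const3 (exp_map_on.fixed UNIV D)"
proof -
  interpret \<delta>: exp_map_on UNIV D by fact
  interpret \<alpha>: exp_map_on UNIV \<alpha> by fact
  have k\<delta>: "range const3 \<subseteq> \<delta>.fixed" using const3_fixed[OF \<delta> Dlin] by auto
  have k\<alpha>: "range const3 \<subseteq> \<alpha>.fixed" using const3_fixed[OF \<alpha> \<alpha>lin] by auto
  interpret H: homogenization D \<alpha> "range const3" "{X3, Y3, Z3}" s
  proof unfold_locales
    show "U = UNIV" if "closed_subring U" "range const3 \<union> {X3, Y3, Z3} \<subseteq> U" for U :: "'k poly poly poly set"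
      using that by (rule poly3_generated)
    show "D (\<delta>.dg s) s \<in> \<alpha>.fixed" by (rule c)
    show "range const3 \<subseteq> \<delta>.fixed" by (rule k\<delta>)
    show "range const3 \<subseteq> \<alpha>.fixed" by (rule k\<alpha>)
    show "\<not> \<delta>.fixed \<subseteq> \<alpha>.fixed" by (rule moves)
    show "\<delta>.dg s > 0" by (rule s(1))
    show "\<delta>.dg s \<le> \<delta>.dg b" if "\<delta>.dg b > 0" for b using that by (rule s(2))
  qed simp
  obtain u v where uv: "v > 0"
    and \<phi>: "exp_map_on \<delta>.fixed (\<lambda>j b. if v dvd u * j then D (u * j div v) (\<alpha> j b) else 0)"
    and nontriv: "\<exists>a\<in>\<delta>.fixed. \<exists>j>0. (if v dvd u * j then D (u * j div v) (\<alpha> j a) else 0) \<noteq> 0"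
    by (rule H.homogenized_exp_map)
  define F where "F = (\<lambda>j b. if v dvd u * j then D (u * j div v) (\<alpha> j b) else 0)"
  interpret \<phi>: exp_map_on \<delta>.fixed F using \<phi> by (simp add: F_def)
  have Flin: "k_linear (F j)" for j
    by (cases "v dvd u * j") (simp_all add: F_def k_linear_zero k_linear_comp[OF Dlin \<alpha>lin])
  have kF: "range const3 \<subseteq> \<phi>.fixed"
    using const3_fixed[OF \<phi>.exp_map_on_axioms Flin] k\<delta> by blast
  interpret tower D F by unfold_locales (use Dlin Flin kF in auto)
  have "\<exists>a\<in>\<delta>.fixed. \<exists>j>0. F j a \<noteq> 0" unfolding F_def by (rule nontriv)
  then obtain a j where a: "a \<in> \<delta>.fixed" "j > 0" "F j a \<noteq> 0" by blast
  have "j \<le> \<phi>.dg a" by (rule \<phi>.le_dg[OF a(1,3)])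
  then have "\<phi>.dg a > 0" using a(2) by linarith
  with a(1) have aex: "a \<in> \<delta>.fixed \<and> \<phi>.dg a > 0" by (rule conjI)
  from ex_has_least_nat[of "\<lambda>y. y \<in> \<delta>.fixed \<and> \<phi>.dg y > 0", OF aex, of \<phi>.dg]
  obtain y where y: "(y \<in> \<delta>.fixed \<and> \<phi>.dg y > 0) \<and>
      (\<forall>b. b \<in> \<delta>.fixed \<and> \<phi>.dg b > 0 \<longrightarrow> \<phi>.dg y \<le> \<phi>.dg b)"
    by (rule exE)
  let ?c = "D (\<delta>.dg s) s"
  \<comment> \<open>Prepares \<open>no_constant_tower\<close>: if all of \<open>\<phi>.fixed\<close>
    were constant, \<open>?c\<close> would be a unit.\<close>
  have c\<phi>: "?c \<in> \<phi>.fixed"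
  proof (rule \<phi>.fixedI)
    show "?c \<in> \<delta>.fixed" by (intro \<delta>.D_dg_fixed) auto
    fix n :: nat assume "n > 0"
    with c have "\<alpha> n ?c = 0" by (rule \<alpha>.fixedD)
    then show "F n ?c = 0" by (simp only: F_def \<delta>.D_zero if_cancel)
  qed
  have "\<not> \<phi>.fixed \<subseteq> range const3"
  proof
    assume *: "\<phi>.fixed \<subseteq> range const3"
    show False
    proof (rule no_constant_tower[OF \<delta> \<phi>.exp_map_on_axioms * c\<phi> s])
      show "y \<in> \<delta>.fixed" "\<phi>.dg y > 0" using y by auto
      show "\<phi>.dg y \<le> \<phi>.dg b" if "b \<in> \<delta>.fixed" "\<phi>.dg b > 0" for b
        using y that by blast
    qed
  qed
  then obtain g where g: "g \<in> \<phi>.fixed" "g \<notin> range const3" by blast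
  then have gex: "g \<in> \<phi>.fixed \<and> total_degree g > 0"
    using total_degree_eq_0_iff[of g] by (metis gr0I)
  from ex_has_least_nat[of "\<lambda>f. f \<in> \<phi>.fixed \<and> total_degree f > 0", OF gex, of total_degree]
  obtain f where f: "(f \<in> \<phi>.fixed \<and> total_degree f > 0) \<and>
      (\<forall>g. g \<in> \<phi>.fixed \<and> total_degree g > 0 \<longrightarrow> total_degree f \<le> total_degree g)"
    by (rule exE)
  \<comment> \<open>Removing the constant term changes neither membership nor total degree, so
    \<open>f0\<close> is still minimal and satisfies the normalization of
    \<open>tower_generator\<close>.\<close>
  define f0 where "f0 = f - const3 (const_term f)"
  have td: "total_degree f0 = total_degree f" using f by (simp add: f0_def total_degree_diff_const)
  have f0: "f0 \<in> \<phi>.fixed" unfolding f0_def using f kF by (intro \<phi>.fixed.diff_closed) auto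
  interpret tower_slices D F f0 y s
  proof unfold_locales
    show "total_degree f0 > 0" using td f by simp
    show "total_degree f0 \<le> total_degree g" if "g \<in> \<phi>.fixed" "total_degree g > 0" for g
      unfolding td using f that by blast
    show "const_term f0 = 0" by (simp add: f0_def comm_homD[OF comm_hom_const_term])
  qed (use f0 y s in auto)
  show ?thesis by (rule polynomial_ring2_fixed)
qed

theorem theorem3p8:
  fixes D :: "nat \<Rightarrow> 'k::field poly poly poly \<Rightarrow> 'k poly poly poly"
  assumes "exponential_map (const3 :: 'k \<Rightarrow> 'k poly poly poly) D"
    and "\<exists>x \<in> plinth D. quasi_basic (const3 :: 'k \<Rightarrow> 'k poly poly poly) x"
  shows "polynomial_ring2 (const3 :: 'k \<Rightarrow> 'k poly poly poly) (invariants D)"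
proof -
  obtain x where x: "x \<in> plinth D" "quasi_basic const3 x" using assms(2) by blast
  obtain \<alpha> \<beta> where ab: "exponential_map const3 \<alpha>" "exponential_map const3 \<beta>"
      "nontrivial \<alpha>" "nontrivial \<beta>" "invariants \<alpha> \<noteq> invariants \<beta>"
      "x \<in> invariants \<alpha>" "x \<in> invariants \<beta>" "x \<noteq> 0"
    using x(2) unfolding quasi_basic_def by blast
  obtain s where s: "x = lead_coeff (exp_poly D s)" "local_slice D s"
    using x(1) ab(8) unfolding plinth_def by auto
  note \<delta> = exp_map_on_of_exponential_map[OF assms(1)]
  note \<alpha> = exp_map_on_of_exponential_map[OF ab(1)]
  note \<beta> = exp_map_on_of_exponential_map[OF ab(2)]
  interpret \<delta>: exp_map_on UNIV D by (rule \<delta>(1))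
  interpret \<alpha>: exp_map_on UNIV \<alpha> by (rule \<alpha>(1))
  interpret \<beta>: exp_map_on UNIV \<beta> by (rule \<beta>(1))
  note inv = \<delta>.fixed_eq_invariants[OF refl] \<alpha>.fixed_eq_invariants[OF refl] \<beta>.fixed_eq_invariants[OF refl]
  have s': "\<delta>.dg s > 0" "\<And>b. \<delta>.dg b > 0 \<Longrightarrow> \<delta>.dg s \<le> \<delta>.dg b"
    using s(2) by (auto simp: local_slice_def)
  have xs: "x = D (\<delta>.dg s) s" unfolding s(1) by (rule \<delta>.coeff_E) simp
  have eq: "\<delta>.fixed = \<alpha>.fixed" if "\<delta>.fixed \<subseteq> \<alpha>.fixed"
    using ab(3) by (intro fixed_subset_imp_eq[OF \<delta>(1) \<alpha>(1) that _ s']) (simp add: nontrivial_def inv(2))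
  have eq': "\<delta>.fixed = \<beta>.fixed" if "\<delta>.fixed \<subseteq> \<beta>.fixed"
    using ab(4) by (intro fixed_subset_imp_eq[OF \<delta>(1) \<beta>(1) that _ s']) (simp add: nontrivial_def inv(3))
  have "\<alpha>.fixed \<noteq> \<beta>.fixed" unfolding inv(2,3) by (rule ab(5))
  then have "\<not> \<delta>.fixed \<subseteq> \<alpha>.fixed \<or> \<not> \<delta>.fixed \<subseteq> \<beta>.fixed"
    using eq eq' by blast
  then have "polynomial_ring2 const3 \<delta>.fixed"
  proof
    assume "\<not> \<delta>.fixed \<subseteq> \<alpha>.fixed"
    then show ?thesis
      using ab(6) xs inv(2) by (intro polynomial_ring2_of_moving_map[OF \<delta> \<alpha> s']) auto
  next
    assume "\<not> \<delta>.fixed \<subseteq> \<beta>.fixed"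
    then show ?thesis
      using ab(7) xs inv(3) by (intro polynomial_ring2_of_moving_map[OF \<delta> \<beta> s']) auto
  qed
  then show ?thesis unfolding inv(1) .
qed

end
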